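(* For two reclaimers with given stockpile positions and no precedence constraints, a contiguous unimodal schedule of minimum makespan (among all contiguous unimodal schedules) can be computed in time quadratic in the number of stockpiles.
   Context: Reclaimer scheduling model. Two pads $P_1,P_2$ are each modeled as $[0,L]$, $L$ a positive integer. Stockpiles $1,\dots,n_1$ lie on $P_1$ and $n_1+1,\dots,n$ on $P_2$; stockpile $j$ occupies $[l_j,r_j]\subseteq[0,L]$ with integers $l_j<r_j$, non-overlapping on each pad and indexed left to right on each pad. Reclaimers $R_0,R_1$ move on a rail represented by $[0,L]$; $R_0$ starts and ends at $0$, $R_1$ at $L$. Reclaim speed $1$, travel speed $s\ge1$. A schedule of $R_k$ with makespan $C_k$ is a continuous piecewise linear $H_k:[0,C_k]\to[0,L]$, $H_k(0)=H_k(C_k)=kL$ (extended by $kL$ afterwards), with pieces of slope $0$, $\pm s$ (travel) or $\pm1$ (reclaiming on one of the pads). Each stockpile must be reclaimed by traversing all of $[l_j,r_j]$ once at speed $1$ by one reclaimer, in either direction; feasibility requires $H_0(t)\le H_1(t)$ for all $t$; the makespan is $\max(C_0,C_1)$. A schedule is contiguous unimodal if each reclaimer changes direction exactly once, $R_0$ reclaims everything on one pad between $0$ and some point while moving right (from left to right) and then everything on the other pad from some (possibly different) point back to $0$ while moving left, and $R_1$ reclaims everything on one pad between $L$ and some point while moving left and then everything on the other pad from some (possibly different) point back to $L$ while moving right; every stockpile is reclaimed by exactly one of them. *)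

theory Defs
  imports Complex_Main "HOL-Library.Multiset"
begin

section \<open>Reclaimer scheduling\<close>

datatype pad = Pad1 | Pad2
datatype reclaimer = R0 | R1
datatype direction = Leftward | Rightward

record stockyard =
  pad_length :: int
  num :: nat
  num1 :: nat
  left_end :: "nat \<Rightarrow> int"
  right_end :: "nat \<Rightarrow> int"
  speed :: real

fun stockpiles :: "stockyard \<Rightarrow> pad \<Rightarrow> nat set" where
  "stockpiles Y Pad1 = {1..num1 Y}"
| "stockpiles Y Pad2 = {num1 Y + 1..num Y}"

fun other_pad :: "pad \<Rightarrow> pad" where
  "other_pad Pad1 = Pad2"
| "other_pad Pad2 = Pad1"

definition valid_stockyard :: "stockyard \<Rightarrow> bool" where
  "valid_stockyard Y \<longleftrightarrow>
     0 < pad_length Y \<and> 1 \<le> speed Y \<and> 1 \<le> num Y \<and> num1 Y \<le> num Y \<and>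
     (\<forall>j\<in>{1..num Y}. 0 \<le> left_end Y j \<and> left_end Y j < right_end Y j
                       \<and> right_end Y j \<le> pad_length Y) \<and>
     (\<forall>p. \<forall>i\<in>stockpiles Y p. \<forall>j\<in>stockpiles Y p. i < j \<longrightarrow> right_end Y i \<le> left_end Y j)"

text \<open>
  The continuous piecewise linear path of a reclaimer is given by the list of its pieces, each with
  its duration.  The moves label the pieces because the slope alone does not tell travelling from
  reclaiming (the speed may be 1), nor which pad is served.  One reclaiming piece is one complete
  traversal of one stockpile; adjacent stockpiles give consecutive pieces.
\<close>

datatype move = Wait | Travel direction | Reclaim nat direction

type_synonym trajectory = "(move \<times> real) list"
type_synonym schedule = "reclaimer \<Rightarrow> trajectory"

fun signum :: "direction \<Rightarrow> real" where
  "signum Leftward = - 1"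
| "signum Rightward = 1"

fun velocity :: "real \<Rightarrow> move \<Rightarrow> real" where
  "velocity s Wait = 0"
| "velocity s (Travel D) = signum D * s"
| "velocity s (Reclaim j D) = signum D"

definition duration :: "trajectory \<Rightarrow> real" where
  "duration ps = sum_list (map snd ps)"

text \<open>
  \<open>path s x ps t\<close> is the position at time \<open>t \<ge> 0\<close> when starting in \<open>x\<close> at time 0; after the last
  piece the position stays constant.
\<close>

fun path :: "real \<Rightarrow> real \<Rightarrow> trajectory \<Rightarrow> real \<Rightarrow> real" where
  "path s x [] t = x"
| "path s x ((m, d) # ps) t =
     (if t \<le> d then x + velocity s m * t else path s (x + velocity s m * d) ps (t - d))"

fun home :: "stockyard \<Rightarrow> reclaimer \<Rightarrow> real" where
  "home Y R0 = 0"
| "home Y R1 = real_of_int (pad_length Y)"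

definition pos :: "stockyard \<Rightarrow> schedule \<Rightarrow> reclaimer \<Rightarrow> real \<Rightarrow> real" where
  "pos Y S k = path (speed Y) (home Y k) (S k)"

fun entry :: "stockyard \<Rightarrow> nat \<Rightarrow> direction \<Rightarrow> int" where
  "entry Y j Rightward = left_end Y j"
| "entry Y j Leftward = right_end Y j"

fun reclaimed_stockpile :: "move \<Rightarrow> nat option" where
  "reclaimed_stockpile (Reclaim j D) = Some j"
| "reclaimed_stockpile _ = None"

definition stockpiles_of :: "trajectory \<Rightarrow> nat list" where
  "stockpiles_of ps = List.map_filter (reclaimed_stockpile \<circ> fst) ps"

definition reclaimer_schedule :: "stockyard \<Rightarrow> schedule \<Rightarrow> reclaimer \<Rightarrow> bool" where
  "reclaimer_schedule Y S k \<longleftrightarrow>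
     (\<forall>(m, d)\<in>set (S k). 0 < d) \<and>
     (\<forall>i<length (S k). \<forall>j D d. S k ! i = (Reclaim j D, d) \<longrightarrow>
        pos Y S k (duration (take i (S k))) = real_of_int (entry Y j D) \<and>
        d = real_of_int (right_end Y j - left_end Y j)) \<and>
     pos Y S k (duration (S k)) = home Y k \<and>
     (\<forall>t\<in>{0..duration (S k)}. pos Y S k t \<in> {0..real_of_int (pad_length Y)})"

definition feasible :: "stockyard \<Rightarrow> schedule \<Rightarrow> bool" where
  "feasible Y S \<longleftrightarrow>
     (\<forall>k. reclaimer_schedule Y S k) \<and>
     mset (stockpiles_of (S R0)) + mset (stockpiles_of (S R1)) = mset_set {1..num Y} \<and>
     (\<forall>t\<ge>0. pos Y S R0 t \<le> pos Y S R1 t)"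

definition makespan :: "schedule \<Rightarrow> real" where
  "makespan S = max (duration (S R0)) (duration (S R1))"


section \<open>Contiguous unimodal schedules\<close>

fun move_direction :: "move \<Rightarrow> direction option" where
  "move_direction Wait = None"
| "move_direction (Travel D) = Some D"
| "move_direction (Reclaim j D) = Some D"

text \<open>
  Waiting does not count; \<open>remdups_adj\<close> leaves one entry for each maximal run of equal directions.
\<close>

definition direction_changes :: "trajectory \<Rightarrow> nat" where
  "direction_changes ps =
     length (remdups_adj (List.map_filter (move_direction \<circ> fst) ps)) - 1"

definition reclaimed :: "trajectory \<Rightarrow> direction \<Rightarrow> nat set" where
  "reclaimed ps D = {j. \<exists>d. (Reclaim j D, d) \<in> set ps}"

fun outward :: "reclaimer \<Rightarrow> direction" where
  "outward R0 = Rightward"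
| "outward R1 = Leftward"

fun homeward :: "reclaimer \<Rightarrow> direction" where
  "homeward R0 = Leftward"
| "homeward R1 = Rightward"

text \<open>The stockpiles of a pad that lie between the home of the reclaimer and the point \<open>x\<close>.\<close>

fun on_home_side :: "stockyard \<Rightarrow> reclaimer \<Rightarrow> pad \<Rightarrow> real \<Rightarrow> nat set" where
  "on_home_side Y R0 p x = {j \<in> stockpiles Y p. real_of_int (right_end Y j) \<le> x}"
| "on_home_side Y R1 p x = {j \<in> stockpiles Y p. x \<le> real_of_int (left_end Y j)}"

definition contiguous_unimodal :: "stockyard \<Rightarrow> schedule \<Rightarrow> bool" where
  "contiguous_unimodal Y S \<longleftrightarrow>
     feasible Y S \<and>
     (\<forall>k. direction_changes (S k) = 1 \<and>
        (\<exists>p. \<exists>x\<in>{0..real_of_int (pad_length Y)}. \<exists>y\<in>{0..real_of_int (pad_length Y)}.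
           reclaimed (S k) (outward k) = on_home_side Y k p x \<and>
           reclaimed (S k) (homeward k) = on_home_side Y k (other_pad p) y))"

definition optimal_contiguous_unimodal :: "stockyard \<Rightarrow> schedule \<Rightarrow> bool" where
  "optimal_contiguous_unimodal Y S \<longleftrightarrow>
     contiguous_unimodal Y S \<and>
     (\<forall>S'. contiguous_unimodal Y S' \<longrightarrow> makespan S \<le> makespan S')"


section \<open>Programs for a unit-cost real RAM\<close>

text \<open>
  The machine has registers holding natural numbers, with addition and truncated subtraction, and
  arrays of real numbers, indexed by natural numbers, with the field operations and comparison.
  There is no rounding operation and no conversion from real numbers to register contents.  Every
  operator, constant, memory access and executed command costs one time unit.
\<close>

datatype nexp = NConst nat | NReg string | NAdd nexp nexp | NSub nexp nexp

datatype rexp = RConst int | RRead string nexp | ROfNat nexp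
  | RAdd rexp rexp | RSub rexp rexp | RMul rexp rexp | RDiv rexp rexp

datatype bexp = NLess nexp nexp | RLess rexp rexp | BNot bexp | BAnd bexp bexp

datatype program = Nop
  | SetReg string nexp
  | Write string nexp rexp
  | Then program program
  | Cond bexp program program
  | Loop bexp program

record machine_state =
  regs :: "string \<Rightarrow> nat"
  arrays :: "string \<Rightarrow> nat \<Rightarrow> real"

fun nval :: "nexp \<Rightarrow> machine_state \<Rightarrow> nat" where
  "nval (NConst c) \<sigma> = c"
| "nval (NReg x) \<sigma> = regs \<sigma> x"
| "nval (NAdd a b) \<sigma> = nval a \<sigma> + nval b \<sigma>"
| "nval (NSub a b) \<sigma> = nval a \<sigma> - nval b \<sigma>"

fun ncost :: "nexp \<Rightarrow> nat" where
  "ncost (NConst c) = 1"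
| "ncost (NReg x) = 1"
| "ncost (NAdd a b) = 1 + ncost a + ncost b"
| "ncost (NSub a b) = 1 + ncost a + ncost b"

fun rval :: "rexp \<Rightarrow> machine_state \<Rightarrow> real" where
  "rval (RConst c) \<sigma> = real_of_int c"
| "rval (RRead A i) \<sigma> = arrays \<sigma> A (nval i \<sigma>)"
| "rval (ROfNat i) \<sigma> = real (nval i \<sigma>)"
| "rval (RAdd a b) \<sigma> = rval a \<sigma> + rval b \<sigma>"
| "rval (RSub a b) \<sigma> = rval a \<sigma> - rval b \<sigma>"
| "rval (RMul a b) \<sigma> = rval a \<sigma> * rval b \<sigma>"
| "rval (RDiv a b) \<sigma> = rval a \<sigma> / rval b \<sigma>"

fun rcost :: "rexp \<Rightarrow> nat" where
  "rcost (RConst c) = 1"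
| "rcost (RRead A i) = 1 + ncost i"
| "rcost (ROfNat i) = 1 + ncost i"
| "rcost (RAdd a b) = 1 + rcost a + rcost b"
| "rcost (RSub a b) = 1 + rcost a + rcost b"
| "rcost (RMul a b) = 1 + rcost a + rcost b"
| "rcost (RDiv a b) = 1 + rcost a + rcost b"

fun bval :: "bexp \<Rightarrow> machine_state \<Rightarrow> bool" where
  "bval (NLess a b) \<sigma> \<longleftrightarrow> nval a \<sigma> < nval b \<sigma>"
| "bval (RLess a b) \<sigma> \<longleftrightarrow> rval a \<sigma> < rval b \<sigma>"
| "bval (BNot b) \<sigma> \<longleftrightarrow> \<not> bval b \<sigma>"
| "bval (BAnd a b) \<sigma> \<longleftrightarrow> bval a \<sigma> \<and> bval b \<sigma>"

fun bcost :: "bexp \<Rightarrow> nat" where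
  "bcost (NLess a b) = 1 + ncost a + ncost b"
| "bcost (RLess a b) = 1 + rcost a + rcost b"
| "bcost (BNot b) = 1 + bcost b"
| "bcost (BAnd a b) = 1 + bcost a + bcost b"

text \<open>\<open>exec c \<sigma> t \<sigma>'\<close>: started in \<open>\<sigma>\<close>, the program \<open>c\<close> halts in \<open>\<sigma>'\<close> after \<open>t\<close> time units.\<close>

inductive exec :: "program \<Rightarrow> machine_state \<Rightarrow> nat \<Rightarrow> machine_state \<Rightarrow> bool" where
  exec_Nop: "exec Nop \<sigma> 1 \<sigma>"
| exec_SetReg:
    "exec (SetReg x a) \<sigma> (1 + ncost a) (\<sigma>\<lparr>regs := (regs \<sigma>)(x := nval a \<sigma>)\<rparr>)"
| exec_Write:
    "exec (Write A i e) \<sigma> (1 + ncost i + rcost e)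
       (\<sigma>\<lparr>arrays := (arrays \<sigma>)(A := (arrays \<sigma> A)(nval i \<sigma> := rval e \<sigma>))\<rparr>)"
| exec_Then:
    "exec c1 \<sigma> t1 \<sigma>' \<Longrightarrow> exec c2 \<sigma>' t2 \<sigma>'' \<Longrightarrow> exec (Then c1 c2) \<sigma> (1 + t1 + t2) \<sigma>''"
| exec_Cond_true:
    "bval b \<sigma> \<Longrightarrow> exec c1 \<sigma> t \<sigma>' \<Longrightarrow> exec (Cond b c1 c2) \<sigma> (1 + bcost b + t) \<sigma>'"
| exec_Cond_false:
    "\<not> bval b \<sigma> \<Longrightarrow> exec c2 \<sigma> t \<sigma>' \<Longrightarrow> exec (Cond b c1 c2) \<sigma> (1 + bcost b + t) \<sigma>'"
| exec_Loop_false: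
    "\<not> bval b \<sigma> \<Longrightarrow> exec (Loop b c) \<sigma> (1 + bcost b) \<sigma>"
| exec_Loop_true:
    "bval b \<sigma> \<Longrightarrow> exec c \<sigma> t1 \<sigma>' \<Longrightarrow> exec (Loop b c) \<sigma>' t2 \<sigma>''
      \<Longrightarrow> exec (Loop b c) \<sigma> (1 + bcost b + t1 + t2) \<sigma>''"

lemma exec_deterministic:
  assumes "exec c \<sigma> t \<sigma>'" and "exec c \<sigma> u \<sigma>''"
  shows "u = t \<and> \<sigma>'' = \<sigma>'"
  using assms
proof (induction arbitrary: u \<sigma>'' rule: exec.induct)
  case exec_Nop
  then show ?case by cases simp
next
  case exec_SetReg
  then show ?case by cases simp
next
  case exec_Write
  then show ?case by cases simp
next
  case (exec_Then c1 \<sigma> t1 \<sigma>1 c2 t2 \<sigma>2)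
  from exec_Then.prems show ?case
    by cases (use exec_Then.IH in blast)
next
  case (exec_Cond_true b \<sigma> c1 t \<sigma>1 c2)
  from exec_Cond_true.prems show ?case
    by cases (use exec_Cond_true.hyps exec_Cond_true.IH in blast)+
next
  case (exec_Cond_false b \<sigma> c2 t \<sigma>1 c1)
  from exec_Cond_false.prems show ?case
    by cases (use exec_Cond_false.hyps exec_Cond_false.IH in blast)+
next
  case (exec_Loop_false b \<sigma> c)
  from exec_Loop_false.prems show ?case
    by cases (use exec_Loop_false.hyps in blast)+
next
  case (exec_Loop_true b \<sigma> c t1 \<sigma>1 t2 \<sigma>2)
  from exec_Loop_true.prems show ?case
    by cases (use exec_Loop_true.hyps exec_Loop_true.IH in blast)+
qed


section \<open>Input and output\<close>

text \<open>The positions are stored at the indices \<open>1,\<dots>,n\<close>; all remaining memory is initially zero.\<close>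

definition input_state :: "stockyard \<Rightarrow> machine_state" where
  "input_state Y =
     \<lparr>regs = (\<lambda>_. 0)(''n'' := num Y, ''n1'' := num1 Y),
      arrays = (\<lambda>_ _. 0)
        (''L'' := (\<lambda>_. 0)(0 := real_of_int (pad_length Y)),
         ''s'' := (\<lambda>_. 0)(0 := speed Y),
         ''l'' := (\<lambda>j. if j \<in> {1..num Y} then real_of_int (left_end Y j) else 0),
         ''r'' := (\<lambda>j. if j \<in> {1..num Y} then real_of_int (right_end Y j) else 0))\<rparr>"

text \<open>
  A move is written as the sign of its velocity and the number of the stockpile it reclaims, with
  0 for none; stockpile numbers start at 1.
\<close>

fun move_code :: "move \<Rightarrow> real \<times> real" where
  "move_code Wait = (0, 0)"
| "move_code (Travel D) = (signum D, 0)"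
| "move_code (Reclaim j D) = (signum D, real j)"

definition trajectory_output ::
  "machine_state \<Rightarrow> string \<Rightarrow> string \<Rightarrow> string \<Rightarrow> string \<Rightarrow> trajectory \<Rightarrow> bool" where
  "trajectory_output \<sigma> len dir pile dur ps \<longleftrightarrow>
     regs \<sigma> len = length ps \<and>
     (\<forall>i<length ps.
        (arrays \<sigma> dir i, arrays \<sigma> pile i) = move_code (fst (ps ! i)) \<and>
        arrays \<sigma> dur i = snd (ps ! i))"

definition schedule_output :: "machine_state \<Rightarrow> schedule \<Rightarrow> bool" where
  "schedule_output \<sigma> S \<longleftrightarrow>
     trajectory_output \<sigma> ''len0'' ''dir0'' ''pile0'' ''dur0'' (S R0) \<and>
     trajectory_output \<sigma> ''len1'' ''dir1'' ''pile1'' ''dur1'' (S R1)"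

end

theory Submission
  imports Defs
begin

text \<open>
  A contiguous unimodal schedule splits each pad into a left part, reclaimed by \<open>R0\<close>, and a right part,
  reclaimed by \<open>R1\<close>.  If the two reclaimers have to enter each other's region, then one of them has
  to turn first; reversing time exchanges the two cases, so let this be \<open>R0\<close>.  The only constraint
  is then that \<open>R0\<close>, on its way home, leaves every point \<open>z\<close> of the common region before \<open>R1\<close>
  arrives there.  It can be met by delaying the start of \<open>R1\<close>, and the least possible delay is the
  maximum over \<open>z\<close> of the difference of two travel times.  In the common region this difference is
  convex between consecutive left ends of stockpiles served there by \<open>R0\<close> and right ends of stockpiles
  served by \<open>R1\<close>, so only these points matter.  Running maxima over the left ends (as the part of
  \<open>R0\<close> on one pad grows) and over the right ends (as its part on the other pad shrinks) give the
  optimal value for each of the quadratically many splits in constant time.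
\<close>

section \<open>Trajectories\<close>

text \<open>On the scale \<open>travel_time Y J\<close> no reclaimer that serves \<open>J\<close> on
  a one-way run outpaces the clock, and one that never waits keeps pace with it exactly. Bounds thus
  become sums of travel times between known points, joined at moments supplied by the intermediate
  value theorem.

  Constant time per split rests on the function \<open>gain\<close>: once the pads of the four runs
  are chosen, the part of the needed delay that varies with \<open>z\<close> is independent of the
  split. Inside the common region the share of either reclaimer can be replaced, up to a constant,
  by its whole pad. All values at stockpile ends are therefore tabled before the search.

  Even an idle reclaimer must change direction once, and no shortest excursion exists. Since
  stockpile ends are integers, a working reclaimer covers distance at least 1 each way, so an idle
  excursion of length 1/3 never determines the makespan.

  The time bound is read off the program text: every loop makes at most \<open>num Y + 2\<close>
  iterations, and loops are nested at most twice.\<close>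

definition nonneg_durations :: "trajectory \<Rightarrow> bool" where
  "nonneg_durations ps \<longleftrightarrow> (\<forall>q\<in>set ps. 0 \<le> snd q)"

lemma nonneg_durations_simps [simp]:
  "nonneg_durations []"
  "nonneg_durations (q # ps) \<longleftrightarrow> 0 \<le> snd q \<and> nonneg_durations ps"
  "nonneg_durations (ps @ qs) \<longleftrightarrow> nonneg_durations ps \<and> nonneg_durations qs"
  by (auto simp: nonneg_durations_def)

fun displacement :: "real \<Rightarrow> trajectory \<Rightarrow> real" where
  "displacement s [] = 0"
| "displacement s ((m, d) # ps) = velocity s m * d + displacement s ps"

lemma displacement_append: "displacement s (ps @ qs) = displacement s ps + displacement s qs"
  by (induction ps) auto

lemma duration_Nil [simp]: "duration [] = 0"
  and duration_Cons [simp]: "duration (q # ps) = snd q + duration ps"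
  and duration_append: "duration (ps @ qs) = duration ps + duration qs"
  by (simp_all add: duration_def)

lemma duration_nonneg: "nonneg_durations ps \<Longrightarrow> 0 \<le> duration ps"
  by (induction ps) auto

lemma path_zero: "nonneg_durations ps \<Longrightarrow> path s x ps 0 = x"
  by (cases ps) auto

text \<open>At \<open>t = d\<close> the definition of \<open>path\<close> still uses the first
  piece. The two formulas agree there because a tail with nonnegative durations starts at its
  initial point; hence the hypothesis on durations.\<close>

lemma path_Cons_late:
  assumes "nonneg_durations ((m, d) # ps)" "d \<le> t"
  shows "path s x ((m, d) # ps) t = path s (x + velocity s m * d) ps (t - d)"
  using assms path_zero[of ps] by (cases "t = d") auto

declare path.simps(2) [simp del]

lemma path_Cons_early: "t \<le> d \<Longrightarrow> path s x ((m, d) # ps) t = x + velocity s m * t"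
  by (simp add: path.simps)

lemma path_append_early:
  assumes "nonneg_durations ps" "nonneg_durations qs" "0 \<le> t" "t \<le> duration ps"
  shows "path s x (ps @ qs) t = path s x ps t"
  using assms
proof (induction ps arbitrary: x t)
  case Nil
  then show ?case by (simp add: path_zero)
next
  case (Cons q ps)
  obtain m d where q: "q = (m, d)" by force
  show ?case
  proof (cases "t \<le> d")
    case True
    then show ?thesis by (simp add: q path_Cons_early)
  next
    case False
    then show ?thesis using Cons by (simp add: q path_Cons_late)
  qed
qed

lemma path_append_late:
  assumes "nonneg_durations ps" "nonneg_durations qs" "duration ps \<le> t"
  shows "path s x (ps @ qs) t = path s (x + displacement s ps) qs (t - duration ps)"
  using assms
proof (induction ps arbitrary: x t)
  case Nil
  then show ?case by simp
next
  case (Cons q ps)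
  obtain m d where q: "q = (m, d)" by force
  have "d \<le> t" using Cons.prems duration_nonneg[of ps] by (simp add: q)
  then show ?case using Cons by (simp add: q path_Cons_late algebra_simps)
qed

lemma path_late:
  assumes "nonneg_durations ps" "duration ps \<le> t"
  shows "path s x ps t = x + displacement s ps"
  using path_append_late[of ps "[]" t s x] assms by simp

text \<open>Serves the intermediate value theorem in the lower bound, which yields the moments when
  a reclaimer passes a given point.\<close>

lemma continuous_on_path:
  assumes "nonneg_durations ps"
  shows "continuous_on A (path s x ps)"
proof -
  have "continuous_on UNIV (path s x ps)"
    using assms
  proof (induction ps arbitrary: x)
    case Nil
    then show ?case by simp
  next
    case (Cons q ps)
    obtain m d where q: "q = (m, d)" by force
    have nn: "nonneg_durations ps" and IH: "continuous_on UNIV (path s (x + velocity s m * d) ps)"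
      using Cons by (simp_all add: q)
    have cont: "continuous_on {d..} (\<lambda>t. path s (x + velocity s m * d) ps (t - d))"
      by (rule continuous_on_compose2[OF IH]) (auto intro: continuous_intros)
    have lin: "continuous_on {..d} (\<lambda>t. x + velocity s m * t)"
      by (intro continuous_intros)
    have agree: "path s (x + velocity s m * d) ps (t - d) = x + velocity s m * t"
      if "d \<le> t" "t \<le> d" for t
      using that nn by (simp add: order_antisym path_zero)
    have "continuous_on ({..d} \<union> {d..})
       (\<lambda>t. if t \<le> d then x + velocity s m * t else path s (x + velocity s m * d) ps (t - d))"
      by (intro continuous_on_cases cont lin closed_atMost closed_atLeast) (auto simp: agree)
    moreover have "{..d} \<union> {d..} = UNIV" by auto
    ultimately show ?case by (simp add: q path.simps)
  qed
  then show ?thesis using continuous_on_subset by blast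
qed

text \<open>The recursion carries the current position, so validity distributes over concatenation.
  \<open>reclaimer_schedule\<close> phrases the same local conditions through indices and durations
  of prefixes, which does not.\<close>

fun valid_from :: "stockyard \<Rightarrow> real \<Rightarrow> trajectory \<Rightarrow> bool" where
  "valid_from Y x [] \<longleftrightarrow> True"
| "valid_from Y x ((m, d) # ps) \<longleftrightarrow>
     0 < d \<and> (\<forall>j D. m = Reclaim j D \<longrightarrow>
        x = real_of_int (entry Y j D) \<and> d = real_of_int (right_end Y j - left_end Y j)) \<and>
     valid_from Y (x + velocity (speed Y) m * d) ps"

lemma valid_from_pos: "valid_from Y x ps \<Longrightarrow> q \<in> set ps \<Longrightarrow> 0 < snd q"
  by (induction Y x ps rule: valid_from.induct) auto

lemma valid_from_nonneg: "valid_from Y x ps \<Longrightarrow> nonneg_durations ps"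
  by (auto simp: nonneg_durations_def intro: less_imp_le valid_from_pos)

lemma valid_from_append:
  "valid_from Y x (ps @ qs) \<longleftrightarrow> valid_from Y x ps \<and> valid_from Y (x + displacement (speed Y) ps) qs"
  by (induction Y x ps rule: valid_from.induct) (auto simp: algebra_simps)

lemma valid_from_iff:
  fixes x :: real
  shows "valid_from Y x ps \<longleftrightarrow>
     (\<forall>(m, d)\<in>set ps. 0 < d) \<and>
     (\<forall>i<length ps. \<forall>j D d. ps ! i = (Reclaim j D, d) \<longrightarrow>
        path (speed Y) x ps (duration (take i ps)) = real_of_int (entry Y j D) \<and>
        d = real_of_int (right_end Y j - left_end Y j))"
proof (induction ps arbitrary: x)
  case Nil
  then show ?case by simp
next
  case (Cons q ps)
  obtain m d where q: "q = (m, d)" by force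
  show ?case
  proof (cases "\<forall>(m, d)\<in>set (q # ps). 0 < d")
    case False
    then show ?thesis using valid_from_pos[of Y x "q # ps"] by fastforce
  next
    case True
    then have nn: "nonneg_durations (q # ps)" by (auto simp: q nonneg_durations_def less_imp_le)
    have late: "path (speed Y) x ((m, d) # ps) (d + duration (take i ps)) =
        path (speed Y) (x + velocity (speed Y) m * d) ps (duration (take i ps))" for i
    proof -
      have "0 \<le> duration (take i ps)"
        using nn by (intro duration_nonneg) (auto simp: nonneg_durations_def dest: in_set_takeD)
      then show ?thesis using nn by (simp add: q path_Cons_late)
    qed
    have zero: "path (speed Y) x ((m', d') # ps) 0 = x" if "0 \<le> d'" for x m' d'
      using nn that by (intro path_zero) (simp add: q)
    show ?thesis
      using True by (auto simp: q Cons.IH All_less_Suc2 late zero)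
  qed
qed

lemma reclaimer_schedule_iff:
  "reclaimer_schedule Y S k \<longleftrightarrow>
     valid_from Y (home Y k) (S k) \<and> displacement (speed Y) (S k) = 0 \<and>
     (\<forall>t\<in>{0..duration (S k)}. pos Y S k t \<in> {0..real_of_int (pad_length Y)})"
proof -
  have "pos Y S k (duration (S k)) = home Y k + displacement (speed Y) (S k)"
    if "valid_from Y (home Y k) (S k)"
    using that by (simp add: pos_def path_late valid_from_nonneg)
  then show ?thesis
    unfolding reclaimer_schedule_def using valid_from_iff[of Y "home Y k" "S k"]
    by (auto simp: pos_def)
qed

section \<open>Runs in a single direction\<close>

definition oriented :: "direction \<Rightarrow> trajectory \<Rightarrow> bool" where
  "oriented D ps \<longleftrightarrow> (\<forall>q\<in>set ps. move_direction (fst q) \<in> {None, Some D})"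

lemma oriented_simps [simp]:
  "oriented D []"
  "oriented D (q # ps) \<longleftrightarrow> move_direction (fst q) \<in> {None, Some D} \<and> oriented D ps"
  "oriented D (ps @ qs) \<longleftrightarrow> oriented D ps \<and> oriented D qs"
  by (auto simp: oriented_def)

lemma signum_cases: "signum D = 1 \<or> signum D = - 1"
  by (cases D) auto

lemma signum_sq [simp]: "signum D * signum D = 1"
  by (cases D) auto

lemma signum_mult_cancel [simp]: "signum D * (signum D * x) = x"
  by (cases D) auto

lemma oriented_velocity:
  assumes "move_direction m \<in> {None, Some D}" "0 \<le> s"
  shows "0 \<le> signum D * velocity s m"
  using assms by (cases m) auto

lemma oriented_velocity_mult:
  assumes "move_direction m \<in> {None, Some D}" "0 \<le> s" "0 \<le> d"
  shows "0 \<le> signum D * (velocity s m * d)"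
  using mult_nonneg_nonneg[OF oriented_velocity[OF assms(1,2)] assms(3)] by (simp add: mult.assoc)

lemma oriented_displacement:
  assumes "oriented D ps" "nonneg_durations ps" "0 \<le> s"
  shows "0 \<le> signum D * displacement s ps"
  using assms
proof (induction ps)
  case (Cons q ps)
  obtain m d where q: "q = (m, d)" by force
  show ?case
    using Cons oriented_velocity_mult[of m D s d] by (simp add: q distrib_left)
qed simp

lemma oriented_mono:
  assumes "oriented D ps" "nonneg_durations ps" "0 \<le> s" "0 \<le> t1" "t1 \<le> t2"
  shows "0 \<le> signum D * (path s x ps t2 - path s x ps t1)"
  using assms
proof (induction ps arbitrary: x t1 t2)
  case Nil
  then show ?case by simp
next
  case (Cons q ps)
  obtain m d where q: "q = (m, d)" by force
  have d: "0 \<le> d" and nn: "nonneg_durations ps" using Cons.prems by (auto simp: q)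
  have md: "move_direction m \<in> {None, Some D}" using Cons.prems by (simp add: q)
  have piece: "0 \<le> signum D * (velocity s m * (b - a))" if "a \<le> b" for a b
    using that oriented_velocity_mult[OF md Cons.prems(3), of "b - a"] by simp
  consider "t2 \<le> d" | "t1 \<le> d" "d \<le> t2" | "d \<le> t1" by linarith
  then show ?case
  proof cases
    case 1
    then show ?thesis using Cons.prems piece[of t1 t2] by (simp add: q path_Cons_early algebra_simps)
  next
    case 2
    have "0 \<le> signum D * (path s (x + velocity s m * d) ps (t2 - d) -
        path s (x + velocity s m * d) ps 0)"
      using Cons 2 nn by (intro Cons.IH) auto
    then show ?thesis using 2 Cons.prems nn d piece[of t1 d]
      by (simp add: q path_Cons_early path_Cons_late path_zero algebra_simps)
  next
    case 3
    then show ?thesis using Cons d nn by (simp add: q path_Cons_late)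
  qed
qed

lemma reclaimed_simps [simp]:
  "reclaimed [] D = {}"
  "reclaimed ((m, d) # ps) D = (case m of Reclaim j D' \<Rightarrow> if D' = D then {j} else {} | _ \<Rightarrow> {}) \<union> reclaimed ps D"
  "reclaimed (ps @ qs) D = reclaimed ps D \<union> reclaimed qs D"
  by (auto simp: reclaimed_def split: move.splits)

fun exit :: "stockyard \<Rightarrow> nat \<Rightarrow> direction \<Rightarrow> int" where
  "exit Y j Rightward = right_end Y j"
| "exit Y j Leftward = left_end Y j"

lemma exit_entry:
  "real_of_int (exit Y j D) = entry Y j D + signum D * (right_end Y j - left_end Y j)"
  by (cases D) auto

text \<open>The position only advances in direction \<open>D\<close>, so a stockpile reclaimed on
  the run lies entirely between its start and its end. The factor \<open>signum D\<close> covers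
  both directions at once.\<close>

lemma oriented_reclaimed:
  fixes x :: real
  assumes "valid_from Y x ps" "oriented D ps" "0 \<le> speed Y" "j \<in> reclaimed ps D"
  shows "0 \<le> signum D * (entry Y j D - x)"
    and "0 \<le> signum D * (x + displacement (speed Y) ps - exit Y j D)"
proof -
  have "0 \<le> signum D * (entry Y j D - x) \<and>
    0 \<le> signum D * (x + displacement (speed Y) ps - exit Y j D)"
    using assms
  proof (induction ps arbitrary: x)
    case (Cons q ps)
    obtain m d where q: "q = (m, d)" by force
    have d: "0 \<le> d" and md: "move_direction m \<in> {None, Some D}" using Cons.prems by (auto simp: q)
    have nn: "nonneg_durations ps" using Cons.prems valid_from_nonneg by (auto simp: q)
    have step: "0 \<le> signum D * (velocity (speed Y) m * d)"
      using oriented_velocity_mult[OF md _ d] Cons.prems by simp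
    have rest: "0 \<le> signum D * displacement (speed Y) ps"
      using Cons.prems nn by (intro oriented_displacement) (auto simp: q)
    show ?case
    proof (cases "j \<in> reclaimed ps D")
      case True
      have "0 \<le> signum D * (entry Y j D - (x + velocity (speed Y) m * d)) \<and>
          0 \<le> signum D * (x + velocity (speed Y) m * d + displacement (speed Y) ps - exit Y j D)"
        using True Cons.prems by (intro Cons.IH) (auto simp: q)
      then show ?thesis using step by (simp add: q algebra_simps)
    next
      case False
      then have m: "m = Reclaim j D" using Cons.prems by (auto simp: q split: move.splits if_splits)
      then show ?thesis using Cons.prems rest by (simp add: q exit_entry algebra_simps)
    qed
  qed simp
  then show "0 \<le> signum D * (entry Y j D - x)"
    and "0 \<le> signum D * (x + displacement (speed Y) ps - exit Y j D)" by auto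
qed

section \<open>Travel times\<close>

text \<open>The length of the part of stockpile \<open>j\<close> to the left of \<open>z\<close>. In
  \<open>travel_time\<close> every unit of distance is first charged \<open>1 / speed Y\<close>; a
  unit inside a reclaimed stockpile costs 1, hence the surplus factor
  \<open>1 - 1 / speed Y\<close>.\<close>

definition overlap :: "stockyard \<Rightarrow> nat \<Rightarrow> real \<Rightarrow> real" where
  "overlap Y j z = max 0 (min z (right_end Y j) - left_end Y j)"

text \<open>
  The time that a reclaimer needs from 0 to \<open>z\<close> if it reclaims the stockpiles in \<open>J\<close> on its way.
\<close>
definition travel_time :: "stockyard \<Rightarrow> nat set \<Rightarrow> real \<Rightarrow> real" where
  "travel_time Y J z = z / speed Y + (1 - 1 / speed Y) * (\<Sum>j\<in>J. overlap Y j z)"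

abbreviation proper :: "stockyard \<Rightarrow> nat set \<Rightarrow> bool" where
  "proper Y J \<equiv> finite J \<and> (\<forall>j\<in>J. left_end Y j < right_end Y j)"

lemma overlap_clear:
  fixes a b :: real
  assumes "a \<le> b" "b \<le> left_end Y j \<or> right_end Y j \<le> a" "left_end Y j < right_end Y j"
  shows "overlap Y j b = overlap Y j a"
  using assms by (auto simp: overlap_def)

lemma overlap_mono:
  fixes a b :: real
  shows "a \<le> b \<Longrightarrow> overlap Y j a \<le> overlap Y j b"
  by (auto simp: overlap_def)

lemma overlap_lipschitz:
  fixes a b :: real
  shows "a \<le> b \<Longrightarrow> overlap Y j b - overlap Y j a \<le> b - a"
  by (auto simp: overlap_def)

lemma overlap_inside:
  fixes a b :: real
  shows "left_end Y j \<le> a \<Longrightarrow> a \<le> b \<Longrightarrow> b \<le> right_end Y j \<Longrightarrow> overlap Y j b - overlap Y j a = b - a"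
  by (auto simp: overlap_def)

lemma travel_time_diff:
  fixes a b :: real
  shows "travel_time Y J b - travel_time Y J a =
    (b - a) / speed Y + (1 - 1 / speed Y) * (\<Sum>j\<in>J. overlap Y j b - overlap Y j a)"
  by (simp add: travel_time_def sum_subtractf diff_divide_distrib right_diff_distrib)

lemma travel_time_clear:
  fixes a b :: real
  assumes "proper Y J" "a \<le> b" "\<And>j. j \<in> J \<Longrightarrow> b \<le> left_end Y j \<or> right_end Y j \<le> a"
  shows "travel_time Y J b - travel_time Y J a = (b - a) / speed Y"
  using assms by (simp add: travel_time_diff overlap_clear)

lemma travel_time_lower:
  fixes a b :: real
  assumes "1 \<le> speed Y" "a \<le> b"
  shows "(b - a) / speed Y \<le> travel_time Y J b - travel_time Y J a"
  using assms by (auto simp: travel_time_diff intro!: mult_nonneg_nonneg sum_nonneg overlap_mono)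

lemma travel_time_mono:
  fixes a b :: real
  assumes "1 \<le> speed Y" "a \<le> b"
  shows "travel_time Y J a \<le> travel_time Y J b"
  using travel_time_lower[OF assms, of J] assms by (smt (verit) divide_nonneg_nonneg)

text \<open>Strictness makes it possible to return from an inequality of travel times to one of
  positions, as the separation of the reclaimers in \<open>upper_bound\<close> requires.\<close>

lemma travel_time_strict_mono:
  fixes a b :: real
  assumes "1 \<le> speed Y" "a < b"
  shows "travel_time Y J a < travel_time Y J b"
  using travel_time_lower[of Y a b J] assms by (smt (verit) divide_pos_pos)

lemma travel_time_zero:
  assumes "\<And>j. j \<in> J \<Longrightarrow> 0 \<le> left_end Y j"
  shows "travel_time Y J 0 = 0"
proof -
  have "overlap Y j 0 = 0" if "j \<in> J" for j
    using assms[OF that] by (auto simp: overlap_def)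
  then show ?thesis by (simp add: travel_time_def)
qed

text \<open>No stockpile of \<open>J\<close> except possibly \<open>j\<close> meets the interval, so
  the sum of overlaps collapses to a single term, which is at most \<open>b - a\<close>.\<close>

lemma travel_time_busy:
  fixes a b :: real
  assumes "1 \<le> speed Y" "proper Y J" "a \<le> b"
    and "\<And>i. i \<in> J \<Longrightarrow> i \<noteq> j \<Longrightarrow> b \<le> left_end Y i \<or> right_end Y i \<le> a"
  shows "travel_time Y J b - travel_time Y J a \<le> b - a"
    and "j \<in> J \<Longrightarrow> left_end Y j \<le> a \<Longrightarrow> b \<le> right_end Y j \<Longrightarrow>
      travel_time Y J b - travel_time Y J a = b - a"
proof -
  have eq: "(\<Sum>i\<in>J. overlap Y i b - overlap Y i a) =
      (\<Sum>i\<in>J. if i = j then overlap Y j b - overlap Y j a else 0)"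
    using assms by (intro sum.cong) (auto intro!: overlap_clear)
  have "(\<Sum>i\<in>J. overlap Y i b - overlap Y i a) \<le> b - a"
    unfolding eq using assms overlap_lipschitz[of a b Y j] by simp
  then have "(1 - 1 / speed Y) * (\<Sum>i\<in>J. overlap Y i b - overlap Y i a) \<le> (1 - 1 / speed Y) * (b - a)"
    using assms by (intro mult_left_mono) auto
  then show "travel_time Y J b - travel_time Y J a \<le> b - a"
    unfolding travel_time_diff by (simp add: algebra_simps diff_divide_distrib)
  assume j: "j \<in> J" "left_end Y j \<le> a" "b \<le> right_end Y j"
  have sum: "(\<Sum>i\<in>J. overlap Y i b - overlap Y i a) = b - a"
    unfolding eq using assms j overlap_inside[of Y j a b] by simp
  show "travel_time Y J b - travel_time Y J a = b - a"
    unfolding travel_time_diff sum by (simp add: algebra_simps diff_divide_distrib)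
qed

section \<open>Progress of a single piece, measured in travel time\<close>

lemma piece_clear:
  fixes x d a b :: real
  assumes m: "m = Wait \<or> m = Travel D" and s: "1 \<le> speed Y" and J: "proper Y J"
    and clear: "\<And>j. j \<in> J \<Longrightarrow> 0 \<le> signum D * (x - exit Y j D) \<or>
      0 \<le> signum D * (entry Y j D - (x + velocity (speed Y) m * d))"
    and ab: "0 \<le> a" "a \<le> b" "b \<le> d"
  shows "signum D * (travel_time Y J (x + velocity (speed Y) m * b)
      - travel_time Y J (x + velocity (speed Y) m * a)) = (if m = Wait then 0 else b - a)"
proof (cases "m = Wait")
  case False
  with m have m: "m = Travel D" by simp
  have le: "speed Y * a \<le> speed Y * b" "speed Y * b \<le> speed Y * d" "0 \<le> speed Y * a"
    using ab s by (auto intro!: mult_left_mono)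
  show ?thesis
  proof (cases D)
    case Rightward
    have "travel_time Y J (x + speed Y * b) - travel_time Y J (x + speed Y * a)
        = ((x + speed Y * b) - (x + speed Y * a)) / speed Y"
      using J le clear by (intro travel_time_clear) (fastforce simp: m Rightward)+
    then show ?thesis using s by (simp add: m Rightward diff_divide_distrib)
  next
    case Leftward
    have "travel_time Y J (x - speed Y * a) - travel_time Y J (x - speed Y * b)
        = ((x - speed Y * a) - (x - speed Y * b)) / speed Y"
      using J le clear by (intro travel_time_clear) (fastforce simp: m Leftward)+
    then show ?thesis using s by (simp add: m Leftward diff_divide_distrib)
  qed
qed simp

text \<open>The other stockpiles of \<open>J\<close> lie before the entry or after the exit of
  \<open>j\<close>, so only \<open>j\<close> can contribute. If \<open>j\<close> belongs to
  \<open>J\<close>, progress and clock agree; otherwise crossing \<open>j\<close> counts as mere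
  travelling, which leaves an inequality.\<close>

lemma piece_reclaim:
  fixes a b :: real
  assumes s: "1 \<le> speed Y" and J: "proper Y J"
    and clear: "\<And>i. i \<in> J \<Longrightarrow> i \<noteq> j \<Longrightarrow> 0 \<le> signum D * (entry Y j D - exit Y i D) \<or>
      0 \<le> signum D * (entry Y i D - exit Y j D)"
    and ab: "0 \<le> a" "a \<le> b" "b \<le> right_end Y j - left_end Y j"
  shows "signum D * (travel_time Y J (entry Y j D + signum D * b)
      - travel_time Y J (entry Y j D + signum D * a)) \<le> b - a"
    and "j \<in> J \<Longrightarrow> signum D * (travel_time Y J (entry Y j D + signum D * b)
      - travel_time Y J (entry Y j D + signum D * a)) = b - a"
proof -
  let ?lo = "if D = Rightward then left_end Y j + a else right_end Y j - b"
  let ?hi = "if D = Rightward then left_end Y j + b else right_end Y j - a"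
  have "?hi \<le> left_end Y i \<or> right_end Y i \<le> ?lo" if "i \<in> J" "i \<noteq> j" for i
    using clear[OF that] ab by (cases D) auto
  note busy = travel_time_busy[OF s J _ this, simplified]
  have *: "signum D * (travel_time Y J (entry Y j D + signum D * b)
      - travel_time Y J (entry Y j D + signum D * a)) = travel_time Y J ?hi - travel_time Y J ?lo"
    by (cases D) auto
  have "travel_time Y J ?hi - travel_time Y J ?lo \<le> ?hi - ?lo"
    using ab busy by (cases D) auto
  moreover have "?hi - ?lo = b - a" by auto
  ultimately show "signum D * (travel_time Y J (entry Y j D + signum D * b)
      - travel_time Y J (entry Y j D + signum D * a)) \<le> b - a"
    unfolding * by simp
  assume "j \<in> J"
  then have "travel_time Y J ?hi - travel_time Y J ?lo = ?hi - ?lo"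
    using ab busy by (cases D) auto
  then show "signum D * (travel_time Y J (entry Y j D + signum D * b)
      - travel_time Y J (entry Y j D + signum D * a)) = b - a"
    unfolding * by auto
qed

text \<open>
  Within a run in one direction the position, measured in travel time, advances at most at unit
  speed, and exactly at unit speed if the reclaimer never waits.
\<close>
lemma oriented_travel_time:
  assumes "valid_from Y x ps" "oriented D ps" "1 \<le> speed Y" "proper Y J"
    and "\<And>j. j \<in> J \<Longrightarrow> j \<in> reclaimed ps D \<or> 0 \<le> signum D * (x - exit Y j D)"
    and "0 \<le> t1" "t1 \<le> t2"
  shows "signum D * (travel_time Y J (path (speed Y) x ps t2)
      - travel_time Y J (path (speed Y) x ps t1)) \<le> t2 - t1" (is ?le)
    and "Wait \<notin> fst ` set ps \<Longrightarrow> reclaimed ps D \<subseteq> J \<Longrightarrow> t2 \<le> duration ps \<Longrightarrow>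
      signum D * (travel_time Y J (path (speed Y) x ps t2)
      - travel_time Y J (path (speed Y) x ps t1)) = t2 - t1" (is "_ \<Longrightarrow> _ \<Longrightarrow> _ \<Longrightarrow> ?eq")
proof -
  have "?le \<and> (Wait \<notin> fst ` set ps \<longrightarrow> reclaimed ps D \<subseteq> J \<longrightarrow> t2 \<le> duration ps \<longrightarrow> ?eq)"
    using assms
  proof (induction ps arbitrary: x t1 t2)
    case Nil
    then show ?case by simp
  next
    case (Cons q ps)
    obtain m d where q: "q = (m, d)" by force
    let ?s = "speed Y" and ?T = "travel_time Y J"
    let ?x' = "x + velocity ?s m * d"
    have d: "0 < d" and md: "move_direction m \<in> {None, Some D}"
      and v: "valid_from Y ?x' ps" and o: "oriented D ps" using Cons.prems by (simp_all add: q)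
    have nn: "nonneg_durations ps" using v by (rule valid_from_nonneg)
    have step: "0 \<le> signum D * (velocity ?s m * d)"
      using oriented_velocity_mult[OF md, of ?s d] d Cons.prems by simp
    have ahead: "0 \<le> signum D * (entry Y j D - ?x')" if "j \<in> reclaimed ps D" for j
      using oriented_reclaimed(1)[OF v o _ that] Cons.prems by simp
    have piece: "signum D * (?T (x + velocity ?s m * b) - ?T (x + velocity ?s m * a)) \<le> b - a \<and>
      (m \<noteq> Wait \<longrightarrow> reclaimed (q # ps) D \<subseteq> J \<longrightarrow>
        signum D * (?T (x + velocity ?s m * b) - ?T (x + velocity ?s m * a)) = b - a)"
      if ab: "0 \<le> a" "a \<le> b" "b \<le> d" for a b
    proof (cases "\<exists>j. m = Reclaim j D")
      case True
      then obtain j where m: "m = Reclaim j D" by blast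
      have x: "x = entry Y j D" and dj: "d = right_end Y j - left_end Y j"
        using Cons.prems by (simp_all add: q m)
      have x': "?x' = exit Y j D" by (simp add: m x dj exit_entry)
      \<comment> \<open>Another stockpile of \<open>J\<close> is either already behind the entry of
        \<open>j\<close> or reclaimed later in the same run, hence ahead of its exit.\<close>
      have clear: "0 \<le> signum D * (entry Y j D - exit Y i D) \<or>
          0 \<le> signum D * (entry Y i D - exit Y j D)" if "i \<in> J" "i \<noteq> j" for i
      proof -
        have "i \<in> reclaimed ps D \<or> 0 \<le> signum D * (x - exit Y i D)"
          using Cons.prems(5)[OF that(1)] that(2) by (auto simp: q m)
        then show ?thesis using ahead[of i, unfolded x'] by (auto simp: x)
      qed
      show ?thesis
        using piece_reclaim[OF Cons.prems(3,4) clear, where a = a and b = b] ab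
        by (auto simp: m x dj q)
    next
      case False
      then have m: "m = Wait \<or> m = Travel D" using md by (cases m) auto
      have "0 \<le> signum D * (x - exit Y j D) \<or> 0 \<le> signum D * (entry Y j D - ?x')" if "j \<in> J" for j
        using Cons.prems(5)[OF that] ahead[of j] m by (auto simp: q)
      from piece_clear[OF m Cons.prems(3,4) this ab] ab show ?thesis by auto
    qed
    \<comment> \<open>A stockpile that has just been reclaimed ends at the new position and is
      behind it from now on. This restores the assumption on \<open>J\<close> for the rest of the
      run.\<close>
    have behind: "j \<in> reclaimed ps D \<or> 0 \<le> signum D * (?x' - exit Y j D)" if "j \<in> J" for j
    proof (cases "j \<in> reclaimed (q # ps) D \<and> j \<notin> reclaimed ps D")
      case True
      then have m: "m = Reclaim j D" by (auto simp: q split: move.splits if_splits)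
      have "?x' = exit Y j D" using Cons.prems by (simp add: q m exit_entry)
      then show ?thesis by simp
    next
      case False
      then show ?thesis using Cons.prems(5)[OF that] step by (auto simp: algebra_simps)
    qed
    note IH = Cons.IH[OF v o Cons.prems(3,4) behind]
    consider "t2 \<le> d" | "t1 \<le> d" "d \<le> t2" | "d \<le> t1" by linarith
    then show ?case
    proof cases
      case 1
      then show ?thesis using Cons.prems piece[of t1 t2] by (auto simp: q path_Cons_early)
    next
      case 2
      then show ?thesis using Cons.prems nn d piece[of t1 d] IH[of 0 "t2 - d"]
        by (auto simp: q path_Cons_early path_Cons_late path_zero algebra_simps)
    next
      case 3
      then show ?thesis using Cons.prems nn d IH[of "t1 - d" "t2 - d"]
        by (auto simp: q path_Cons_late)
    qed
  qed
  then show ?le and "Wait \<notin> fst ` set ps \<Longrightarrow> reclaimed ps D \<subseteq> J \<Longrightarrow> t2 \<le> duration ps \<Longrightarrow> ?eq"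
    by blast+
qed

section \<open>Splits of the stockpiles\<close>

fun offset :: "stockyard \<Rightarrow> pad \<Rightarrow> nat" where
  "offset Y Pad1 = 0"
| "offset Y Pad2 = num1 Y"

fun pile_num :: "stockyard \<Rightarrow> pad \<Rightarrow> nat" where
  "pile_num Y Pad1 = num1 Y"
| "pile_num Y Pad2 = num Y - num1 Y"

text \<open>Ends of the \<open>i\<close>-th stockpile of a pad, with \<open>0\<close> and \<open>L\<close> where there is no such stockpile.\<close>

definition left_at :: "stockyard \<Rightarrow> pad \<Rightarrow> nat \<Rightarrow> real" where
  "left_at Y p i = (if 1 \<le> i \<and> i \<le> pile_num Y p then left_end Y (offset Y p + i) else pad_length Y)"

definition right_at :: "stockyard \<Rightarrow> pad \<Rightarrow> nat \<Rightarrow> real" where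
  "right_at Y p i = (if 1 \<le> i \<and> i \<le> pile_num Y p then right_end Y (offset Y p + i) else 0)"

definition near :: "stockyard \<Rightarrow> pad \<Rightarrow> nat \<Rightarrow> nat set" where
  "near Y p i = {offset Y p + 1..offset Y p + i}"

definition far :: "stockyard \<Rightarrow> pad \<Rightarrow> nat \<Rightarrow> nat set" where
  "far Y p i = {offset Y p + i + 1..offset Y p + pile_num Y p}"

text \<open>
  A split \<open>c\<close> gives the first \<open>c p\<close> stockpiles of pad \<open>p\<close> to \<open>R0\<close> and the others to \<open>R1\<close>.  An idle
  reclaimer has to change direction, too; it turns at distance 1/3 from its home.
\<close>

definition peak :: "stockyard \<Rightarrow> (pad \<Rightarrow> nat) \<Rightarrow> real" where
  "peak Y c = max (1 / 3) (max (right_at Y Pad1 (c Pad1)) (right_at Y Pad2 (c Pad2)))"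

definition valley :: "stockyard \<Rightarrow> (pad \<Rightarrow> nat) \<Rightarrow> real" where
  "valley Y c = min (pad_length Y - 1 / 3)
     (min (left_at Y Pad1 (c Pad1 + 1)) (left_at Y Pad2 (c Pad2 + 1)))"

abbreviation "near_time Y p c \<equiv> travel_time Y (near Y p (c p))"
abbreviation "far_time Y p c \<equiv> travel_time Y (far Y p (c p))"

definition time0 :: "stockyard \<Rightarrow> (pad \<Rightarrow> nat) \<Rightarrow> real" where
  "time0 Y c = near_time Y Pad1 c (peak Y c) + near_time Y Pad2 c (peak Y c)"

definition time1 :: "stockyard \<Rightarrow> (pad \<Rightarrow> nat) \<Rightarrow> real" where
  "time1 Y c = far_time Y Pad1 c (pad_length Y) - far_time Y Pad1 c (valley Y c)
     + far_time Y Pad2 c (pad_length Y) - far_time Y Pad2 c (valley Y c)"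

text \<open>
  \<open>R0\<close> leaves \<open>z\<close> on its way home at the earliest at the first of the two times; without a delay
  \<open>R1\<close> arrives there at the second.  Here \<open>o0\<close> and \<open>o1\<close> are the pads served on the way out.
\<close>

definition need :: "stockyard \<Rightarrow> pad \<Rightarrow> pad \<Rightarrow> (pad \<Rightarrow> nat) \<Rightarrow> real \<Rightarrow> real" where
  "need Y o0 o1 c z = (time0 Y c - near_time Y (other_pad o0) c z)
     - (far_time Y o1 c (pad_length Y) - far_time Y o1 c z)"

lemma other_other [simp]: "other_pad (other_pad p) = p"
  by (cases p) auto

lemma other_neq [simp]: "other_pad p \<noteq> p" "p \<noteq> other_pad p"
  by (cases p; simp)+

lemma pad_sum: "f Pad1 + f Pad2 = f p + (f (other_pad p) :: real)"
  by (cases p) auto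

lemma time0_pads: "time0 Y c = near_time Y p c (peak Y c) + near_time Y (other_pad p) c (peak Y c)"
  unfolding time0_def using pad_sum[of "\<lambda>p. near_time Y p c (peak Y c)"] .

lemma time1_pads:
  "time1 Y c = far_time Y p c (pad_length Y) - far_time Y p c (valley Y c)
     + far_time Y (other_pad p) c (pad_length Y) - far_time Y (other_pad p) c (valley Y c)"
  unfolding time1_def
  using pad_sum[of "\<lambda>p. far_time Y p c (pad_length Y) - far_time Y p c (valley Y c)" p] by simp

lemma near_le_peak: "right_at Y p (c p) \<le> peak Y c"
  by (cases p) (auto simp: peak_def)

lemma valley_le_far: "valley Y c \<le> left_at Y p (c p + 1)"
  by (cases p) (auto simp: valley_def)

section \<open>Elementary facts about pads, splits and turning points\<close>

locale yard =
  fixes Y :: stockyard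
  assumes valid: "valid_stockyard Y"
begin

lemma
  shows length_pos: "1 \<le> real_of_int (pad_length Y)"
    and speed_ge: "1 \<le> speed Y"
    and num_pos: "1 \<le> num Y"
    and num1_le: "num1 Y \<le> num Y"
  using valid by (auto simp: valid_stockyard_def)

lemma stockpiles_eq: "stockpiles Y p = {offset Y p + 1..offset Y p + pile_num Y p}"
  using num1_le by (cases p) auto

lemma stockpiles_sub: "stockpiles Y p \<subseteq> {1..num Y}"
  using num1_le by (cases p) auto

lemma stockpiles_disjoint: "stockpiles Y p \<inter> stockpiles Y (other_pad p) = {}"
  by (cases p) auto

lemma stockpiles_union: "stockpiles Y p \<union> stockpiles Y (other_pad p) = {1..num Y}"
  using num1_le by (cases p) auto

lemma near_sub: "i \<le> pile_num Y p \<Longrightarrow> near Y p i \<subseteq> stockpiles Y p"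
  by (auto simp: near_def stockpiles_eq)

lemma far_sub: "far Y p i \<subseteq> stockpiles Y p"
  by (auto simp: far_def stockpiles_eq)

lemma stockpile_diff_near: "i \<le> pile_num Y p \<Longrightarrow> stockpiles Y p - near Y p i = far Y p i"
  by (auto simp: near_def far_def stockpiles_eq)

lemma stockpile_bounds:
  assumes "j \<in> {1..num Y}"
  shows "0 \<le> left_end Y j" "left_end Y j < right_end Y j" "right_end Y j \<le> pad_length Y"
  using valid assms by (auto simp: valid_stockyard_def)

lemma stockpile_order:
  "i \<in> stockpiles Y p \<Longrightarrow> j \<in> stockpiles Y p \<Longrightarrow> i < j \<Longrightarrow> right_end Y i \<le> left_end Y j"
  using valid by (auto simp: valid_stockyard_def)

lemma proper_sub: "J \<subseteq> {1..num Y} \<Longrightarrow> proper Y J"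
  using stockpile_bounds finite_subset by blast

lemma proper_near: "i \<le> pile_num Y p \<Longrightarrow> proper Y (near Y p i)"
  using proper_sub near_sub stockpiles_sub by (meson subset_trans)

lemma proper_far: "proper Y (far Y p i)"
  using proper_sub far_sub stockpiles_sub by (meson subset_trans)

lemma travel_time_near_zero: "i \<le> pile_num Y p \<Longrightarrow> travel_time Y (near Y p i) 0 = 0"
  using near_sub stockpiles_sub stockpile_bounds by (intro travel_time_zero) blast

lemma in_stockpiles: "1 \<le> i \<Longrightarrow> i \<le> pile_num Y p \<Longrightarrow> offset Y p + i \<in> stockpiles Y p"
  by (auto simp: stockpiles_eq)

lemma right_at_pos: "1 \<le> i \<Longrightarrow> i \<le> pile_num Y p \<Longrightarrow> 1 \<le> right_at Y p i"
  using stockpile_bounds[of "offset Y p + i"] in_stockpiles[of i p] stockpiles_sub[of p]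
  by (auto simp: right_at_def)

lemma right_at_bounds: "0 \<le> right_at Y p i" "right_at Y p i \<le> pad_length Y"
  using stockpile_bounds[of "offset Y p + i"] in_stockpiles[of i p] stockpiles_sub[of p] length_pos
  by (auto simp: right_at_def)

lemma left_at_bounds: "0 \<le> left_at Y p i" "left_at Y p i \<le> pad_length Y"
  using stockpile_bounds[of "offset Y p + i"] in_stockpiles[of i p] stockpiles_sub[of p] length_pos
  by (auto simp: left_at_def)

lemma left_at_le: "1 \<le> i \<Longrightarrow> i \<le> pile_num Y p \<Longrightarrow> left_at Y p i \<le> pad_length Y - 1"
  using stockpile_bounds[of "offset Y p + i"] in_stockpiles[of i p] stockpiles_sub[of p] length_pos
  by (auto simp: left_at_def)

lemma left_right_at: "1 \<le> i \<Longrightarrow> i \<le> pile_num Y p \<Longrightarrow> left_at Y p i < right_at Y p i"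
  using stockpile_bounds[of "offset Y p + i"] in_stockpiles[of i p] stockpiles_sub[of p]
  by (auto simp: left_at_def right_at_def)

text \<open>The default values 0 and \<open>pad_length Y\<close> outside the range of stockpiles
  make this hold for all indices, so empty shares need no separate treatment later.\<close>

lemma right_left_at: "i < j \<Longrightarrow> right_at Y p i \<le> left_at Y p j"
proof (cases "1 \<le> i \<and> j \<le> pile_num Y p")
  case True
  then show "i < j \<Longrightarrow> ?thesis"
    using stockpile_order[OF in_stockpiles in_stockpiles, of i p j]
    by (auto simp: left_at_def right_at_def)
next
  case False
  then show "i < j \<Longrightarrow> ?thesis" using left_at_bounds(1)[of p j] right_at_bounds(2)[of p i]
    by (auto simp: left_at_def right_at_def)
qed

lemma right_at_mono: "i \<le> j \<Longrightarrow> j \<le> pile_num Y p \<Longrightarrow> right_at Y p i \<le> right_at Y p j"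
  using right_left_at[of i j p] left_right_at[of j p] by (cases "i = j") auto

lemma left_at_mono: "1 \<le> i \<Longrightarrow> i \<le> j \<Longrightarrow> left_at Y p i \<le> left_at Y p j"
  using right_left_at[of i j p] left_right_at[of i p] left_at_bounds(2)[of p i]
  by (cases "i = j"; cases "i \<le> pile_num Y p") (auto simp: left_at_def)

lemma near_right:
  assumes "j \<in> near Y p i" "i \<le> pile_num Y p"
  shows "right_end Y j \<le> right_at Y p i"
proof -
  obtain k where "j = offset Y p + k" "1 \<le> k" "k \<le> i"
    using assms nat_le_iff_add[of "offset Y p" j] by (auto simp: near_def)
  then show ?thesis using right_at_mono[of k i p] assms by (auto simp: right_at_def)
qed

lemma far_left:
  assumes "j \<in> far Y p i"
  shows "left_at Y p (i + 1) \<le> left_end Y j"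
proof -
  obtain k where "j = offset Y p + k" "i + 1 \<le> k" "k \<le> pile_num Y p"
    using assms nat_le_iff_add[of "offset Y p" j] by (auto simp: far_def)
  then show ?thesis using left_at_mono[of "i + 1" k p] by (auto simp: left_at_def)
qed

lemma peak_bounds: "1 / 3 \<le> peak Y c" "peak Y c \<le> pad_length Y"
  using right_at_bounds length_pos by (auto simp: peak_def)

lemma valley_bounds: "0 \<le> valley Y c" "valley Y c \<le> pad_length Y - 1 / 3"
  using left_at_bounds length_pos by (auto simp: valley_def)

definition is_split :: "(pad \<Rightarrow> nat) \<Rightarrow> bool" where
  "is_split c \<longleftrightarrow> (\<forall>p. c p \<le> pile_num Y p)"

definition idle0 :: "(pad \<Rightarrow> nat) \<Rightarrow> bool" where
  "idle0 c \<longleftrightarrow> (\<forall>p. c p = 0)"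

definition idle1 :: "(pad \<Rightarrow> nat) \<Rightarrow> bool" where
  "idle1 c \<longleftrightarrow> (\<forall>p. c p = pile_num Y p)"

lemma not_both_idle: "\<not> (idle0 c \<and> idle1 c)"
proof
  assume a: "idle0 c \<and> idle1 c"
  then have "pile_num Y Pad1 = 0" "pile_num Y Pad2 = 0" by (metis idle0_def idle1_def)+
  then show False using num_pos by simp
qed

lemma all_pads: "(\<forall>p. P p) \<longleftrightarrow> P Pad1 \<and> P Pad2"
  by (metis pad.exhaust)

text \<open>Ends of stockpiles are integers, so a nonempty share reaches at least to 1 and the
  substitute 1/3 drops out of the maximum.\<close>

lemma peak_not_idle:
  assumes "is_split c" "\<not> idle0 c"
  shows "1 \<le> peak Y c" and "peak Y c = max (right_at Y Pad1 (c Pad1)) (right_at Y Pad2 (c Pad2))"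
proof -
  obtain p where p: "0 < c p" using assms by (auto simp: idle0_def)
  then have "1 \<le> right_at Y p (c p)" using assms right_at_pos[of "c p" p] by (auto simp: is_split_def)
  then show "1 \<le> peak Y c" "peak Y c = max (right_at Y Pad1 (c Pad1)) (right_at Y Pad2 (c Pad2))"
    by (cases p; auto simp: peak_def)+
qed

lemma valley_not_idle:
  assumes "is_split c" "\<not> idle1 c"
  shows "valley Y c \<le> pad_length Y - 1"
    and "valley Y c = min (left_at Y Pad1 (c Pad1 + 1)) (left_at Y Pad2 (c Pad2 + 1))"
proof -
  obtain p where p: "c p < pile_num Y p"
    using assms by (auto simp: idle1_def is_split_def intro: le_neq_implies_less)
  then have "left_at Y p (c p + 1) \<le> pad_length Y - 1" using left_at_le[of "c p + 1" p] by auto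
  then show "valley Y c \<le> pad_length Y - 1"
    "valley Y c = min (left_at Y Pad1 (c Pad1 + 1)) (left_at Y Pad2 (c Pad2 + 1))"
    by (cases p; auto simp: valley_def)+
qed

lemma time0_ge:
  assumes "is_split c"
  shows "2 * peak Y c / speed Y \<le> time0 Y c"
proof -
  have "peak Y c / speed Y \<le> near_time Y p c (peak Y c)" for p
    using travel_time_lower[OF speed_ge, of 0 "peak Y c" "near Y p (c p)"] peak_bounds[of c] assms
    by (simp add: travel_time_near_zero is_split_def)
  from this[of Pad1] this[of Pad2] show ?thesis by (simp add: time0_def)
qed

lemma time1_ge: "2 * (pad_length Y - valley Y c) / speed Y \<le> time1 Y c"
proof -
  have "(pad_length Y - valley Y c) / speed Y \<le>
      far_time Y p c (pad_length Y) - far_time Y p c (valley Y c)" for p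
    using valley_bounds[of c] by (intro travel_time_lower speed_ge) auto
  from this[of Pad1] this[of Pad2] show ?thesis by (simp add: time1_def diff_divide_distrib)
qed

lemma time0_idle:
  assumes "idle0 c"
  shows "peak Y c = 1 / 3" "near Y p (c p) = {}" "time0 Y c = 2 / (3 * speed Y)"
  using assms by (auto simp: idle0_def peak_def right_at_def near_def time0_def travel_time_def)

lemma time1_idle:
  assumes "idle1 c"
  shows "valley Y c = pad_length Y - 1 / 3" "far Y p (c p) = {}" "time1 Y c = 2 / (3 * speed Y)"
proof -
  show *: "valley Y c = pad_length Y - 1 / 3" "far Y p (c p) = {}" for p
    using assms by (auto simp: idle1_def valley_def left_at_def far_def)
  show "time1 Y c = 2 / (3 * speed Y)"
    using speed_ge by (simp add: * time1_def travel_time_def field_simps)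
qed

text \<open>The excursion of an idle \<open>R0\<close> takes \<open>2 / (3 * speed Y)\<close>, while
  \<open>R1\<close> then has work and covers distance at least 1 in both directions. So idleness
  never decides the makespan.\<close>

lemma time0_le_time1:
  assumes "idle0 c" "is_split c"
  shows "time0 Y c \<le> time1 Y c"
proof -
  have "2 * 1 / speed Y \<le> 2 * (pad_length Y - valley Y c) / speed Y"
    using valley_not_idle(1)[OF assms(2)] assms not_both_idle speed_ge
    by (intro divide_right_mono) auto
  moreover have "2 / (3 * speed Y) \<le> 2 * 1 / speed Y" using speed_ge by (simp add: field_simps)
  ultimately show ?thesis using time1_ge[of c] time0_idle(3)[OF assms(1)] by linarith
qed

lemma time1_le_time0:
  assumes "idle1 c" "is_split c"
  shows "time1 Y c \<le> time0 Y c"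
proof -
  have "2 * 1 / speed Y \<le> 2 * peak Y c / speed Y"
    using peak_not_idle(1)[OF assms(2)] assms not_both_idle speed_ge
    by (intro divide_right_mono) auto
  moreover have "2 / (3 * speed Y) \<le> 2 * 1 / speed Y" using speed_ge by (simp add: field_simps)
  ultimately show ?thesis using time0_ge[OF assms(2)] time1_idle(3)[OF assms(1)] by linarith
qed

end

section \<open>The lower bound\<close>

definition directions :: "trajectory \<Rightarrow> direction list" where
  "directions ps = List.map_filter (move_direction \<circ> fst) ps"

lemma directions_simps [simp]:
  "directions [] = []"
  "directions (q # ps) = (case move_direction (fst q) of None \<Rightarrow> directions ps | Some D \<Rightarrow> D # directions ps)"
  by (simp_all add: directions_def map_filter_simps split: option.splits)

lemma directions_append: "directions (ps @ qs) = directions ps @ directions qs"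
  by (induction ps) (auto split: option.splits)

lemma directions_append_split:
  assumes "directions ps = us @ vs"
  shows "\<exists>ps1 ps2. ps = ps1 @ ps2 \<and> directions ps1 = us \<and> directions ps2 = vs"
  using assms
proof (induction ps arbitrary: us)
  case Nil
  then show ?case by auto
next
  case (Cons q ps)
  show ?case
  proof (cases "move_direction (fst q)")
    case None
    then have "directions ps = us @ vs" using Cons.prems by simp
    from Cons.IH[OF this] obtain ps1 ps2 where
      "ps = ps1 @ ps2 \<and> directions ps1 = us \<and> directions ps2 = vs" by blast
    then show ?thesis using None by (intro exI[of _ "q # ps1"] exI[of _ ps2]) auto
  next
    case (Some D)
    show ?thesis
    proof (cases us)
      case Nil
      then show ?thesis using Cons.prems by (intro exI[of _ "[]"] exI[of _ "q # ps"]) auto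
    next
      case (Cons u us')
      then have "u = D" "directions ps = us' @ vs"
        using Cons.prems Some by (simp_all)
      from Cons.IH[OF this(2)] \<open>u = D\<close> obtain ps1 ps2 where
        "ps = ps1 @ ps2 \<and> directions ps1 = us' \<and> directions ps2 = vs" "u = D" by blast
      then show ?thesis using Some Cons
        by (intro exI[of _ "q # ps1"] exI[of _ ps2]) auto
    qed
  qed
qed

lemma set_directions: "set (directions ps) = {D. \<exists>q\<in>set ps. move_direction (fst q) = Some D}"
  by (induction ps) (auto split: option.splits)

lemma remdups_adj_pair:
  assumes "remdups_adj xs = [a, b]"
  shows "\<exists>us vs. xs = us @ vs \<and> set us = {a} \<and> set vs = {b}"
  using assms
proof (induction xs rule: remdups_adj.induct)
  case (3 x y xs)
  show ?case
  proof (cases "x = y")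
    case True
    then obtain us vs where "y # xs = us @ vs" "set us = {a}" "set vs = {b}" using 3 by auto
    moreover have "y = a" using True 3 calculation by (cases us) auto
    ultimately show ?thesis using True by (intro exI[of _ "x # us"] exI[of _ vs]) auto
  next
    case False
    then have "x = a" "remdups_adj (y # xs) = [b]" using 3 by auto
    then have "set (y # xs) = {b}" by (metis remdups_adj_set list.set(1,2))
    then show ?thesis using \<open>x = a\<close> by (intro exI[of _ "[x]"] exI[of _ "y # xs"]) auto
  qed
qed auto

lemma remdups_adj_pair_neq: "remdups_adj xs = [a, b] \<Longrightarrow> a \<noteq> b"
  by (metis distinct_adj_remdups_adj distinct_adj_Cons_Cons)

lemma other_direction: "D \<noteq> outward k \<Longrightarrow> D = homeward k"
  by (cases k; cases D) auto

lemma signum_homeward: "signum (homeward k) = - signum (outward k)"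
  by (cases k) auto

lemma oriented_displacement_pos:
  assumes "oriented D ps" "D \<in> set (directions ps)" "valid_from Y x ps" "0 < speed Y"
  shows "0 < signum D * displacement (speed Y) ps"
  using assms
proof (induction ps arbitrary: x)
  case Nil
  then show ?case by simp
next
  case (Cons q ps)
  obtain m d where q: "q = (m, d)" by force
  have nn: "nonneg_durations ps" using Cons.prems valid_from_nonneg by (auto simp: q)
  show ?case
  proof (cases "move_direction m")
    case None
    then have "m = Wait" by (cases m) auto
    then show ?thesis using Cons by (auto simp: q)
  next
    case (Some D')
    then have "0 < signum D * (velocity (speed Y) m * d)"
      using Cons.prems by (cases m; cases D) (auto simp: q)
    moreover have "0 \<le> signum D * displacement (speed Y) ps"
      using Cons.prems nn by (intro oriented_displacement) (auto simp: q)
    ultimately show ?thesis by (simp add: q distrib_left)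
  qed
qed

lemma pos_ge_zero:
  assumes "reclaimer_schedule Y S k" "0 \<le> t"
  shows "pos Y S k t \<in> {0..real_of_int (pad_length Y)}"
proof (cases "t \<le> duration (S k)")
  case True
  then show ?thesis using assms by (auto simp: reclaimer_schedule_def)
next
  case False
  have nn: "nonneg_durations (S k)" using assms valid_from_nonneg by (auto simp: reclaimer_schedule_iff)
  have "pos Y S k t = pos Y S k (duration (S k))"
    using False nn by (simp add: pos_def path_late)
  moreover have "pos Y S k (duration (S k)) \<in> {0..real_of_int (pad_length Y)}"
    using assms duration_nonneg[OF nn] unfolding reclaimer_schedule_def by (meson atLeastAtMost_iff order_refl)
  ultimately show ?thesis by simp
qed

text \<open>One change of direction gives two maximal runs; waiting belongs to either of them. That
  the first one leads away from home is not demanded explicitly but forced by the ends of the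
  rail.\<close>

lemma (in yard) unimodal_split:
  assumes sched: "reclaimer_schedule Y S k" and one: "direction_changes (S k) = 1"
  obtains ps qs where "S k = ps @ qs" "oriented (outward k) ps" "oriented (homeward k) qs"
proof -
  have "length (remdups_adj (directions (S k))) = 2"
    using one by (simp add: direction_changes_def directions_def)
  then obtain D E where DE: "remdups_adj (directions (S k)) = [D, E]"
    by (auto simp: numeral_2_eq_2 length_Suc_conv)
  from remdups_adj_pair[OF this] obtain us vs where
    uv: "directions (S k) = us @ vs" "set us = {D}" "set vs = {E}" by blast
  from directions_append_split[OF uv(1)] obtain ps qs where
    split: "S k = ps @ qs" and dirs: "directions ps = us" "directions qs = vs" by blast
  have "move_direction (fst q) = None \<or> move_direction (fst q) = Some D" if "q \<in> set ps" for q
    using set_directions[of ps] that uv(2) dirs by (cases "move_direction (fst q)") auto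
  then have ops: "oriented D ps" by (auto simp: oriented_def)
  have "move_direction (fst q) = None \<or> move_direction (fst q) = Some E" if "q \<in> set qs" for q
    using set_directions[of qs] that uv(3) dirs by (cases "move_direction (fst q)") auto
  then have oqs: "oriented E qs" by (auto simp: oriented_def)
  have v: "valid_from Y (home Y k) ps" and nn: "nonneg_durations (S k)"
    using sched valid_from_nonneg by (auto simp: reclaimer_schedule_iff split valid_from_append)
  have "0 < signum D * displacement (speed Y) ps"
    using oriented_displacement_pos[OF ops _ v] dirs uv speed_ge by auto
  moreover have "pos Y S k (duration ps) = home Y k + displacement (speed Y) ps"
  proof -
    have "nonneg_durations ps" "nonneg_durations qs" using nn split by auto
    then show ?thesis by (simp add: pos_def split path_append_late path_zero)
  qed
  moreover have "pos Y S k (duration ps) \<in> {0..real_of_int (pad_length Y)}"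
    using nn by (intro pos_ge_zero[OF sched] duration_nonneg) (simp add: split)
  \<comment> \<open>The first run has nonzero displacement and starts at an end of the rail, so in
    the opposite direction it would leave the rail.\<close>
  ultimately have "D = outward k" by (cases k; cases D) auto
  moreover then have "E = homeward k" using remdups_adj_pair_neq[OF DE] other_direction by metis
  ultimately show ?thesis using that split ops oqs by blast
qed

lemma oriented_reclaimed_other: "oriented D ps \<Longrightarrow> D' \<noteq> D \<Longrightarrow> reclaimed ps D' = {}"
  by (force simp: oriented_def reclaimed_def)

lemma homeward_neq: "homeward k \<noteq> outward k" "outward k \<noteq> homeward k"
  by (cases k; simp)+

lemma entry_homeward: "entry Y j (homeward k) = exit Y j (outward k)"
  by (cases k) auto

text \<open>Extracts all that the lower bound uses about one reclaimer: before and after a turning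
  time \<open>\<tau>\<close> the position is monotone, and its travel time changes no faster than
  the clock. Both phases are expressed with the outward sign, and the second one extends beyond the
  end of the schedule.\<close>

lemma (in yard) turning_time:
  assumes sched: "reclaimer_schedule Y S k" and one: "direction_changes (S k) = 1"
    and out: "proper Y (reclaimed (S k) (outward k))" and hom: "proper Y (reclaimed (S k) (homeward k))"
  obtains \<tau> where "0 \<le> \<tau>" "\<tau> \<le> duration (S k)"
    and "\<And>t1 t2. 0 \<le> t1 \<Longrightarrow> t1 \<le> t2 \<Longrightarrow> t2 \<le> \<tau> \<Longrightarrow>
      0 \<le> signum (outward k) * (pos Y S k t2 - pos Y S k t1) \<and>
      signum (outward k) * (travel_time Y (reclaimed (S k) (outward k)) (pos Y S k t2) -
        travel_time Y (reclaimed (S k) (outward k)) (pos Y S k t1)) \<le> t2 - t1"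
    and "\<And>t1 t2. \<tau> \<le> t1 \<Longrightarrow> t1 \<le> t2 \<Longrightarrow>
      0 \<le> signum (outward k) * (pos Y S k t1 - pos Y S k t2) \<and>
      signum (outward k) * (travel_time Y (reclaimed (S k) (homeward k)) (pos Y S k t1) -
        travel_time Y (reclaimed (S k) (homeward k)) (pos Y S k t2)) \<le> t2 - t1"
    and "\<And>j. j \<in> reclaimed (S k) (outward k) \<union> reclaimed (S k) (homeward k) \<Longrightarrow>
      0 \<le> signum (outward k) * (pos Y S k \<tau> - exit Y j (outward k))"
proof -
  from unimodal_split[OF sched one] obtain ps qs where
    split: "S k = ps @ qs" and o: "oriented (outward k) ps" "oriented (homeward k) qs" .
  let ?\<tau> = "duration ps" and ?D = "outward k" and ?E = "homeward k"
  let ?x = "home Y k + displacement (speed Y) ps"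
  have v: "valid_from Y (home Y k) ps" "valid_from Y ?x qs"
    using sched by (auto simp: reclaimer_schedule_iff split valid_from_append)
  note nn = valid_from_nonneg[OF v(1)] valid_from_nonneg[OF v(2)]
  have R: "reclaimed (S k) ?D = reclaimed ps ?D" "reclaimed (S k) ?E = reclaimed qs ?E"
    using oriented_reclaimed_other[OF o(1) homeward_neq(1)] oriented_reclaimed_other[OF o(2) homeward_neq(2)]
    by (auto simp: split)
  have early: "pos Y S k t = path (speed Y) (home Y k) ps t" if "0 \<le> t" "t \<le> ?\<tau>" for t
    using that nn by (simp add: pos_def split path_append_early)
  have late: "pos Y S k t = path (speed Y) ?x qs (t - ?\<tau>)" if "?\<tau> \<le> t" for t
    using that nn by (simp add: pos_def split path_append_late)
  have turn: "pos Y S k ?\<tau> = ?x" using late[of ?\<tau>] nn by (simp add: path_zero)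
  show ?thesis
  proof (rule that[of ?\<tau>])
    show "0 \<le> ?\<tau>" "?\<tau> \<le> duration (S k)"
      using nn by (simp_all add: duration_nonneg duration_append split)
  next
    fix t1 t2 :: real assume t: "0 \<le> t1" "t1 \<le> t2" "t2 \<le> ?\<tau>"
    show "0 \<le> signum ?D * (pos Y S k t2 - pos Y S k t1) \<and>
      signum ?D * (travel_time Y (reclaimed (S k) ?D) (pos Y S k t2) -
        travel_time Y (reclaimed (S k) ?D) (pos Y S k t1)) \<le> t2 - t1"
      using oriented_mono[OF o(1) nn(1), of "speed Y" t1 t2] t speed_ge
        oriented_travel_time(1)[OF v(1) o(1) speed_ge out[unfolded R], of t1 t2]
      by (simp add: early R)
  next
    fix t1 t2 :: real assume t: "?\<tau> \<le> t1" "t1 \<le> t2"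
    show "0 \<le> signum ?D * (pos Y S k t1 - pos Y S k t2) \<and>
      signum ?D * (travel_time Y (reclaimed (S k) ?E) (pos Y S k t1) -
        travel_time Y (reclaimed (S k) ?E) (pos Y S k t2)) \<le> t2 - t1"
      using oriented_mono[OF o(2) nn(2), of "speed Y" "t1 - ?\<tau>" "t2 - ?\<tau>"] t speed_ge
        oriented_travel_time(1)[OF v(2) o(2) speed_ge hom[unfolded R], of "t1 - ?\<tau>" "t2 - ?\<tau>"]
      by (simp add: late R signum_homeward algebra_simps)
  next
    fix j assume "j \<in> reclaimed (S k) ?D \<union> reclaimed (S k) ?E"
    then show "0 \<le> signum ?D * (pos Y S k ?\<tau> - exit Y j ?D)"
      using oriented_reclaimed(2)[OF v(1) o(1), of j] oriented_reclaimed(1)[OF v(2) o(2), of j] speed_ge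
      by (auto simp: R turn signum_homeward entry_homeward algebra_simps)
  qed
qed

section \<open>From a contiguous unimodal schedule to a split\<close>

lemma set_stockpiles_of: "set (stockpiles_of ps) = (\<Union>D. reclaimed ps D)"
proof (induction ps)
  case Nil
  then show ?case by (simp add: stockpiles_of_def map_filter_simps)
next
  case (Cons q ps)
  then show ?case by (cases q; cases "fst q") (auto simp: stockpiles_of_def map_filter_simps split: if_splits)
qed

lemma UN_direction: "(\<Union>D. f D) = f (outward k) \<union> f (homeward k)"
  by (cases k) (auto, (metis direction.exhaust)+)

lemma initial_segment:
  assumes "A \<subseteq> {m + 1..m + n :: nat}" "\<And>i j. i \<in> A \<Longrightarrow> m < j \<Longrightarrow> j \<le> i \<Longrightarrow> j \<in> A"
  obtains k where "k \<le> n" "A = {m + 1..m + k}"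
proof (cases "A = {}")
  case True
  then show ?thesis using that[of 0] by simp
next
  case False
  have fin: "finite A" using assms(1) finite_subset by blast
  have max: "Max A \<in> A" "\<And>x. x \<in> A \<Longrightarrow> x \<le> Max A" using fin False by auto
  have "m < Max A" "Max A \<le> m + n" using assms(1) max(1) by auto
  moreover have "A = {m + 1..Max A}" using assms max by (fastforce simp: subset_iff)
  ultimately have "A = {m + 1..m + (Max A - m)}" "Max A - m \<le> n" by auto
  then show ?thesis using that by blast
qed

text \<open>Stockpiles of a pad do not overlap and are indexed from left to right, so those that end
  before \<open>x\<close> are closed under passing to smaller indices.\<close>

lemma (in yard) home_side_near:
  obtains i where "i \<le> pile_num Y p" "on_home_side Y R0 p x = near Y p i"
proof -
  have "on_home_side Y R0 p x \<subseteq> {offset Y p + 1..offset Y p + pile_num Y p}"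
    by (auto simp: stockpiles_eq)
  moreover have "j \<in> on_home_side Y R0 p x"
    if "i \<in> on_home_side Y R0 p x" "offset Y p < j" "j \<le> i" for i j
  proof (cases "i = j")
    case False
    have "i \<in> stockpiles Y p" "j \<in> stockpiles Y p" using that by (auto simp: stockpiles_eq)
    then have "right_end Y j \<le> left_end Y i" "left_end Y i < right_end Y i"
      using stockpile_order[of j p i] False that stockpile_bounds[of i] stockpiles_sub[of p] by auto
    then show ?thesis using that \<open>j \<in> stockpiles Y p\<close> by auto
  qed (use that in simp)
  ultimately show ?thesis using initial_segment that unfolding near_def by metis
qed

text \<open>Only the share of \<open>R0\<close> is recognised as an initial segment on each pad. The
  share of \<open>R1\<close> is then its complement, because every stockpile is reclaimed exactly
  once.\<close>

lemma (in yard) split_of_schedule: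
  assumes "contiguous_unimodal Y S"
  obtains c o0 o1 where "is_split c"
    "reclaimed (S R0) (outward R0) = near Y o0 (c o0)"
    "reclaimed (S R0) (homeward R0) = near Y (other_pad o0) (c (other_pad o0))"
    "reclaimed (S R1) (outward R1) = far Y o1 (c o1)"
    "reclaimed (S R1) (homeward R1) = far Y (other_pad o1) (c (other_pad o1))"
proof -
  have "\<exists>p x y. reclaimed (S k) (outward k) = on_home_side Y k p x \<and>
      reclaimed (S k) (homeward k) = on_home_side Y k (other_pad p) y" for k
    using assms unfolding contiguous_unimodal_def by blast
  then obtain o0 x0 y0 o1 x1 y1 where
    r0: "reclaimed (S R0) (outward R0) = on_home_side Y R0 o0 x0"
      "reclaimed (S R0) (homeward R0) = on_home_side Y R0 (other_pad o0) y0" and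
    r1: "reclaimed (S R1) (outward R1) = on_home_side Y R1 o1 x1"
      "reclaimed (S R1) (homeward R1) = on_home_side Y R1 (other_pad o1) y1"
    by metis
  obtain i where i: "i \<le> pile_num Y o0" "on_home_side Y R0 o0 x0 = near Y o0 i"
    by (rule home_side_near)
  obtain j where j: "j \<le> pile_num Y (other_pad o0)"
    "on_home_side Y R0 (other_pad o0) y0 = near Y (other_pad o0) j"
    by (rule home_side_near)
  define c where "c = (\<lambda>p. if p = o0 then i else j)"
  have c: "is_split c"
    unfolding is_split_def c_def using i j by (metis (full_types) other_pad.cases other_pad.simps)
  have near: "near Y p (c p) = set (stockpiles_of (S R0)) \<inter> stockpiles Y p" for p
  proof -
    have "near Y o0 i \<subseteq> stockpiles Y o0" "near Y (other_pad o0) j \<subseteq> stockpiles Y (other_pad o0)"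
      using near_sub i j by auto
    moreover have "set (stockpiles_of (S R0)) = near Y o0 i \<union> near Y (other_pad o0) j"
      by (simp only: set_stockpiles_of UN_direction[of _ R0] r0 i j)
    moreover have "p = o0 \<or> p = other_pad o0" by (cases p; cases o0) auto
    ultimately show ?thesis using stockpiles_disjoint[of o0] by (auto simp: c_def)
  qed
  have ms: "mset (stockpiles_of (S R0)) + mset (stockpiles_of (S R1)) = mset_set {1..num Y}"
    using assms by (auto simp: contiguous_unimodal_def feasible_def)
  then have union: "set (stockpiles_of (S R0)) \<union> set (stockpiles_of (S R1)) = {1..num Y}"
    by (metis finite_atLeastAtMost finite_set_mset_mset_set set_mset_mset set_mset_union)
  \<comment> \<open>A stockpile reclaimed by both would have multiplicity at least 2 on the
    left-hand side of \<open>ms\<close>, while \<open>mset_set\<close> has multiplicities at most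
    1.\<close>
  have disj: "set (stockpiles_of (S R0)) \<inter> set (stockpiles_of (S R1)) = {}"
  proof -
    have le: "count (mset (stockpiles_of (S R0))) j + count (mset (stockpiles_of (S R1))) j \<le> 1" for j
      using arg_cong[OF ms, of "\<lambda>M. count M j"] by (simp add: count_mset_set')
    have ge: "1 \<le> count (mset (stockpiles_of ps)) j" if "j \<in> set (stockpiles_of ps)" for j ps
      using that count_greater_zero_iff[of "mset (stockpiles_of ps)" j] by (simp add: Suc_le_eq)
    show ?thesis
    proof (rule equals0I)
      fix j assume "j \<in> set (stockpiles_of (S R0)) \<inter> set (stockpiles_of (S R1))"
      then have "1 \<le> count (mset (stockpiles_of (S R0))) j" "1 \<le> count (mset (stockpiles_of (S R1))) j"
        using ge by blast+
      then show False using le[of j] by linarith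
    qed
  qed
  have far: "far Y p (c p) = set (stockpiles_of (S R1)) \<inter> stockpiles Y p" for p
  proof -
    have "far Y p (c p) = stockpiles Y p - near Y p (c p)"
      using stockpile_diff_near c by (simp add: is_split_def)
    then show ?thesis using union disj near[of p] stockpiles_sub[of p] by auto
  qed
  have s1: "set (stockpiles_of (S R1)) =
      on_home_side Y R1 o1 x1 \<union> on_home_side Y R1 (other_pad o1) y1"
    by (simp only: set_stockpiles_of UN_direction[of _ R1] r1)
  show ?thesis
  proof (rule that[OF c])
    show "reclaimed (S R0) (outward R0) = near Y o0 (c o0)"
      "reclaimed (S R0) (homeward R0) = near Y (other_pad o0) (c (other_pad o0))"
      by (simp_all only: r0 i j c_def) auto
    show "reclaimed (S R1) (outward R1) = far Y o1 (c o1)"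
      "reclaimed (S R1) (homeward R1) = far Y (other_pad o1) (c (other_pad o1))"
      unfolding far s1 r1 using stockpiles_disjoint[of o1] by auto
  qed
qed


text \<open>
  The reclaimer that turns first has to leave \<open>z\<close> before the other one arrives there.  If this is
  \<open>R1\<close>, then reversing time leads back to the case that it is \<open>R0\<close>; this exchanges the two pads.
\<close>

lemma (in yard) lower_bound:
  assumes cu: "contiguous_unimodal Y S"
  obtains o0 o1 c where "is_split c" "time0 Y c \<le> makespan S" "time1 Y c \<le> makespan S"
    and "\<And>z. \<not> idle0 c \<Longrightarrow> \<not> idle1 c \<Longrightarrow> valley Y c \<le> z \<Longrightarrow> z \<le> peak Y c \<Longrightarrow>
      time1 Y c + need Y o0 o1 c z \<le> makespan S"
proof -
  from split_of_schedule[OF cu] obtain c o0 o1 where c: "is_split c"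
    and R: "reclaimed (S R0) (outward R0) = near Y o0 (c o0)"
    "reclaimed (S R0) (homeward R0) = near Y (other_pad o0) (c (other_pad o0))"
    "reclaimed (S R1) (outward R1) = far Y o1 (c o1)"
    "reclaimed (S R1) (homeward R1) = far Y (other_pad o1) (c (other_pad o1))" .
  have cp: "c p \<le> pile_num Y p" for p using c by (simp add: is_split_def)
  have sched: "reclaimer_schedule Y S k" and one: "direction_changes (S k) = 1" for k
    using cu by (auto simp: contiguous_unimodal_def feasible_def)
  have apart: "pos Y S R0 t \<le> pos Y S R1 t" if "0 \<le> t" for t
    using cu that by (auto simp: contiguous_unimodal_def feasible_def)
  let ?H0 = "pos Y S R0" and ?H1 = "pos Y S R1" and ?L = "real_of_int (pad_length Y)"
  let ?N = "\<lambda>p. near_time Y p c" and ?F = "\<lambda>p. far_time Y p c"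
  let ?q0 = "other_pad o0" and ?q1 = "other_pad o1"
  let ?d0 = "duration (S R0)" and ?d1 = "duration (S R1)"
  have P0: "proper Y (reclaimed (S R0) (outward R0))" "proper Y (reclaimed (S R0) (homeward R0))"
    and P1: "proper Y (reclaimed (S R1) (outward R1))" "proper Y (reclaimed (S R1) (homeward R1))"
    unfolding R by (rule proper_near[OF cp] proper_far)+
  obtain \<tau>0 where t0: "0 \<le> \<tau>0" "\<tau>0 \<le> ?d0"
    and out0: "\<And>t1 t2. 0 \<le> t1 \<Longrightarrow> t1 \<le> t2 \<Longrightarrow> t2 \<le> \<tau>0 \<Longrightarrow>
      ?H0 t1 \<le> ?H0 t2 \<and> ?N o0 (?H0 t2) - ?N o0 (?H0 t1) \<le> t2 - t1"
    and home0: "\<And>t1 t2. \<tau>0 \<le> t1 \<Longrightarrow> t1 \<le> t2 \<Longrightarrow>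
      ?H0 t2 \<le> ?H0 t1 \<and> ?N ?q0 (?H0 t1) - ?N ?q0 (?H0 t2) \<le> t2 - t1"
    and turn0: "\<And>j. j \<in> near Y o0 (c o0) \<union> near Y ?q0 (c ?q0) \<Longrightarrow> right_end Y j \<le> ?H0 \<tau>0"
    by (rule turning_time[OF sched[of R0] one P0, unfolded R]) (rule that; simp)
  obtain \<tau>1 where t1: "0 \<le> \<tau>1" "\<tau>1 \<le> ?d1"
    and out1: "\<And>t1 t2. 0 \<le> t1 \<Longrightarrow> t1 \<le> t2 \<Longrightarrow> t2 \<le> \<tau>1 \<Longrightarrow>
      ?H1 t2 \<le> ?H1 t1 \<and> ?F o1 (?H1 t1) - ?F o1 (?H1 t2) \<le> t2 - t1"
    and home1: "\<And>t1 t2. \<tau>1 \<le> t1 \<Longrightarrow> t1 \<le> t2 \<Longrightarrow>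
      ?H1 t1 \<le> ?H1 t2 \<and> ?F ?q1 (?H1 t2) - ?F ?q1 (?H1 t1) \<le> t2 - t1"
    and turn1: "\<And>j. j \<in> far Y o1 (c o1) \<union> far Y ?q1 (c ?q1) \<Longrightarrow> ?H1 \<tau>1 \<le> left_end Y j"
    by (rule turning_time[OF sched[of R1] one P1, unfolded R]) (rule that; simp)
  have nn: "nonneg_durations (S k)" for k
    using sched[of k] valid_from_nonneg unfolding reclaimer_schedule_iff by blast
  have ends: "?H0 0 = 0" "?H0 ?d0 = 0" "?H1 0 = ?L" "?H1 ?d1 = ?L"
    using sched[of R0] sched[of R1] nn by (auto simp: reclaimer_schedule_def pos_def path_zero)
  have N0: "?N p 0 = 0" for p using travel_time_near_zero cp by blast
  have mk: "?d0 \<le> makespan S" "?d1 \<le> makespan S" by (auto simp: makespan_def)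
  have cont: "continuous_on A (pos Y S k)" for A k
    unfolding pos_def by (rule continuous_on_path[OF nn])
  have mN: "a \<le> b \<Longrightarrow> ?N p a \<le> ?N p b" and mF: "a \<le> b \<Longrightarrow> ?F p a \<le> ?F p b" for a b p
    by (rule travel_time_mono[OF speed_ge]; assumption)+
  \<comment> \<open>An idle \<open>R0\<close> may turn arbitrarily close to its home, below the
    value 1/3 that \<open>peak\<close> assigns to it; so idleness has to be excluded.\<close>
  have peak: "peak Y c \<le> ?H0 \<tau>0" if "\<not> idle0 c"
  proof -
    have "right_at Y p (c p) \<le> ?H0 \<tau>0" for p
    proof (cases "c p = 0")
      case True
      then show ?thesis using pos_ge_zero[OF sched[of R0] t0(1)] by (simp add: right_at_def)
    next
      case False
      then have "offset Y p + c p \<in> near Y o0 (c o0) \<union> near Y ?q0 (c ?q0)"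
        by (cases p; cases o0) (auto simp: near_def)
      from turn0[OF this] show ?thesis using False cp[of p] by (simp add: right_at_def)
    qed
    then show ?thesis using peak_not_idle(2)[OF c that] by simp
  qed
  have valley: "?H1 \<tau>1 \<le> valley Y c" if "\<not> idle1 c"
  proof -
    have "?H1 \<tau>1 \<le> left_at Y p (c p + 1)" for p
    proof (cases "c p = pile_num Y p")
      case True
      then show ?thesis using pos_ge_zero[OF sched[of R1] t1(1)] by (simp add: left_at_def)
    next
      case False
      then have "offset Y p + (c p + 1) \<in> far Y o1 (c o1) \<union> far Y ?q1 (c ?q1)"
        using cp[of p] by (cases p; cases o1) (auto simp: far_def)
      from turn1[OF this] show ?thesis using False cp[of p] by (simp add: left_at_def)
    qed
    then show ?thesis using valley_not_idle(2)[OF c that] by simp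
  qed
  have T0: "time0 Y c \<le> makespan S" if "\<not> idle0 c"
    using out0[of 0 \<tau>0] home0[of \<tau>0 ?d0] t0 ends N0 mk mN[OF peak[OF that], of o0]
      mN[OF peak[OF that], of ?q0] time0_pads[of Y c o0] by simp
  have T1: "time1 Y c \<le> makespan S" if "\<not> idle1 c"
    using out1[of 0 \<tau>1] home1[of \<tau>1 ?d1] t1 ends mk mF[OF valley[OF that], of o1]
      mF[OF valley[OF that], of ?q1] time1_pads[of Y c o1] by simp
  \<comment> \<open>For an idle reclaimer the bound is inherited from the other one, which takes at
    least as long and cannot be idle as well.\<close>
  have times: "time0 Y c \<le> makespan S" "time1 Y c \<le> makespan S"
    using T0 T1 time0_le_time1[OF _ c] time1_le_time0[OF _ c] not_both_idle[of c] by fastforce+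
  show ?thesis
  proof (cases "\<tau>0 \<le> \<tau>1")
    case True
    show ?thesis
    proof (rule that[OF c times])
      fix z assume idle: "\<not> idle0 c" "\<not> idle1 c" and z: "valley Y c \<le> z" "z \<le> peak Y c"
      \<comment> \<open>When \<open>R0\<close> turns at or beyond \<open>z\<close>,
        \<open>R1\<close> is still to the right of it; when \<open>R1\<close> turns, it is at or to
        the left of \<open>z\<close>. So \<open>R1\<close> passes \<open>z\<close> on its way out at
        some time \<open>v\<close> in between. By then \<open>R0\<close> cannot be beyond
        \<open>z\<close>, so it has passed \<open>z\<close> on its way home at some
        \<open>u \<le> v\<close>.\<close>
      have "?H1 \<tau>1 \<le> z" "z \<le> ?H1 \<tau>0"
        using valley[OF idle(2)] peak[OF idle(1)] z apart[OF t0(1)] by simp_all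
      from IVT2'[OF this True cont] obtain v where v: "\<tau>0 \<le> v" "v \<le> \<tau>1" "?H1 v = z" by blast
      have "?H0 v \<le> z" "z \<le> ?H0 \<tau>0" using v apart[of v] t0 z peak[OF idle(1)] by simp_all
      from IVT2'[OF this v(1) cont] obtain u where u: "\<tau>0 \<le> u" "u \<le> v" "?H0 u = z" by blast
      \<comment> \<open>The sum equals the way of \<open>R0\<close> out and back to
        \<open>z\<close>, followed by the way of \<open>R1\<close> from \<open>z\<close> to the
        valley and home. These parts fit into the time before \<open>u\<close> and the time after
        \<open>v\<close>.\<close>
      show "time1 Y c + need Y o0 o1 c z \<le> makespan S"
        unfolding need_def time0_pads[of Y c o0] time1_pads[of Y c o1]
        using out0[of 0 \<tau>0] home0[of \<tau>0 u] out1[of v \<tau>1] home1[of \<tau>1 ?d1] t0 t1 u v ends N0 mk(2)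
          mN[OF peak[OF idle(1)], of o0] mN[OF peak[OF idle(1)], of ?q0]
          mF[OF valley[OF idle(2)], of o1] mF[OF valley[OF idle(2)], of ?q1] by simp
    qed
  next
    case False
    then have le: "\<tau>1 \<le> \<tau>0" by simp
    show ?thesis
    proof (rule that[OF c times])
      fix z assume idle: "\<not> idle0 c" "\<not> idle1 c" and z: "valley Y c \<le> z" "z \<le> peak Y c"
      have "?H0 \<tau>1 \<le> z" "z \<le> ?H0 \<tau>0"
        using valley[OF idle(2)] peak[OF idle(1)] z apart[OF t1(1)] by simp_all
      from IVT'[OF this le cont] obtain v where v: "\<tau>1 \<le> v" "v \<le> \<tau>0" "?H0 v = z" by blast
      have "?H1 \<tau>1 \<le> z" "z \<le> ?H1 v" using v apart[of v] t1 z valley[OF idle(2)] by simp_all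
      from IVT'[OF this v(1) cont] obtain u where u: "\<tau>1 \<le> u" "u \<le> v" "?H1 u = z" by blast
      \<comment> \<open>With the pads exchanged the same expression reads as the way of
        \<open>R1\<close> out and back to \<open>z\<close>, followed by the way of \<open>R0\<close>
        from \<open>z\<close> to the peak and home.\<close>
      show "time1 Y c + need Y ?q0 ?q1 c z \<le> makespan S"
        unfolding need_def time0_pads[of Y c o0] time1_pads[of Y c o1] other_other
        using out0[of v \<tau>0] home0[of \<tau>0 ?d0] out1[of 0 \<tau>1] home1[of \<tau>1 u] t0 t1 u v ends N0 mk(1)
          mN[OF peak[OF idle(1)], of o0] mN[OF peak[OF idle(1)], of ?q0]
          mF[OF valley[OF idle(2)], of o1] mF[OF valley[OF idle(2)], of ?q1] by simp
    qed
  qed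
qed

section \<open>Schedules without detours\<close>

fun sweep :: "stockyard \<Rightarrow> direction \<Rightarrow> real \<Rightarrow> nat list \<Rightarrow> trajectory" where
  "sweep Y D x [] = []"
| "sweep Y D x (j # js) =
     (Travel D, signum D * (real_of_int (entry Y j D) - x) / speed Y) #
     (Reclaim j D, real_of_int (right_end Y j - left_end Y j)) # sweep Y D (real_of_int (exit Y j D)) js"

fun sweep_end :: "stockyard \<Rightarrow> direction \<Rightarrow> real \<Rightarrow> nat list \<Rightarrow> real" where
  "sweep_end Y D x [] = x"
| "sweep_end Y D x (j # js) = sweep_end Y D (real_of_int (exit Y j D)) js"

definition leg :: "stockyard \<Rightarrow> direction \<Rightarrow> real \<Rightarrow> nat list \<Rightarrow> real \<Rightarrow> trajectory" where
  "leg Y D x js y = sweep Y D x js @ [(Travel D, signum D * (y - sweep_end Y D x js) / speed Y)]"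

text \<open>Pieces of a schedule must have positive duration, whereas \<open>sweep\<close> travels
  distance 0 between adjacent stockpiles and the waiting time may vanish.\<close>

abbreviation moving :: "trajectory \<Rightarrow> trajectory" where
  "moving ps \<equiv> filter (\<lambda>q. 0 < snd q) ps"

definition trajectory_of ::
  "stockyard \<Rightarrow> reclaimer \<Rightarrow> real \<Rightarrow> nat list \<Rightarrow> real \<Rightarrow> nat list \<Rightarrow> trajectory" where
  "trajectory_of Y k w js y js' = moving ((Wait, w) #
     leg Y (outward k) (home Y k) js y @ leg Y (homeward k) y js' (home Y k))"

lemma sweep_snoc:
  fixes x :: real
  shows "sweep Y D x (js @ [j]) = sweep Y D x js @
     [(Travel D, signum D * (real_of_int (entry Y j D) - sweep_end Y D x js) / speed Y),
      (Reclaim j D, real_of_int (right_end Y j - left_end Y j))]"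
  by (induction js arbitrary: x) auto

lemma sweep_end_snoc: "sweep_end Y D x (js @ [j]) = exit Y j D"
  by (induction js arbitrary: x) auto

lemma sweep_end_cases: "sweep_end Y D x js = x \<or> (\<exists>j\<in>set js. sweep_end Y D x js = exit Y j D)"
  by (induction js arbitrary: x) (simp, fastforce)

text \<open>Precisely what makes the travelling pieces of \<open>sweep\<close> nonnegative and its
  reclaiming pieces positive in duration.\<close>

fun chain :: "stockyard \<Rightarrow> direction \<Rightarrow> real \<Rightarrow> nat list \<Rightarrow> bool" where
  "chain Y D x [] \<longleftrightarrow> True"
| "chain Y D x (j # js) \<longleftrightarrow> 0 \<le> signum D * (real_of_int (entry Y j D) - x) \<and> left_end Y j < right_end Y j \<and>
     chain Y D (exit Y j D) js"

lemma chainI: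
  fixes x :: real
  assumes "sorted_wrt (\<lambda>i j. 0 \<le> signum D * (entry Y j D - exit Y i D)) js"
    and "\<forall>j\<in>set js. left_end Y j < right_end Y j \<and> 0 \<le> signum D * (real_of_int (entry Y j D) - x)"
  shows "chain Y D x js"
  using assms by (induction js arbitrary: x) auto

lemma moving_leg:
  fixes x y :: real
  assumes "chain Y D x js" "0 \<le> signum D * (y - sweep_end Y D x js)" "0 < speed Y"
  shows "valid_from Y x (moving (leg Y D x js y))"
    and "displacement (speed Y) (moving (leg Y D x js y)) = y - x"
proof -
  have "valid_from Y x (moving (leg Y D x js y)) \<and>
    displacement (speed Y) (moving (leg Y D x js y)) = y - x"
    using assms
  proof (induction js arbitrary: x)
    case Nil
    then show ?case using signum_cases[of D] by (auto simp: leg_def zero_less_divide_iff)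
  next
    case (Cons j js)
    have d: "0 < real_of_int (right_end Y j - left_end Y j)" using Cons.prems by simp
    have ex: "real_of_int (entry Y j D) + signum D * (right_end Y j - left_end Y j) = exit Y j D"
      by (simp add: exit_entry)
    have IH: "valid_from Y (exit Y j D) (moving (leg Y D (exit Y j D) js y))"
      "displacement (speed Y) (moving (leg Y D (exit Y j D) js y)) = y - exit Y j D"
      using Cons by simp_all
    have split: "moving (leg Y D x (j # js) y) =
        moving [(Travel D, signum D * (entry Y j D - x) / speed Y)] @
        (Reclaim j D, right_end Y j - left_end Y j) # moving (leg Y D (exit Y j D) js y)"
      using d by (simp add: leg_def)
    have rest: "valid_from Y (entry Y j D)
        ((Reclaim j D, right_end Y j - left_end Y j) # moving (leg Y D (exit Y j D) js y))"
      using IH d ex by simp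
    have first: "valid_from Y x (moving [(Travel D, signum D * (entry Y j D - x) / speed Y)])"
      "displacement (speed Y) (moving [(Travel D, signum D * (entry Y j D - x) / speed Y)]) = entry Y j D - x"
      using Cons.prems signum_cases[of D] by (auto simp: zero_less_divide_iff)
    show ?case unfolding split valid_from_append displacement_append first(2)
      using first rest IH ex by simp
  qed
  then show "valid_from Y x (moving (leg Y D x js y))"
    and "displacement (speed Y) (moving (leg Y D x js y)) = y - x" by auto
qed

lemma oriented_leg: "oriented D (leg Y D x js y)"
proof -
  have "oriented D (sweep Y D x js)" by (induction js arbitrary: x) auto
  then show ?thesis by (simp add: leg_def)
qed

lemma oriented_moving: "oriented D ps \<Longrightarrow> oriented D (moving ps)"
  by (auto simp: oriented_def)

lemma no_wait_leg: "Wait \<notin> fst ` set (moving (leg Y D x js y))"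
proof -
  have "Wait \<notin> fst ` set (sweep Y D x js)" by (induction js arbitrary: x) auto
  then show ?thesis by (auto simp: leg_def)
qed

lemma stockpiles_of_simps [simp]:
  "stockpiles_of [] = []"
  "stockpiles_of (q # ps) = (case fst q of Reclaim j D \<Rightarrow> j # stockpiles_of ps | _ \<Rightarrow> stockpiles_of ps)"
  by (auto simp: stockpiles_of_def map_filter_simps split: move.splits)

lemma stockpiles_of_append [simp]: "stockpiles_of (ps @ qs) = stockpiles_of ps @ stockpiles_of qs"
  by (induction ps) (auto split: move.splits)

lemma stockpiles_of_leg:
  assumes "\<forall>j\<in>set js. left_end Y j < right_end Y j"
  shows "stockpiles_of (moving (leg Y D x js y)) = js"
proof -
  have "stockpiles_of (moving (sweep Y D x js)) = js" using assms
    by (induction js arbitrary: x) auto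
  then show ?thesis by (simp add: leg_def)
qed

lemma reclaimed_leg:
  assumes "\<forall>j\<in>set js. left_end Y j < right_end Y j"
  shows "reclaimed (moving (leg Y D x js y)) D = set js"
proof -
  have "reclaimed (moving (sweep Y D x js)) D = set js" using assms
    by (induction js arbitrary: x) auto
  then show ?thesis by (simp add: leg_def)
qed

lemma directions_oriented: "oriented D ps \<Longrightarrow> set (directions ps) \<subseteq> {D}"
  by (auto simp: set_directions oriented_def)

lemma directions_nonempty:
  assumes "displacement s ps \<noteq> 0"
  shows "directions ps \<noteq> []"
proof
  assume "directions ps = []"
  then have "displacement s ps = 0"
  proof (induction ps)
    case (Cons q ps)
    then show ?case by (cases q; cases "fst q") auto
  qed simp
  with assms show False by simp
qed

lemma remdups_adj_two:
  assumes "set us \<subseteq> {a}" "us \<noteq> []" "set vs \<subseteq> {b}" "vs \<noteq> []" "a \<noteq> b"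
  shows "remdups_adj (us @ vs) = [a, b]"
proof -
  have "replicate (length us) a = us" "replicate (length vs) b = vs"
    using assms by (auto intro: replicate_length_same)
  moreover obtain m n where "length us = Suc m" "length vs = Suc n"
    using assms(2,4) by (metis length_0_conv not0_implies_Suc)
  ultimately obtain m n where "us = replicate (Suc m) a" "vs = replicate (Suc n) b" by metis
  moreover have "remdups_adj (replicate (Suc m) a @ replicate (Suc n) b) = [a, b]" for m n
    using assms(5) by (induction m) (simp_all add: remdups_adj_replicate remdups_adj_Cons)
  ultimately show ?thesis by simp
qed

text \<open>\<open>A\<close> and \<open>B\<close> are the times that the reclaimer needs for the way out to \<open>y\<close> and for the way home.\<close>

lemma (in yard) trajectory_of_facts:
  assumes k: "S k = trajectory_of Y k w js y js'" and w: "0 \<le> w"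
    and js: "set js \<subseteq> {1..num Y}" "set js' \<subseteq> {1..num Y}"
    and c1: "chain Y (outward k) (home Y k) js"
      "0 \<le> signum (outward k) * (y - sweep_end Y (outward k) (home Y k) js)"
    and c2: "chain Y (homeward k) y js'"
      "0 \<le> signum (homeward k) * (home Y k - sweep_end Y (homeward k) y js')"
    and y: "0 < signum (outward k) * (y - home Y k)" "0 \<le> y" "y \<le> pad_length Y"
  defines "A \<equiv> signum (outward k) * (travel_time Y (set js) y - travel_time Y (set js) (home Y k))"
    and "B \<equiv> signum (outward k) * (travel_time Y (set js') y - travel_time Y (set js') (home Y k))"
  shows "reclaimer_schedule Y S k"
    and "direction_changes (S k) = 1"
    and "reclaimed (S k) (outward k) = set js" "reclaimed (S k) (homeward k) = set js'"
    and "stockpiles_of (S k) = js @ js'"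
    and "duration (S k) = w + A + B"
    and "\<And>t. 0 \<le> t \<Longrightarrow> t \<le> w \<Longrightarrow> pos Y S k t = home Y k"
    and "\<And>t. w \<le> t \<Longrightarrow> t \<le> w + A \<Longrightarrow> signum (outward k) *
      (travel_time Y (set js) (pos Y S k t) - travel_time Y (set js) (home Y k)) = t - w"
    and "\<And>t. w + A \<le> t \<Longrightarrow> t \<le> w + A + B \<Longrightarrow> signum (outward k) *
      (travel_time Y (set js') y - travel_time Y (set js') (pos Y S k t)) = t - (w + A)"
    and "\<And>t. w + A + B \<le> t \<Longrightarrow> pos Y S k t = home Y k"
    and "\<And>t. 0 \<le> t \<Longrightarrow> 0 \<le> signum (outward k) * (pos Y S k t - home Y k) \<and>
      0 \<le> signum (outward k) * (y - pos Y S k t)"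
proof -
  let ?s = "speed Y" and ?h = "home Y k" and ?D = "outward k" and ?E = "homeward k"
  let ?W = "moving [(Wait, w)]"
  define P where "P = moving (leg Y ?D ?h js y)"
  define Q where "Q = moving (leg Y ?E y js' ?h)"
  have s: "0 < ?s" "0 \<le> ?s" using speed_ge by auto
  have S: "S k = ?W @ P @ Q" by (simp add: k trajectory_of_def P_def Q_def)
  note vP = moving_leg(1)[OF c1 s(1), folded P_def] and dP = moving_leg(2)[OF c1 s(1), folded P_def]
  note vQ = moving_leg(1)[OF c2 s(1), folded Q_def] and dQ = moving_leg(2)[OF c2 s(1), folded Q_def]
  note nnP = valid_from_nonneg[OF vP] and nnQ = valid_from_nonneg[OF vQ]
  have oP: "oriented ?D P" and oQ: "oriented ?E Q"
    unfolding P_def Q_def by (simp_all only: oriented_moving oriented_leg)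
  have nnW: "nonneg_durations ?W" and durW: "duration ?W = w" and disW: "displacement ?s ?W = 0"
    using w by auto
  have lt: "\<forall>j\<in>set js. left_end Y j < right_end Y j" "\<forall>j\<in>set js'. left_end Y j < right_end Y j"
    using js stockpile_bounds by blast+
  have proper: "proper Y (set js)" "proper Y (set js')" using lt by auto
  have rP: "reclaimed P ?D = set js" and rQ: "reclaimed Q ?E = set js'"
    unfolding P_def Q_def using lt by (auto intro!: reclaimed_leg)
  have vS: "valid_from Y ?h (S k)"
    using vP vQ dP w by (simp add: S valid_from_append disW)
  have dS: "displacement ?s (S k) = 0" by (simp only: S displacement_append disW dP dQ)
  \<comment> \<open>Without waiting, travel time is an exact clock along the run; this determines
    all positions of the constructed schedule.\<close>
  have ttP: "signum ?D * (travel_time Y (set js) (path ?s ?h P t2) - travel_time Y (set js) (path ?s ?h P t1)) = t2 - t1"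
    if "0 \<le> t1" "t1 \<le> t2" "t2 \<le> duration P" for t1 t2
    using oriented_travel_time(2)[OF vP oP speed_ge proper(1) _ that(1,2) _ _ that(3)] rP no_wait_leg
    by (simp add: P_def)
  have ttQ: "signum ?E * (travel_time Y (set js') (path ?s y Q t2) - travel_time Y (set js') (path ?s y Q t1)) = t2 - t1"
    if "0 \<le> t1" "t1 \<le> t2" "t2 \<le> duration Q" for t1 t2
    using oriented_travel_time(2)[OF vQ oQ speed_ge proper(2) _ that(1,2) _ _ that(3)] rQ no_wait_leg
    by (simp add: Q_def)
  have endP: "path ?s ?h P t = y" if "duration P \<le> t" for t using path_late[OF nnP that] dP by simp
  have endQ: "path ?s y Q t = ?h" if "duration Q \<le> t" for t using path_late[OF nnQ that] dQ by simp
  have A: "duration P = A"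
    using ttP[of 0 "duration P"] duration_nonneg[OF nnP] path_zero[OF nnP] endP[of "duration P"]
    by (simp add: A_def)
  have B: "duration Q = B"
    using ttQ[of 0 "duration Q"] duration_nonneg[OF nnQ] path_zero[OF nnQ] endQ[of "duration Q"]
    by (simp add: B_def signum_homeward algebra_simps)
  have AB: "0 \<le> A" "0 \<le> B" using A B duration_nonneg nnP nnQ by metis+
  have p1: "pos Y S k t = ?h" if "0 \<le> t" "t \<le> w" for t
    unfolding pos_def S using that nnW nnP nnQ durW by (cases "w = 0")
      (auto simp: path_append_early path_zero path_Cons_early)
  have p2: "pos Y S k t = path ?s ?h P (t - w)" if "w \<le> t" "t \<le> w + A" for t
  proof -
    have "pos Y S k t = path ?s ?h (P @ Q) (t - w)"
      unfolding pos_def S using path_append_late[OF nnW, of "P @ Q" t] that nnP nnQ durW disW by simp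
    then show ?thesis using that A path_append_early[OF nnP nnQ] by simp
  qed
  have p3: "pos Y S k t = path ?s y Q (t - (w + A))" if "w + A \<le> t" for t
  proof -
    have "pos Y S k t = path ?s ?h (P @ Q) (t - w)"
      unfolding pos_def S using path_append_late[OF nnW, of "P @ Q" t] that AB nnP nnQ durW disW by simp
    then show ?thesis using that A path_append_late[OF nnP nnQ] dP by (simp add: algebra_simps)
  qed
  show between: "0 \<le> signum ?D * (pos Y S k t - ?h) \<and> 0 \<le> signum ?D * (y - pos Y S k t)"
    if "0 \<le> t" for t
  proof -
    consider "t \<le> w" | "w \<le> t" "t \<le> w + A" | "w + A \<le> t" "t \<le> w + A + B" | "w + A + B \<le> t" by linarith
    then show ?thesis
    proof cases
      case 1
      then show ?thesis using p1[of t] that y(1) by simp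
    next
      case 2
      then show ?thesis
        using oriented_mono[OF oP nnP s(2), of 0 "t - w" ?h] oriented_mono[OF oP nnP s(2), of "t - w" A ?h]
          p2[OF 2] path_zero[OF nnP] endP[of A] A by simp
    next
      case 3
      then show ?thesis
        using oriented_mono[OF oQ nnQ s(2), of 0 "t - (w + A)" y] oriented_mono[OF oQ nnQ s(2), of "t - (w + A)" B y]
          p3[OF 3(1)] path_zero[OF nnQ] endQ[of B] B by (simp add: signum_homeward algebra_simps)
    next
      case 4
      then show ?thesis using p3[of t] endQ[of "t - (w + A)"] AB y(1) B by simp
    qed
  qed
  have "pos Y S k t \<in> {0..real_of_int (pad_length Y)}" if "0 \<le> t" for t
    using between[OF that] y(2,3) by (cases k) auto
  then show "reclaimer_schedule Y S k" using vS dS by (simp add: reclaimer_schedule_iff)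
  have "directions (S k) = directions P @ directions Q"
    unfolding S by (simp add: directions_append)
  \<comment> \<open>The turning point differs from home, so both runs have nonzero displacement.
    Hence both directions really occur after pieces of duration 0 have been removed, and there is
    exactly one change.\<close>
  moreover from y(1) have ne: "y \<noteq> ?h" by auto
  then have "remdups_adj (directions P @ directions Q) = [?D, ?E]"
    using directions_oriented[OF oP] directions_oriented[OF oQ] directions_nonempty[of ?s P]
      directions_nonempty[of ?s Q] dP dQ ne
      homeward_neq(2)[of k] by (intro remdups_adj_two) auto
  ultimately show "direction_changes (S k) = 1"
    by (simp add: direction_changes_def flip: directions_def)
  show "reclaimed (S k) ?D = set js" "reclaimed (S k) ?E = set js'"
    using oriented_reclaimed_other[OF oP homeward_neq(1)] oriented_reclaimed_other[OF oQ homeward_neq(2)]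
    by (auto simp: S rP rQ)
  show "stockpiles_of (S k) = js @ js'"
    using lt by (simp add: S P_def Q_def stockpiles_of_leg)
  show "duration (S k) = w + A + B" using durW by (simp only: S duration_append A B)
  show "pos Y S k t = ?h" if "0 \<le> t" "t \<le> w" for t using p1 that .
  show "signum ?D * (travel_time Y (set js) (pos Y S k t) - travel_time Y (set js) ?h) = t - w"
    if "w \<le> t" "t \<le> w + A" for t
    using ttP[of 0 "t - w"] that A p2[OF that] path_zero[OF nnP] by simp
  show "signum ?D * (travel_time Y (set js') y - travel_time Y (set js') (pos Y S k t)) = t - (w + A)"
    if "w + A \<le> t" "t \<le> w + A + B" for t
    using ttQ[of 0 "t - (w + A)"] that B p3[of t] path_zero[OF nnQ] by (simp add: signum_homeward algebra_simps)
  show "pos Y S k t = ?h" if "w + A + B \<le> t" for t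
    using that p3[of t] endQ[of "t - (w + A)"] AB B by simp
qed


section \<open>The schedule built from a split and a delay\<close>

definition near_list :: "stockyard \<Rightarrow> pad \<Rightarrow> nat \<Rightarrow> nat list" where
  "near_list Y p i = [offset Y p + 1..<offset Y p + i + 1]"

definition far_list :: "stockyard \<Rightarrow> pad \<Rightarrow> nat \<Rightarrow> nat list" where
  "far_list Y p i = [offset Y p + i + 1..<offset Y p + pile_num Y p + 1]"

fun plan :: "stockyard \<Rightarrow> pad \<Rightarrow> pad \<Rightarrow> (pad \<Rightarrow> nat) \<Rightarrow> real \<Rightarrow> schedule" where
  "plan Y o0 o1 c w R0 = trajectory_of Y R0 0 (near_list Y o0 (c o0)) (peak Y c)
     (rev (near_list Y (other_pad o0) (c (other_pad o0))))"
| "plan Y o0 o1 c w R1 = trajectory_of Y R1 w (rev (far_list Y o1 (c o1))) (valley Y c)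
     (far_list Y (other_pad o1) (c (other_pad o1)))"

declare plan.simps [simp del]

lemma set_near_list [simp]: "set (near_list Y p i) = near Y p i"
  by (auto simp: near_list_def near_def)

lemma set_far_list [simp]: "set (far_list Y p i) = far Y p i"
  by (auto simp: far_list_def far_def)

lemma mset_near_list: "mset (near_list Y p i) = mset_set (near Y p i)"
  by (simp add: near_list_def near_def mset_upt atLeastLessThanSuc_atLeastAtMost del: upt_Suc)

lemma mset_far_list: "mset (far_list Y p i) = mset_set (far Y p i)"
  by (simp add: far_list_def far_def mset_upt atLeastLessThanSuc_atLeastAtMost del: upt_Suc)

context yard
begin

lemma chain_interval:
  fixes x y :: real
  assumes "{a..<b} \<subseteq> stockpiles Y p"
    and "\<And>j. j \<in> {a..<b} \<Longrightarrow> x \<le> left_end Y j" "\<And>j. j \<in> {a..<b} \<Longrightarrow> right_end Y j \<le> y" "x \<le> y"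
  shows "chain Y Rightward x [a..<b]" "sweep_end Y Rightward x [a..<b] \<le> y"
    and "chain Y Leftward y (rev [a..<b])" "x \<le> sweep_end Y Leftward y (rev [a..<b])"
proof -
  have lt: "left_end Y j < right_end Y j" if "j \<in> {a..<b}" for j
    using that assms(1) stockpiles_sub[of p] stockpile_bounds(2) by blast
  have ord: "right_end Y i \<le> left_end Y j" if "i \<in> {a..<b}" "j \<in> {a..<b}" "i < j" for i j
    using that assms(1) stockpile_order by blast
  have sorted: "sorted_wrt (\<lambda>i j. right_end Y i \<le> left_end Y j) [a..<b]"
    using ord by (intro sorted_wrt_mono_rel[OF _ sorted_wrt_upt]) auto
  have "sorted_wrt (\<lambda>i j. 0 \<le> signum Rightward * (entry Y j Rightward - exit Y i Rightward)) [a..<b]"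
    by (rule sorted_wrt_mono_rel[OF _ sorted]) auto
  then show "chain Y Rightward x [a..<b]" using lt assms(2) by (intro chainI) auto
  have "sorted_wrt (\<lambda>i j. 0 \<le> signum Leftward * (entry Y j Leftward - exit Y i Leftward)) (rev [a..<b])"
    unfolding sorted_wrt_rev by (rule sorted_wrt_mono_rel[OF _ sorted]) auto
  then show "chain Y Leftward y (rev [a..<b])" using lt assms(3) by (intro chainI) auto
  show "sweep_end Y Rightward x [a..<b] \<le> y"
    using sweep_end_cases[of Y Rightward x "[a..<b]"] assms(3,4) by auto
  show "x \<le> sweep_end Y Leftward y (rev [a..<b])"
    using sweep_end_cases[of Y Leftward y "rev [a..<b]"] assms(2,4) by auto
qed

lemma near_on_home_side:
  assumes "i \<le> pile_num Y p"
  shows "near Y p i = on_home_side Y R0 p (right_at Y p i)"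
proof -
  have "j \<in> near Y p i" if j: "j \<in> stockpiles Y p" "right_end Y j \<le> right_at Y p i" for j
  proof (rule ccontr)
    assume "j \<notin> near Y p i"
    then have "j \<in> far Y p i" using j assms stockpile_diff_near by blast
    then have "left_at Y p (i + 1) \<le> left_end Y j" by (rule far_left)
    moreover have "left_end Y j < right_end Y j" using j stockpiles_sub stockpile_bounds by blast
    ultimately show False using right_left_at[of i "i + 1" p] j by simp
  qed
  then show ?thesis using near_sub[OF assms] near_right[OF _ assms] by auto
qed

lemma far_on_home_side:
  assumes "i \<le> pile_num Y p"
  shows "far Y p i = on_home_side Y R1 p (left_at Y p (i + 1))"
proof -
  have "j \<in> far Y p i" if j: "j \<in> stockpiles Y p" "left_at Y p (i + 1) \<le> left_end Y j" for j
  proof (rule ccontr)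
    assume "j \<notin> far Y p i"
    then have "j \<in> near Y p i" using j assms stockpile_diff_near by blast
    then have "right_end Y j \<le> right_at Y p i" using assms by (rule near_right)
    moreover have "left_end Y j < right_end Y j" using j stockpiles_sub stockpile_bounds by blast
    ultimately show False using right_left_at[of i "i + 1" p] j by simp
  qed
  then show ?thesis using far_sub far_left by auto
qed

lemma mset_split:
  assumes "is_split c"
  shows "mset (near_list Y o0 (c o0) @ rev (near_list Y (other_pad o0) (c (other_pad o0)))) +
    mset (rev (far_list Y o1 (c o1)) @ far_list Y (other_pad o1) (c (other_pad o1))) = mset_set {1..num Y}"
proof -
  have pads: "f p + f (other_pad p) = f Pad1 + (f Pad2 :: nat multiset)" for f p
    by (cases p) (auto simp: add.commute)
  have nf: "mset_set (near Y p (c p)) + mset_set (far Y p (c p)) = mset_set (stockpiles Y p)" for p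
  proof -
    have cp: "c p \<le> pile_num Y p" using assms by (simp add: is_split_def)
    have "finite (near Y p (c p))" "finite (far Y p (c p))" using proper_near[OF cp] proper_far by auto
    moreover have "near Y p (c p) \<union> far Y p (c p) = stockpiles Y p" "near Y p (c p) \<inter> far Y p (c p) = {}"
      using stockpile_diff_near[OF cp] near_sub[OF cp] by auto
    ultimately show ?thesis by (metis mset_set_Union)
  qed
  have "mset_set (stockpiles Y Pad1) + mset_set (stockpiles Y Pad2) = mset_set {1..num Y}"
    using stockpiles_union[of Pad1] stockpiles_disjoint[of Pad1] mset_set_Union[of "stockpiles Y Pad1" "stockpiles Y Pad2"]
    by simp
  then have "(mset_set (near Y Pad1 (c Pad1)) + mset_set (near Y Pad2 (c Pad2))) +
      (mset_set (far Y Pad1 (c Pad1)) + mset_set (far Y Pad2 (c Pad2))) = mset_set {1..num Y}"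
    unfolding nf[symmetric] by (simp add: ac_simps)
  then show ?thesis
    unfolding pads[of "\<lambda>p. mset_set (near Y p (c p))" o0, symmetric]
      pads[of "\<lambda>p. mset_set (far Y p (c p))" o1, symmetric]
    by (simp add: mset_near_list mset_far_list)
qed

text \<open>\<open>R0\<close> never passes the peak and \<open>R1\<close> never passes the valley,
  so only points between the two matter. There a delay that dominates \<open>need\<close> lets
  \<open>R1\<close> arrive no earlier than \<open>R0\<close> has left; if the valley is not below
  the peak, any delay will do.\<close>

lemma upper_bound:
  assumes c: "is_split c" and w: "0 \<le> w"
    and need: "\<And>z. valley Y c < peak Y c \<Longrightarrow> valley Y c \<le> z \<Longrightarrow> z \<le> peak Y c \<Longrightarrow> need Y o0 o1 c z \<le> w"
  shows "contiguous_unimodal Y (plan Y o0 o1 c w)"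
    and "makespan (plan Y o0 o1 c w) = max (time0 Y c) (w + time1 Y c)"
proof -
  let ?S = "plan Y o0 o1 c w" and ?L = "real_of_int (pad_length Y)"
  let ?N = "\<lambda>p. near_time Y p c" and ?F = "\<lambda>p. far_time Y p c"
  let ?q0 = "other_pad o0" and ?q1 = "other_pad o1" and ?p = "peak Y c" and ?v = "valley Y c"
  have cp: "c p \<le> pile_num Y p" for p using c by (simp add: is_split_def)
  have nearL: "{offset Y p + 1..<offset Y p + c p + 1} = near Y p (c p)" for p by (auto simp: near_def)
  have farL: "{offset Y p + c p + 1..<offset Y p + pile_num Y p + 1} = far Y p (c p)" for p
    by (auto simp: far_def)
  have nb: "0 \<le> real_of_int (left_end Y j)" "right_end Y j \<le> ?p" if "j \<in> near Y p (c p)" for j p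
  proof -
    have "0 \<le> left_end Y j" using that near_sub[OF cp] stockpiles_sub stockpile_bounds by blast
    then show "0 \<le> real_of_int (left_end Y j)" by simp
    show "right_end Y j \<le> ?p" using near_right[OF that cp] near_le_peak[of Y p c] by simp
  qed
  have fb: "?v \<le> left_end Y j" "right_end Y j \<le> ?L" if "j \<in> far Y p (c p)" for j p
  proof -
    have "right_end Y j \<le> pad_length Y" using that far_sub stockpiles_sub stockpile_bounds by blast
    then show "right_end Y j \<le> ?L" by simp
    show "?v \<le> left_end Y j" using far_left[OF that] valley_le_far[of Y c p] by simp
  qed
  have pk: "0 < ?p" "?p \<le> ?L" and vl: "0 \<le> ?v" "?v < ?L" using peak_bounds[of c] valley_bounds[of c] by auto
  have N0: "?N p 0 = 0" for p using travel_time_near_zero cp by blast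
  have cn: "chain Y Rightward 0 (near_list Y p (c p))" "sweep_end Y Rightward 0 (near_list Y p (c p)) \<le> ?p"
    "chain Y Leftward ?p (rev (near_list Y p (c p)))" "0 \<le> sweep_end Y Leftward ?p (rev (near_list Y p (c p)))" for p
    unfolding near_list_def
    using chain_interval[of "offset Y p + 1" "offset Y p + c p + 1" p 0 ?p, unfolded nearL,
      OF near_sub[OF cp] nb(1)[of _ p] nb(2)[of _ p] less_imp_le[OF pk(1)]] by blast+
  have cf: "chain Y Rightward ?v (far_list Y p (c p))" "sweep_end Y Rightward ?v (far_list Y p (c p)) \<le> ?L"
    "chain Y Leftward ?L (rev (far_list Y p (c p)))" "?v \<le> sweep_end Y Leftward ?L (rev (far_list Y p (c p)))" for p
    unfolding far_list_def
    using chain_interval[of "offset Y p + c p + 1" "offset Y p + pile_num Y p + 1" p ?v ?L, unfolded farL,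
      OF far_sub fb(1)[of _ p] fb(2)[of _ p] less_imp_le[OF vl(2)]] by blast+
  have sub: "near Y p (c p) \<subseteq> {1..num Y}" "far Y p i \<subseteq> {1..num Y}" for p i
    using near_sub[OF cp] far_sub stockpiles_sub by (meson subset_trans)+
  let ?D0 = "outward R0" and ?E0 = "homeward R0" and ?D1 = "outward R1" and ?E1 = "homeward R1"
  let ?js0 = "near_list Y o0 (c o0)" and ?js0' = "rev (near_list Y ?q0 (c ?q0))"
  let ?js1 = "rev (far_list Y o1 (c o1))" and ?js1' = "far_list Y ?q1 (c ?q1)"
  have a0: "set ?js0 \<subseteq> {1..num Y}" "set ?js0' \<subseteq> {1..num Y}"
    "chain Y ?D0 (home Y R0) ?js0" "0 \<le> signum ?D0 * (?p - sweep_end Y ?D0 (home Y R0) ?js0)"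
    "chain Y ?E0 ?p ?js0'" "0 \<le> signum ?E0 * (home Y R0 - sweep_end Y ?E0 ?p ?js0')"
    "0 < signum ?D0 * (?p - home Y R0)" "0 \<le> ?p" "?p \<le> ?L"
    unfolding set_rev set_near_list by (rule sub) (use cn pk sub in auto)
  have a1: "set ?js1 \<subseteq> {1..num Y}" "set ?js1' \<subseteq> {1..num Y}"
    "chain Y ?D1 (home Y R1) ?js1" "0 \<le> signum ?D1 * (?v - sweep_end Y ?D1 (home Y R1) ?js1)"
    "chain Y ?E1 ?v ?js1'" "0 \<le> signum ?E1 * (home Y R1 - sweep_end Y ?E1 ?v ?js1')"
    "0 < signum ?D1 * (?v - home Y R1)" "0 \<le> ?v" "?v \<le> ?L"
    unfolding set_rev set_far_list by (rule sub) (use cf vl sub in auto)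
  note f0 = trajectory_of_facts[of ?S R0, OF plan.simps(1) order_refl a0]
  note f1 = trajectory_of_facts[of ?S R1, OF plan.simps(2) w a1]
  have T0: "time0 Y c = ?N o0 ?p + ?N ?q0 ?p" by (rule time0_pads)
  have T1: "time1 Y c = ?F o1 ?L - ?F o1 ?v + (?F ?q1 ?L - ?F ?q1 ?v)"
    using time1_pads[of Y c o1] by simp
  have d0: "duration (?S R0) = time0 Y c" using f0(6) by (simp add: T0 N0)
  have d1: "duration (?S R1) = w + time1 Y c" using f1(6) by (simp add: T1)
  show "makespan ?S = max (time0 Y c) (w + time1 Y c)" by (simp add: makespan_def d0 d1)
  let ?t0 = "?N o0 ?p" and ?t1 = "w + (?F o1 ?L - ?F o1 ?v)"
  have R0_out: "?N o0 (pos Y ?S R0 t) = t" if "0 \<le> t" "t \<le> ?t0" for t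
    using f0(8)[of t] that by (simp add: N0)
  have R0_home: "?N ?q0 ?p - ?N ?q0 (pos Y ?S R0 t) = t - ?t0" if "?t0 \<le> t" "t \<le> time0 Y c" for t
    using f0(9)[of t] that by (simp add: N0 T0)
  have R0_late: "pos Y ?S R0 t = 0" if "time0 Y c \<le> t" for t
    using f0(10)[of t] that by (simp add: N0 T0)
  have R0_range: "0 \<le> pos Y ?S R0 t" "pos Y ?S R0 t \<le> ?p" if "0 \<le> t" for t
    using f0(11)[of t] that by simp_all
  have R1_wait: "pos Y ?S R1 t = ?L" if "0 \<le> t" "t \<le> w" for t
    using f1(7)[of t] that by simp
  have R1_out: "?F o1 ?L - ?F o1 (pos Y ?S R1 t) = t - w" if "w \<le> t" "t \<le> ?t1" for t
    using f1(8)[of t] that by simp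
  have R1_range: "?v \<le> pos Y ?S R1 t" "pos Y ?S R1 t \<le> ?L" if "0 \<le> t" for t
    using f1(11)[of t] that by simp_all
  \<comment> \<open>As long as \<open>R1\<close> is on its way out, it is not yet beyond any point
    whose arrival time has not come.\<close>
  have R1_far: "z \<le> pos Y ?S R1 t"
    if t: "0 \<le> t" "t \<le> ?t1" and z: "z \<le> ?L" "t \<le> w + (?F o1 ?L - ?F o1 z)" for t z
  proof (cases "t \<le> w")
    case True
    then show ?thesis using R1_wait t z by simp
  next
    case False
    then have "?F o1 z \<le> ?F o1 (pos Y ?S R1 t)" using R1_out[of t] t z by simp
    then show ?thesis using travel_time_strict_mono[OF speed_ge, of "pos Y ?S R1 t" z "far Y o1 (c o1)"]
      by linarith
  qed
  have apart: "pos Y ?S R0 t \<le> pos Y ?S R1 t" if t: "0 \<le> t" for t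
  proof (cases "?v < ?p")
    case False
    then show ?thesis using R0_range(2)[OF t] R1_range(1)[OF t] by simp
  next
    case True
    have nd: "?t0 + ?N ?q0 ?p - ?N ?q0 z \<le> w + (?F o1 ?L - ?F o1 z)" if "?v \<le> z" "z \<le> ?p" for z
      using need[OF True that] by (simp add: need_def T0)
    \<comment> \<open>The condition at \<open>z = peak Y c\<close> bounds the turning time of
      \<open>R0\<close> by the time when \<open>R1\<close> reaches the peak, and the valley lies
      further on its way.\<close>
    have turn: "?t0 \<le> ?t1"
      using nd[of ?p] travel_time_mono[OF speed_ge less_imp_le[OF True], of "far Y o1 (c o1)"] True by simp
    \<comment> \<open>The cases: \<open>R0\<close> on its way out; \<open>R0\<close> returning while
      \<open>R1\<close> is still on its way out; \<open>R0\<close> already back; \<open>R1\<close>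
      returning before \<open>R0\<close> is back.\<close>
    consider "t \<le> ?t0" | "?t0 \<le> t" "t \<le> ?t1" "t \<le> time0 Y c" | "time0 Y c \<le> t" | "?t1 \<le> t" "t \<le> time0 Y c" "?t0 \<le> t"
      using turn by linarith
    then show ?thesis
    proof cases
      case 1
      then have "?p \<le> pos Y ?S R1 t"
        using nd[of ?p] True pk t turn by (intro R1_far) auto
      then show ?thesis using R0_range(2)[OF t] by simp
    next
      case 2
      show ?thesis
      proof (cases "pos Y ?S R0 t \<le> ?v")
        case True
        then show ?thesis using R1_range(1)[OF t] by simp
      next
        case False
        then show ?thesis
          using nd[of "pos Y ?S R0 t"] R0_home[OF 2(1,3)] R0_range(2)[OF t] pk 2 t
          by (intro R1_far) auto
      qed
    next
      case 3
      then show ?thesis using R0_late R1_range(1)[OF t] vl by simp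
    next
      case 4
      \<comment> \<open>The condition at \<open>z = valley Y c\<close> says that \<open>R0\<close>
        has gone below the valley by the time \<open>R1\<close> turns there.\<close>
      then have "?N ?q0 (pos Y ?S R0 t) \<le> ?N ?q0 ?v"
        using nd[of ?v] R0_home[of t] True by simp
      then have "pos Y ?S R0 t \<le> ?v"
        using travel_time_strict_mono[OF speed_ge, of ?v "pos Y ?S R0 t" "near Y ?q0 (c ?q0)"] by linarith
      then show ?thesis using R1_range(1)[OF t] by simp
    qed
  qed
  have all_k: "(\<forall>k. P k) \<longleftrightarrow> P R0 \<and> P R1" for P by (metis reclaimer.exhaust)
  have feas: "feasible Y ?S"
    unfolding feasible_def all_k using f0(1,5) f1(1,5) apart mset_split[OF c, of o0 o1] by simp
  have "reclaimed (?S R0) (outward R0) = on_home_side Y R0 o0 (right_at Y o0 (c o0))"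
    "reclaimed (?S R0) (homeward R0) = on_home_side Y R0 ?q0 (right_at Y ?q0 (c ?q0))"
    using f0(3,4) near_on_home_side[OF cp] by simp_all
  moreover have "reclaimed (?S R1) (outward R1) = on_home_side Y R1 o1 (left_at Y o1 (c o1 + 1))"
    "reclaimed (?S R1) (homeward R1) = on_home_side Y R1 ?q1 (left_at Y ?q1 (c ?q1 + 1))"
    using f1(3,4) far_on_home_side[OF cp] by simp_all
  moreover have "right_at Y p i \<in> {0..?L}" "left_at Y p i \<in> {0..?L}" for p i
    using right_at_bounds left_at_bounds by auto
  ultimately show "contiguous_unimodal Y ?S"
    unfolding contiguous_unimodal_def all_k using feas f0(2) f1(2) by blast
qed

end

section \<open>Candidates\<close>

definition clamp :: "real \<Rightarrow> real \<Rightarrow> real \<Rightarrow> real" where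
  "clamp l r z = max 0 (min z r - l)"

definition work :: "stockyard \<Rightarrow> pad \<Rightarrow> real \<Rightarrow> real" where
  "work Y p z = (\<Sum>i=1..pile_num Y p. clamp (left_at Y p i) (right_at Y p i) z)"

definition prefix_work :: "stockyard \<Rightarrow> pad \<Rightarrow> nat \<Rightarrow> real" where
  "prefix_work Y p i = (\<Sum>k=1..i. right_at Y p k - left_at Y p k)"

text \<open>
  In a candidate \<open>(p, u, v, a, b)\<close> the numbers of stockpiles for \<open>R0\<close> are \<open>a\<close> on \<open>p\<close> and \<open>b\<close> on the
  other pad; \<open>u\<close> and \<open>v\<close> tell whether \<open>R0\<close> and \<open>R1\<close> serve the other pad on their way out.  If
  their regions cross, it is on pad \<open>p\<close> that \<open>R0\<close> goes beyond stockpiles left to \<open>R1\<close>.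
\<close>

definition split_at :: "pad \<Rightarrow> nat \<Rightarrow> nat \<Rightarrow> pad \<Rightarrow> nat" where
  "split_at p a b r = (if r = p then a else b)"

definition pick :: "bool \<Rightarrow> pad \<Rightarrow> pad" where
  "pick u p = (if u then other_pad p else p)"

definition crossing :: "stockyard \<Rightarrow> pad \<Rightarrow> nat \<Rightarrow> nat \<Rightarrow> bool" where
  "crossing Y p a b \<longleftrightarrow> left_at Y (other_pad p) (b + 1) < right_at Y p a"

text \<open>The part of \<open>need\<close> that depends on \<open>z\<close>, without the factor
  \<open>1 - 1 / speed Y\<close>. It uses the work of whole pads instead of shares and thus does not
  mention the split; so one table per choice of \<open>p\<close>, \<open>u\<close>, \<open>v\<close>
  suffices.\<close>

definition gain :: "stockyard \<Rightarrow> pad \<Rightarrow> bool \<Rightarrow> bool \<Rightarrow> real \<Rightarrow> real" where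
  "gain Y p u v z = of_bool v * work Y (other_pad p) z - of_bool u * work Y p z"

text \<open>The left boundary of the common region is always included, so the set is nonempty and
  \<open>Max\<close> is meaningful; \<open>right_points\<close> contains the right boundary for the
  same reason.\<close>

definition left_points :: "stockyard \<Rightarrow> pad \<Rightarrow> nat \<Rightarrow> nat \<Rightarrow> real set" where
  "left_points Y p a b = insert (left_at Y (other_pad p) (b + 1))
     (left_at Y p ` {i \<in> {1..a}. left_at Y (other_pad p) (b + 1) \<le> left_at Y p i})"

definition right_points :: "stockyard \<Rightarrow> pad \<Rightarrow> nat \<Rightarrow> nat \<Rightarrow> real set" where
  "right_points Y p a b = insert (right_at Y p a)
     (right_at Y (other_pad p) ` {j \<in> {b + 1..pile_num Y (other_pad p)}.
        right_at Y (other_pad p) j \<le> right_at Y p a})"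

definition base_delay :: "stockyard \<Rightarrow> pad \<Rightarrow> bool \<Rightarrow> bool \<Rightarrow> nat \<Rightarrow> nat \<Rightarrow> real" where
  "base_delay Y p u v a b = (2 * right_at Y p a - pad_length Y) / speed Y + (1 - 1 / speed Y) *
     (of_bool u * prefix_work Y (other_pad p) b + prefix_work Y p a
      - of_bool v * prefix_work Y (other_pad p) (pile_num Y (other_pad p))
      - (1 - of_bool v) * (prefix_work Y p (pile_num Y p) - prefix_work Y p a))"

text \<open>If all stockpiles go to \<open>R0\<close>, the excursion of the idle \<open>R1\<close>
  may enter the range of \<open>R0\<close>. It is then started so late that both finish together,
  which does not increase the makespan. An idle \<open>R0\<close> is out of the way in time without
  any delay.\<close>

definition delay :: "stockyard \<Rightarrow> pad \<Rightarrow> bool \<Rightarrow> bool \<Rightarrow> nat \<Rightarrow> nat \<Rightarrow> real" where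
  "delay Y p u v a b =
     (if crossing Y p a b then
        max 0 (base_delay Y p u v a b + (1 - 1 / speed Y) *
          max (Max (gain Y p u v ` left_points Y p a b)) (Max (gain Y p u v ` right_points Y p a b)))
      else if a = pile_num Y p \<and> b = pile_num Y (other_pad p)
      then time0 Y (split_at p a b) - time1 Y (split_at p a b) else 0)"

definition candidate_value :: "stockyard \<Rightarrow> pad \<Rightarrow> bool \<Rightarrow> bool \<Rightarrow> nat \<Rightarrow> nat \<Rightarrow> real" where
  "candidate_value Y p u v a b =
     max (time0 Y (split_at p a b)) (time1 Y (split_at p a b) + delay Y p u v a b)"

definition candidate_plan :: "stockyard \<Rightarrow> pad \<Rightarrow> bool \<Rightarrow> bool \<Rightarrow> nat \<Rightarrow> nat \<Rightarrow> schedule" where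
  "candidate_plan Y p u v a b = plan Y (pick u p) (pick v p) (split_at p a b) (delay Y p u v a b)"

text \<open>A split whose regions cross the other way round is considered with the two pads
  exchanged. A split without crossing is a candidate for either value of \<open>p\<close>.\<close>

definition admissible :: "stockyard \<Rightarrow> pad \<Rightarrow> nat \<Rightarrow> nat \<Rightarrow> bool" where
  "admissible Y p a b \<longleftrightarrow> a \<le> pile_num Y p \<and> b \<le> pile_num Y (other_pad p) \<and> \<not> crossing Y (other_pad p) b a"

text \<open>As a function of \<open>z\<close>, \<open>clamp\<close> has a convex kink at
  \<open>l\<close> and a concave one at \<open>r\<close>. With \<open>r\<close> outside the open
  interval only the convex kink remains.\<close>

lemma clamp_convex:
  assumes r: "r \<le> z1 \<or> z2 \<le> r" and z: "z1 \<le> z2" "0 \<le> s" "0 \<le> t" "s + t = 1" "z = s * z1 + t * z2"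
  shows "clamp l r z \<le> s * clamp l r z1 + t * clamp l r z2"
proof -
  have b: "z1 \<le> z" "z \<le> z2"
    using convex_bound_le[of z1 z2 z2 s t] convex_bound_le[of "-z1" "-z1" "-z2" s t] z by auto
  show ?thesis
  proof (cases "r \<le> z1")
    case True
    then have "clamp l r z = clamp l r z1" "clamp l r z2 = clamp l r z1" using b z by (auto simp: clamp_def)
    then show ?thesis using z by (simp flip: distrib_right)
  next
    case False
    then have c: "clamp l r x = max 0 (x - l)" if "x \<le> z2" for x using r that by (auto simp: clamp_def)
    have "s * (z1 - l) + t * (z2 - l) \<le> s * max 0 (z1 - l) + t * max 0 (z2 - l)"
      using z by (intro add_mono mult_left_mono) auto
    moreover have "s * (z1 - l) + t * (z2 - l) = z - l"
    proof -
      have "s * (z1 - l) + t * (z2 - l) = z - (s + t) * l" by (simp add: z(5) algebra_simps)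
      then show ?thesis using z by simp
    qed
    moreover have "0 \<le> s * max 0 (z1 - l) + t * max 0 (z2 - l)" using z by simp
    ultimately show ?thesis using c b z by auto
  qed
qed

text \<open>The reflection \<open>z\<close> to \<open>- z\<close> exchanges the two kinks and turns
  \<open>clamp\<close> into a constant minus a clamp, which reduces the claim to the convex
  case.\<close>

lemma clamp_concave:
  assumes l: "l \<le> z1 \<or> z2 \<le> l" and lr: "l \<le> r"
    and z: "z1 \<le> z2" "0 \<le> s" "0 \<le> t" "s + t = 1" "z = s * z1 + t * z2"
  shows "s * clamp l r z1 + t * clamp l r z2 \<le> clamp l r z"
proof -
  have "clamp l r x = (r - l) - clamp (- r) (- l) (- x)" for x using lr by (auto simp: clamp_def)
  moreover have "clamp (- r) (- l) (- z) \<le> t * clamp (- r) (- l) (- z2) + s * clamp (- r) (- l) (- z1)"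
    using l z by (intro clamp_convex[of "-l" "-z2" "-z1"]) auto
  moreover have "s * ((r - l) - x) + t * ((r - l) - y) = (r - l) - (t * y + s * x)" for x y
  proof -
    have "s * ((r - l) - x) + t * ((r - l) - y) = (s + t) * (r - l) - (t * y + s * x)"
      by (simp add: algebra_simps)
    then show ?thesis using z by simp
  qed
  ultimately show ?thesis by simp
qed

context yard
begin

abbreviation "\<kappa> \<equiv> 1 - 1 / speed Y"

lemma \<kappa>_nonneg: "0 \<le> \<kappa>"
  using speed_ge by simp

section \<open>Closed forms of travel times by prefix sums and the work of a pad\<close>

lemma sum_piles:
  "(\<Sum>j\<in>{offset Y p + m + 1..offset Y p + n}. f j) = (\<Sum>i=m+1..n. f (offset Y p + i))"
  using sum.shift_bounds_cl_nat_ivl[of f "m + 1" "offset Y p" n] by (simp add: add.commute add.left_commute)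

lemma overlap_clamp:
  "1 \<le> i \<Longrightarrow> i \<le> pile_num Y p \<Longrightarrow> overlap Y (offset Y p + i) z = clamp (left_at Y p i) (right_at Y p i) z"
  by (simp add: overlap_def clamp_def left_at_def right_at_def)

lemma near_overlap:
  assumes "i \<le> pile_num Y p"
  shows "(\<Sum>j\<in>near Y p i. overlap Y j z) = (\<Sum>k=1..i. clamp (left_at Y p k) (right_at Y p k) z)"
  using sum_piles[of "\<lambda>j. overlap Y j z" p 0 i] assms by (simp add: near_def overlap_clamp)

lemma far_overlap:
  "(\<Sum>j\<in>far Y p i. overlap Y j z) = (\<Sum>k=i+1..pile_num Y p. clamp (left_at Y p k) (right_at Y p k) z)"
  using sum_piles[of "\<lambda>j. overlap Y j z" p i "pile_num Y p"] by (simp add: far_def overlap_clamp)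

lemma clamp_full:
  assumes "k \<le> i" "1 \<le> k" "i \<le> pile_num Y p" "right_at Y p i \<le> z"
  shows "clamp (left_at Y p k) (right_at Y p k) z = right_at Y p k - left_at Y p k"
  using right_at_mono[of k i p] left_right_at[of k p] assms by (simp add: clamp_def)

lemma clamp_empty:
  assumes "i < k" "z \<le> left_at Y p (i + 1)"
  shows "clamp (left_at Y p k) (right_at Y p k) z = 0"
  using left_at_mono[of "i + 1" k p] assms by (simp add: clamp_def)

lemma sum_split: "i \<le> n \<Longrightarrow> (\<Sum>k=1..n. f k) = (\<Sum>k=1..i. f k) + (\<Sum>k=i+1..n. (f k :: real))" for n :: nat
  using sum.ub_add_nat[of 1 i f "n - i"] by simp

lemma near_time_beyond:
  assumes "i \<le> pile_num Y p" "right_at Y p i \<le> z"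
  shows "travel_time Y (near Y p i) z = z / speed Y + \<kappa> * prefix_work Y p i"
  using assms by (simp add: travel_time_def near_overlap prefix_work_def clamp_full[of _ i])

text \<open>To the left of stockpile \<open>i + 1\<close> the later stockpiles contribute nothing,
  so the share may be extended to the whole pad. This is how the dependence on the split disappears
  from \<open>gain\<close>.\<close>

lemma near_time_before:
  assumes "i \<le> pile_num Y p" "z \<le> left_at Y p (i + 1)"
  shows "travel_time Y (near Y p i) z = z / speed Y + \<kappa> * work Y p z"
  using assms clamp_empty[of i _ z p]
  unfolding travel_time_def near_overlap[OF assms(1)] work_def sum_split[OF assms(1)] by simp

lemma far_time_before:
  assumes "z \<le> left_at Y p (i + 1)"
  shows "travel_time Y (far Y p i) z = z / speed Y"
  using assms clamp_empty[of i _ z p] by (simp add: travel_time_def far_overlap)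

lemma far_time_beyond:
  assumes "i \<le> pile_num Y p" "right_at Y p i \<le> z"
  shows "travel_time Y (far Y p i) z = z / speed Y + \<kappa> * (work Y p z - prefix_work Y p i)"
  using assms unfolding travel_time_def far_overlap work_def prefix_work_def sum_split[OF assms(1)]
  by (simp add: clamp_full[of _ i])

lemma work_full:
  assumes "right_at Y p (pile_num Y p) \<le> z"
  shows "work Y p z = prefix_work Y p (pile_num Y p)"
  using assms by (simp add: work_def prefix_work_def clamp_full[of _ "pile_num Y p"])

lemma split_at_simps [simp]:
  "split_at p a b p = a" "split_at p a b (other_pad p) = b"
  by (simp_all add: split_at_def)

lemma is_split_split_at:
  "is_split (split_at p a b) \<longleftrightarrow> a \<le> pile_num Y p \<and> b \<le> pile_num Y (other_pad p)"
  unfolding is_split_def by (cases p) (auto simp: split_at_def all_pads)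

lemma peak_eq:
  "peak Y (split_at p a b) = max (1 / 3) (max (right_at Y p a) (right_at Y (other_pad p) b))"
  by (cases p) (auto simp: peak_def split_at_def)

lemma valley_eq:
  "valley Y (split_at p a b) = min (pad_length Y - 1 / 3)
     (min (left_at Y p (a + 1)) (left_at Y (other_pad p) (b + 1)))"
  by (cases p) (auto simp: valley_def split_at_def)

lemma time0_eq:
  assumes "is_split c"
  shows "time0 Y c = 2 * peak Y c / speed Y +
    \<kappa> * (prefix_work Y p (c p) + prefix_work Y (other_pad p) (c (other_pad p)))"
proof -
  have "near_time Y r c (peak Y c) = peak Y c / speed Y + \<kappa> * prefix_work Y r (c r)" for r
    using assms near_le_peak[of Y r c] by (intro near_time_beyond) (auto simp: is_split_def)
  then show ?thesis by (simp add: time0_pads[of Y c p] distrib_left)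
qed

lemma time1_eq:
  assumes "is_split c"
  shows "time1 Y c = 2 * (pad_length Y - valley Y c) / speed Y +
    \<kappa> * (prefix_work Y p (pile_num Y p) - prefix_work Y p (c p)
      + (prefix_work Y (other_pad p) (pile_num Y (other_pad p)) - prefix_work Y (other_pad p) (c (other_pad p))))"
proof -
  have "far_time Y r c (pad_length Y) - far_time Y r c (valley Y c) = (pad_length Y - valley Y c) / speed Y
     + \<kappa> * (prefix_work Y r (pile_num Y r) - prefix_work Y r (c r))" for r
    using assms valley_le_far[of Y c r] right_at_bounds(2)
    by (simp add: far_time_before far_time_beyond is_split_def work_full diff_divide_distrib)
  from this[of p] this[of "other_pad p"] show ?thesis
    by (simp add: time1_pads[of Y c p] distrib_left diff_divide_distrib)
qed

text \<open>With \<open>q\<close> for the other pad, crossing arranges the ends as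
  \<open>right_at Y q b\<close>, \<open>left_at Y q (b + 1)\<close>, \<open>right_at Y p a\<close>,
  \<open>left_at Y p (a + 1)\<close> in increasing order. This fixes peak and valley and rules out a
  crossing the other way round; the default values exclude \<open>a = 0\<close> and an exhausted
  other pad.\<close>

lemma crossing_facts:
  assumes "crossing Y p a b" "a \<le> pile_num Y p" "b \<le> pile_num Y (other_pad p)"
  shows "1 \<le> a" "b < pile_num Y (other_pad p)"
    and "peak Y (split_at p a b) = right_at Y p a"
    and "valley Y (split_at p a b) = left_at Y (other_pad p) (b + 1)"
    and "\<not> crossing Y (other_pad p) b a"
proof -
  have cr: "left_at Y (other_pad p) (b + 1) < right_at Y p a" using assms(1) by (simp add: crossing_def)
  show a: "1 \<le> a"
    using cr left_at_bounds(1)[of "other_pad p" "b + 1"] by (cases a) (auto simp: right_at_def)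
  show b: "b < pile_num Y (other_pad p)"
    using cr right_at_bounds(2)[of p a] assms(3) by (cases "b < pile_num Y (other_pad p)") (auto simp: left_at_def)
  have ra: "1 \<le> right_at Y p a" using a assms right_at_pos by blast
  have lb: "left_at Y (other_pad p) (b + 1) \<le> pad_length Y - 1" using b left_at_le by simp
  have 1: "right_at Y (other_pad p) b \<le> left_at Y (other_pad p) (b + 1)" by (rule right_left_at) simp
  have 2: "right_at Y p a \<le> left_at Y p (a + 1)" by (rule right_left_at) simp
  show "peak Y (split_at p a b) = right_at Y p a" using 1 cr ra by (simp add: peak_eq)
  show "valley Y (split_at p a b) = left_at Y (other_pad p) (b + 1)" using 2 cr lb by (simp add: valley_eq)
  show "\<not> crossing Y (other_pad p) b a" using 1 2 cr by (simp add: crossing_def)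
qed

text \<open>The terms \<open>z / speed Y\<close> of the two travel times cancel. Of each reclaimer's
  work, what is complete throughout the common region enters \<open>base_delay\<close> as prefix
  sums, and only \<open>gain\<close> still varies with \<open>z\<close>.\<close>

lemma need_crossing:
  assumes "crossing Y p a b" "a \<le> pile_num Y p" "b \<le> pile_num Y (other_pad p)"
    and z: "left_at Y (other_pad p) (b + 1) \<le> z" "z \<le> right_at Y p a"
  shows "need Y (pick u p) (pick v p) (split_at p a b) z = base_delay Y p u v a b + \<kappa> * gain Y p u v z"
proof -
  let ?c = "split_at p a b" and ?q = "other_pad p" and ?L = "real_of_int (pad_length Y)"
  have c: "is_split ?c" using assms by (simp add: is_split_split_at)
  note cf = crossing_facts[OF assms(1-3)]
  have za: "z \<le> left_at Y p (a + 1)" using z right_left_at[of a "a + 1" p] by simp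
  have zb: "right_at Y ?q b \<le> z" using z right_left_at[of b "b + 1" ?q] by simp
  have L: "right_at Y r i \<le> ?L" for r i by (rule right_at_bounds)
  have T0: "time0 Y ?c = 2 * right_at Y p a / speed Y + \<kappa> * (prefix_work Y p a + prefix_work Y ?q b)"
    using time0_eq[OF c, of p] cf(3) by simp
  have N: "travel_time Y (near Y (other_pad (pick u p)) (?c (other_pad (pick u p)))) z =
      z / speed Y + \<kappa> * (if u then work Y p z else prefix_work Y ?q b)"
    using near_time_before[OF assms(2) za] near_time_beyond[OF assms(3) zb] by (simp add: pick_def)
  have F: "travel_time Y (far Y (pick v p) (?c (pick v p))) ?L - travel_time Y (far Y (pick v p) (?c (pick v p))) z =
      (?L - z) / speed Y + \<kappa> * (if v then prefix_work Y ?q (pile_num Y ?q) - work Y ?q z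
        else prefix_work Y p (pile_num Y p) - prefix_work Y p a)"
    using far_time_beyond[OF assms(3) zb] far_time_before[OF za] far_time_beyond[OF assms(2) L]
      far_time_beyond[OF assms(3) L] work_full[OF L]
    by (simp add: pick_def diff_divide_distrib right_diff_distrib)
  show ?thesis
    unfolding need_def N F T0 base_delay_def gain_def
    by (cases u; cases v) (simp_all add: diff_divide_distrib add_divide_distrib algebra_simps)
qed

text \<open>Between neighbouring points the work of the other pad is convex and that of
  \<open>p\<close> is concave, so \<open>gain\<close> is convex there and is dominated by its value
  at one of the two neighbours of \<open>z\<close>.\<close>

lemma gain_extremal:
  assumes cr: "crossing Y p a b" "a \<le> pile_num Y p" "b \<le> pile_num Y (other_pad p)"
    and z: "left_at Y (other_pad p) (b + 1) \<le> z" "z \<le> right_at Y p a"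
  shows "\<exists>x\<in>left_points Y p a b \<union> right_points Y p a b. gain Y p u v z \<le> gain Y p u v x"
proof -
  let ?q = "other_pad p" and ?Z = "left_points Y p a b \<union> right_points Y p a b"
  have fin: "finite ?Z" by (simp add: left_points_def right_points_def)
  have ends: "left_at Y ?q (b + 1) \<in> ?Z" "right_at Y p a \<in> ?Z"
    by (simp_all add: left_points_def right_points_def)
  define z1 where "z1 = Max {x \<in> ?Z. x \<le> z}"
  define z2 where "z2 = Min {x \<in> ?Z. z \<le> x}"
  have "z1 \<in> {x \<in> ?Z. x \<le> z}" unfolding z1_def using fin ends z by (intro Max_in) auto
  then have z1: "z1 \<in> ?Z" "z1 \<le> z" by auto
  have "z2 \<in> {x \<in> ?Z. z \<le> x}" unfolding z2_def using fin ends z by (intro Min_in) auto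
  then have z2: "z2 \<in> ?Z" "z \<le> z2" by auto
  have z1_max: "x \<le> z1" if "x \<in> ?Z" "x \<le> z" for x unfolding z1_def using fin that by (intro Max_ge) auto
  have z2_min: "z2 \<le> x" if "x \<in> ?Z" "z \<le> x" for x unfolding z2_def using fin that by (intro Min_le) auto
  have gap: "x \<le> z1 \<or> z2 \<le> x" if "x \<in> ?Z" for x using z1_max z2_min that by fastforce
  have lo: "left_at Y ?q (b + 1) \<le> z1" and hi: "z2 \<le> right_at Y p a" using z1_max z2_min ends z by auto
  \<comment> \<open>Left ends missing from the point set lie left of the common region or, for
    \<open>i > a\<close>, at or beyond its right boundary; so none falls strictly between the
    neighbours.\<close>
  have left: "left_at Y p i \<le> z1 \<or> z2 \<le> left_at Y p i" if i: "i \<in> {1..pile_num Y p}" for i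
  proof (cases "i \<le> a \<and> left_at Y ?q (b + 1) \<le> left_at Y p i")
    case True
    then have "left_at Y p i \<in> ?Z" using i by (auto simp: left_points_def)
    then show ?thesis by (rule gap)
  next
    case False
    then show ?thesis using right_left_at[of a i p] lo hi by fastforce
  qed
  \<comment> \<open>Stockpiles with \<open>j \<le> b\<close> end before the common region begins,
    and the other right ends missing from the set lie beyond it.\<close>
  have right: "right_at Y ?q j \<le> z1 \<or> z2 \<le> right_at Y ?q j" if j: "j \<in> {1..pile_num Y ?q}" for j
  proof (cases "b < j \<and> right_at Y ?q j \<le> right_at Y p a")
    case True
    then have "right_at Y ?q j \<in> ?Z" using j by (auto simp: right_points_def)
    then show ?thesis by (rule gap)
  next
    case False
    then show ?thesis using right_left_at[of j "b + 1" ?q] lo hi by fastforce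
  qed
  obtain s t where st: "0 \<le> s" "0 \<le> t" "s + t = 1" "z = s * z1 + t * z2"
  proof (cases "z1 = z2")
    case True
    then show ?thesis using that[of 1 0] z1 z2 by simp
  next
    case False
    then have lt: "z1 < z2" using z1 z2 by simp
    define t where "t = (z - z1) / (z2 - z1)"
    have "0 \<le> t" "t \<le> 1" "t * (z2 - z1) = z - z1" using lt z1 z2 by (simp_all add: t_def)
    then show ?thesis using that[of "1 - t" t] by (simp add: algebra_simps)
  qed
  have le: "z1 \<le> z2" using z1 z2 by simp
  have "work Y ?q z \<le> (\<Sum>i=1..pile_num Y ?q. s * clamp (left_at Y ?q i) (right_at Y ?q i) z1 +
      t * clamp (left_at Y ?q i) (right_at Y ?q i) z2)"
    unfolding work_def using right st le by (intro sum_mono clamp_convex) auto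
  then have wq: "work Y ?q z \<le> s * work Y ?q z1 + t * work Y ?q z2"
    by (simp add: work_def sum.distrib sum_distrib_left)
  have "(\<Sum>i=1..pile_num Y p. s * clamp (left_at Y p i) (right_at Y p i) z1 +
      t * clamp (left_at Y p i) (right_at Y p i) z2) \<le> work Y p z"
    unfolding work_def using left left_right_at[of _ p] st le by (intro sum_mono clamp_concave) (auto intro: less_imp_le)
  then have wp: "s * work Y p z1 + t * work Y p z2 \<le> work Y p z"
    by (simp add: work_def sum.distrib sum_distrib_left)
  have "gain Y p u v z \<le> s * gain Y p u v z1 + t * gain Y p u v z2"
    unfolding gain_def using wq wp by (cases u; cases v) (auto simp: right_diff_distrib)
  also have "\<dots> \<le> max (gain Y p u v z1) (gain Y p u v z2)"
    using st by (intro convex_bound_le) auto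
  finally show ?thesis using z1 z2 by (auto simp: max_def split: if_splits)
qed

text \<open>The maximum that defines \<open>delay\<close> is thus attained inside the common region,
  where the lower bound applies. So the chosen delay is no larger than what every schedule with this
  split and these pads incurs.\<close>

lemma points_range:
  assumes cr: "crossing Y p a b" "a \<le> pile_num Y p" "b \<le> pile_num Y (other_pad p)"
    and "x \<in> left_points Y p a b \<union> right_points Y p a b"
  shows "left_at Y (other_pad p) (b + 1) \<le> x" "x \<le> right_at Y p a"
proof -
  have lt: "left_at Y (other_pad p) (b + 1) \<le> right_at Y p a" using cr by (simp add: crossing_def)
  have 1: "left_at Y p i \<le> right_at Y p a" if "1 \<le> i" "i \<le> a" for i
    using left_right_at[of i p] right_at_mono[of i a p] that cr by simp
  have 2: "left_at Y (other_pad p) (b + 1) \<le> right_at Y (other_pad p) j"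
    if "b < j" "j \<le> pile_num Y (other_pad p)" for j
    using left_right_at[of j "other_pad p"] left_at_mono[of "b + 1" j "other_pad p"] that by simp
  show "left_at Y (other_pad p) (b + 1) \<le> x" "x \<le> right_at Y p a"
    using assms(4) lt 1 2 by (auto simp: left_points_def right_points_def)
qed

lemma finite_points [simp]: "finite (left_points Y p a b)" "finite (right_points Y p a b)"
  and points_nonempty [simp]: "left_points Y p a b \<noteq> {}" "right_points Y p a b \<noteq> {}"
  by (simp_all add: left_points_def right_points_def)

lemma max_gain:
  "max (Max (gain Y p u v ` left_points Y p a b)) (Max (gain Y p u v ` right_points Y p a b)) =
   Max (gain Y p u v ` (left_points Y p a b \<union> right_points Y p a b))"
  by (simp add: image_Un Max_Un)

lemma idle1_split_at: "idle1 (split_at p a b) \<longleftrightarrow> a = pile_num Y p \<and> b = pile_num Y (other_pad p)"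
  unfolding idle1_def by (cases p) (auto simp: split_at_def all_pads)

lemma candidate_plan_correct:
  assumes "admissible Y p a b"
  shows "contiguous_unimodal Y (candidate_plan Y p u v a b)"
    and "makespan (candidate_plan Y p u v a b) = candidate_value Y p u v a b"
proof -
  let ?c = "split_at p a b" and ?q = "other_pad p" and ?d = "delay Y p u v a b"
  have ab: "a \<le> pile_num Y p" "b \<le> pile_num Y ?q" and ncq: "\<not> crossing Y ?q b a"
    using assms by (auto simp: admissible_def)
  have c: "is_split ?c" using ab by (simp add: is_split_split_at)
  have d: "0 \<le> ?d \<and> (\<forall>z. valley Y ?c < peak Y ?c \<longrightarrow> valley Y ?c \<le> z \<longrightarrow> z \<le> peak Y ?c \<longrightarrow>
      need Y (pick u p) (pick v p) ?c z \<le> ?d)"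
  proof (cases "crossing Y p a b")
    case True
    note cf = crossing_facts[OF True ab]
    have "need Y (pick u p) (pick v p) ?c z \<le> ?d" if z: "valley Y ?c \<le> z" "z \<le> peak Y ?c" for z
    proof -
      have z': "left_at Y ?q (b + 1) \<le> z" "z \<le> right_at Y p a" using z cf by simp_all
      obtain x where x: "x \<in> left_points Y p a b \<union> right_points Y p a b" "gain Y p u v z \<le> gain Y p u v x"
        using gain_extremal[OF True ab z'] by blast
      have "gain Y p u v x \<le> Max (gain Y p u v ` (left_points Y p a b \<union> right_points Y p a b))"
        using x(1) by (intro Max_ge) auto
      with x(2) have "\<kappa> * gain Y p u v z \<le> \<kappa> * Max (gain Y p u v ` (left_points Y p a b \<union> right_points Y p a b))"
        by (intro mult_left_mono[OF _ \<kappa>_nonneg]) (rule order_trans)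
      then show ?thesis unfolding need_crossing[OF True ab z'] delay_def max_gain using True by simp
    qed
    then show ?thesis using True by (simp add: delay_def)
  next
    case False
    show ?thesis
    proof (cases "idle1 ?c")
      case True
      have d: "?d = time0 Y ?c - time1 Y ?c" using False True by (simp add: delay_def idle1_split_at)
      \<comment> \<open>The ways of \<open>R1\<close> from its home to \<open>z\<close> and of
        \<open>R0\<close> from \<open>z\<close> to its home add up to the whole rail. They take at
        least \<open>pad_length Y / speed Y\<close>, more than the \<open>2 / (3 * speed Y)\<close>
        of the idle excursion.\<close>
      have "need Y (pick u p) (pick v p) ?c z \<le> ?d" if z: "valley Y ?c \<le> z" "z \<le> peak Y ?c" for z
      proof -
        let ?r = "other_pad (pick u p)"
        have "0 \<le> z" using z valley_bounds(1)[of ?c] by simp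
        then have N: "z / speed Y \<le> near_time Y ?r ?c z"
          using travel_time_lower[OF speed_ge, of 0 z "near Y ?r (?c ?r)"] c
          by (simp add: travel_time_near_zero is_split_def)
        have F: "far_time Y (pick v p) ?c (pad_length Y) - far_time Y (pick v p) ?c z = (pad_length Y - z) / speed Y"
          by (simp add: time1_idle(2)[OF True] travel_time_def diff_divide_distrib)
        have "2 / 3 / speed Y \<le> pad_length Y / speed Y"
          using length_pos speed_ge by (intro divide_right_mono) auto
        then show ?thesis using N F unfolding need_def d time1_idle(3)[OF True]
          by (simp add: diff_divide_distrib)
      qed
      then show ?thesis using d time1_le_time0[OF True c] by simp
    next
      case nidle1: False
      have d: "?d = 0" using False nidle1 by (auto simp: delay_def idle1_split_at)
      show ?thesis
      proof (cases "idle0 ?c")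
        case True
        \<comment> \<open>The same comparison with the roles exchanged: the idle \<open>R0\<close>
          leaves \<open>z\<close> before \<open>R1\<close> can have come so far.\<close>
        have "need Y (pick u p) (pick v p) ?c z \<le> 0" if z: "valley Y ?c \<le> z" "z \<le> peak Y ?c" for z
        proof -
          have "(pad_length Y - z) / speed Y \<le> far_time Y (pick v p) ?c (pad_length Y) - far_time Y (pick v p) ?c z"
            using z peak_bounds(2)[of ?c] by (intro travel_time_lower speed_ge) simp
          moreover have "2 / 3 / speed Y \<le> pad_length Y / speed Y"
            using length_pos speed_ge by (intro divide_right_mono) auto
          ultimately show ?thesis
            unfolding need_def time0_idle(3)[OF True]
            by (simp add: time0_idle(2)[OF True] travel_time_def[of Y "{}"] diff_divide_distrib)
        qed
        then show ?thesis using d by simp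
      next
        case nidle0: False
        \<comment> \<open>On the same pad this is the order of the stockpiles; on different pads it
          is the absence of one of the two crossings.\<close>
        have "right_at Y r (?c r) \<le> left_at Y r' (?c r' + 1)" for r r'
        proof -
          have "r' = r \<or> r = p \<and> r' = ?q \<or> r = ?q \<and> r' = p" by (cases r; cases r'; cases p) auto
          then show ?thesis using False ncq right_left_at[of "?c r" "?c r + 1" r] by (auto simp: crossing_def)
        qed
        then have "peak Y ?c \<le> valley Y ?c"
          using peak_not_idle(2)[OF c nidle0] valley_not_idle(2)[OF c nidle1] by simp
        then show ?thesis using d by simp
      qed
    qed
  qed
  show "contiguous_unimodal Y (candidate_plan Y p u v a b)"
    unfolding candidate_plan_def using d by (intro upper_bound[OF c]) auto
  show "makespan (candidate_plan Y p u v a b) = candidate_value Y p u v a b"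
    unfolding candidate_plan_def candidate_value_def
    using d upper_bound(2)[OF c, of ?d "pick u p" "pick v p"] by (simp add: add.commute)
qed

lemma candidate_below:
  assumes "contiguous_unimodal Y S"
  shows "\<exists>p u v a b. admissible Y p a b \<and> candidate_value Y p u v a b \<le> makespan S"
proof -
  obtain c o0 o1 where c: "is_split c" "time0 Y c \<le> makespan S" "time1 Y c \<le> makespan S"
    and need: "\<And>z. \<not> idle0 c \<Longrightarrow> \<not> idle1 c \<Longrightarrow> valley Y c \<le> z \<Longrightarrow> z \<le> peak Y c \<Longrightarrow>
      time1 Y c + need Y o0 o1 c z \<le> makespan S"
    by (rule lower_bound[OF assms]) (rule that; assumption)
  \<comment> \<open>The pad on which \<open>R0\<close> goes beyond stockpiles of \<open>R1\<close>.
    Without any crossing both choices are admissible, and \<open>Pad1\<close> is the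
    default.\<close>
  define p where "p = (if crossing Y Pad2 (c Pad2) (c Pad1) then Pad2 else Pad1)"
  define q where "q = other_pad p"
  define u v where "u = (o0 \<noteq> p)" and "v = (o1 \<noteq> p)"
  have o: "o0 = pick u p" "o1 = pick v p"
    unfolding u_def v_def pick_def by (cases o0; cases p; simp) (cases o1; cases p; simp)
  have pads: "r = p \<or> r = q" for r unfolding q_def by (cases r; cases p) simp_all
  have cs: "c = split_at p (c p) (c q)"
  proof
    fix r show "c r = split_at p (c p) (c q) r" using pads[of r] by (auto simp: split_at_def)
  qed
  have ab: "c p \<le> pile_num Y p" "c q \<le> pile_num Y (other_pad p)" using c by (auto simp: is_split_def q_def)
  have adm: "admissible Y p (c p) (c q)"
    using ab crossing_facts(5)[of Pad2 "c Pad2" "c Pad1"] unfolding admissible_def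
    by (auto simp: p_def q_def split: if_splits)
  have "time1 Y c + delay Y p u v (c p) (c q) \<le> makespan S"
  proof (cases "crossing Y p (c p) (c q)")
    case True
    note cf = crossing_facts[OF True ab, folded cs]
    let ?Z = "left_points Y p (c p) (c q) \<union> right_points Y p (c p) (c q)"
    \<comment> \<open>The lower bound is applied at a single point, one where the maximum of
      \<open>gain\<close> is attained.\<close>
    have "Max (gain Y p u v ` ?Z) \<in> gain Y p u v ` ?Z" by (intro Max_in) auto
    then obtain x where x: "x \<in> ?Z" "Max (gain Y p u v ` ?Z) = gain Y p u v x" by blast
    note xr = points_range[OF True ab x(1)]
    have "\<not> idle0 c" "\<not> idle1 c"
      unfolding idle0_def idle1_def using cf(1,2) by (metis not_one_le_zero, metis q_def less_irrefl)
    then have "time1 Y c + need Y o0 o1 c x \<le> makespan S" using need xr cf by simp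
    also have "need Y o0 o1 c x = base_delay Y p u v (c p) (c q) + \<kappa> * gain Y p u v x"
      unfolding o using need_crossing[OF True ab xr, of u v, folded cs] .
    finally show ?thesis using True c by (simp add: delay_def max_gain x)
  next
    case False
    \<comment> \<open>Here the delay is 0 or \<open>time0 - time1\<close>, so the sum is one of the
      two times that are already bounded.\<close>
    then show ?thesis unfolding delay_def cs[symmetric] using c by simp
  qed
  then have "candidate_value Y p u v (c p) (c q) \<le> makespan S"
    using c by (simp add: candidate_value_def flip: cs)
  then show ?thesis using adm by blast
qed

theorem best_candidate_optimal:
  assumes "admissible Y p a b"
    and "\<And>p' u' v' a' b'. admissible Y p' a' b' \<Longrightarrow> candidate_value Y p u v a b \<le> candidate_value Y p' u' v' a' b'"
  shows "optimal_contiguous_unimodal Y (candidate_plan Y p u v a b)"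
  unfolding optimal_contiguous_unimodal_def
  using candidate_plan_correct[OF assms(1)] candidate_below assms(2) by (metis order_trans)

end

section \<open>Reasoning about programs\<close>

text \<open>Symbolic execution of loop-free programs. The clause for \<open>Loop\<close> is a
  placeholder: \<open>exec_run\<close>, which links \<open>run\<close> to \<open>exec\<close>,
  assumes \<open>depth c = 0\<close>.\<close>

fun run :: "program \<Rightarrow> machine_state \<Rightarrow> machine_state" where
  "run Nop \<sigma> = \<sigma>"
| "run (SetReg x a) \<sigma> = \<sigma>\<lparr>regs := (regs \<sigma>)(x := nval a \<sigma>)\<rparr>"
| "run (Write A i e) \<sigma> = \<sigma>\<lparr>arrays := (arrays \<sigma>)(A := (arrays \<sigma> A)(nval i \<sigma> := rval e \<sigma>))\<rparr>"
| "run (Then c1 c2) \<sigma> = run c2 (run c1 \<sigma>)"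
| "run (Cond b c1 c2) \<sigma> = (if bval b \<sigma> then run c1 \<sigma> else run c2 \<sigma>)"
| "run (Loop b c) \<sigma> = \<sigma>"

fun depth :: "program \<Rightarrow> nat" where
  "depth (Then c1 c2) = max (depth c1) (depth c2)"
| "depth (Cond b c1 c2) = max (depth c1) (depth c2)"
| "depth (Loop b c) = Suc (depth c)"
| "depth _ = 0"

text \<open>The factor 2 for a loop pays for the test in each iteration and for the final test that
  fails. Conditionals are charged for both branches, so the weight does not depend on the
  state.\<close>

fun weight :: "program \<Rightarrow> nat" where
  "weight Nop = 1"
| "weight (SetReg x a) = 1 + ncost a"
| "weight (Write A i e) = 1 + ncost i + rcost e"
| "weight (Then c1 c2) = 1 + weight c1 + weight c2"
| "weight (Cond b c1 c2) = 1 + bcost b + weight c1 + weight c2"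
| "weight (Loop b c) = 2 * (1 + bcost b) + weight c"

text \<open>
  If every loop makes at most \<open>M\<close> iterations, then \<open>c\<close> needs at most \<open>weight c * M ^ depth c\<close>
  time units.
\<close>

definition triple :: "nat \<Rightarrow> (machine_state \<Rightarrow> bool) \<Rightarrow> program \<Rightarrow> (machine_state \<Rightarrow> bool) \<Rightarrow> bool" where
  "triple M P c Q \<longleftrightarrow> (\<forall>\<sigma>. P \<sigma> \<longrightarrow> (\<exists>t \<sigma>'. exec c \<sigma> t \<sigma>' \<and> t \<le> weight c * M ^ depth c \<and> Q \<sigma>'))"

lemma exec_run:
  assumes "depth c = 0"
  shows "\<exists>t. exec c \<sigma> t (run c \<sigma>) \<and> t \<le> weight c"
  using assms
proof (induction c arbitrary: \<sigma>)
  case (Then c1 c2)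
  then obtain t1 t2 where "exec c1 \<sigma> t1 (run c1 \<sigma>)" "t1 \<le> weight c1"
    "exec c2 (run c1 \<sigma>) t2 (run c2 (run c1 \<sigma>))" "t2 \<le> weight c2"
    by (metis depth.simps(1) max_nat.eq_neutr_iff)
  then show ?case using exec_Then[of c1 \<sigma> t1 "run c1 \<sigma>" c2 t2] by (intro exI[of _ "1 + t1 + t2"]) auto
next
  case (Cond b c1 c2)
  then obtain t1 t2 where "exec c1 \<sigma> t1 (run c1 \<sigma>)" "t1 \<le> weight c1"
    "exec c2 \<sigma> t2 (run c2 \<sigma>)" "t2 \<le> weight c2"
    by (metis depth.simps(2) max_nat.eq_neutr_iff)
  then show ?case
    using exec_Cond_true[of b \<sigma> c1 t1 "run c1 \<sigma>" c2] exec_Cond_false[of b \<sigma> c2 t2 "run c2 \<sigma>" c1]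
    by (intro exI[of _ "1 + bcost b + (if bval b \<sigma> then t1 else t2)"]) auto
qed (auto intro: exec_Nop exec_SetReg[simplified] exec_Write[simplified] exI[of _ "Suc _"])

lemma triple_run:
  assumes "depth c = 0" "\<And>\<sigma>. P \<sigma> \<Longrightarrow> Q (run c \<sigma>)"
  shows "triple M P c Q"
  unfolding triple_def using exec_run[OF assms(1)] assms by fastforce

lemma triple_weaken:
  assumes "triple M P' c Q'" "\<And>\<sigma>. P \<sigma> \<Longrightarrow> P' \<sigma>" "\<And>\<sigma>. Q' \<sigma> \<Longrightarrow> Q \<sigma>"
  shows "triple M P c Q"
  using assms unfolding triple_def by blast

lemma triple_pre:
  assumes "triple M P' c Q" "\<And>\<sigma>. P \<sigma> \<Longrightarrow> P' \<sigma>"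
  shows "triple M P c Q"
  using triple_weaken[OF assms] .

lemma triple_Then:
  assumes "triple M P c1 R" "triple M R c2 Q" "1 \<le> M"
  shows "triple M P (Then c1 c2) Q"
  unfolding triple_def
proof (intro allI impI)
  fix \<sigma> assume "P \<sigma>"
  then obtain t1 \<sigma>1 where 1: "exec c1 \<sigma> t1 \<sigma>1" "t1 \<le> weight c1 * M ^ depth c1" "R \<sigma>1"
    using assms(1) unfolding triple_def by blast
  then obtain t2 \<sigma>2 where 2: "exec c2 \<sigma>1 t2 \<sigma>2" "t2 \<le> weight c2 * M ^ depth c2" "Q \<sigma>2"
    using assms(2) unfolding triple_def by blast
  let ?D = "depth (Then c1 c2)"
  have "M ^ depth c1 \<le> M ^ ?D" "M ^ depth c2 \<le> M ^ ?D" "1 \<le> M ^ ?D"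
    using assms(3) by (auto intro!: power_increasing)
  then have "t1 \<le> weight c1 * M ^ ?D" "t2 \<le> weight c2 * M ^ ?D" "1 \<le> M ^ ?D"
    using 1(2) 2(2) by (meson mult_le_mono2 order_trans)+
  then have "1 + t1 + t2 \<le> weight (Then c1 c2) * M ^ ?D" by (simp add: distrib_right)
  then show "\<exists>t \<sigma>'. exec (Then c1 c2) \<sigma> t \<sigma>' \<and> t \<le> weight (Then c1 c2) * M ^ ?D \<and> Q \<sigma>'"
    using exec_Then[OF 1(1) 2(1)] 2(3) by blast
qed

definition For :: "string \<Rightarrow> nexp \<Rightarrow> program \<Rightarrow> program" where
  "For i bd c = Then (SetReg i (NConst 0))
     (Loop (NLess (NReg i) bd) (Then c (SetReg i (NAdd (NReg i) (NConst 1)))))"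

lemma depth_For [simp]: "depth (For i bd c) = Suc (depth c)"
  by (simp add: For_def)

lemma weight_For: "weight (For i bd c) = 10 + 2 * bcost (NLess (NReg i) bd) + weight c"
  by (simp add: For_def)

text \<open>The invariant \<open>I\<close> must not mention the loop counter, since its argument \<open>k\<close> stands for it.\<close>

lemma triple_For:
  assumes "N \<le> M" "1 \<le> M"
    and bound: "\<And>k \<sigma>. I k \<sigma> \<Longrightarrow> nval bd \<sigma> = N"
    and body: "\<And>k. k < N \<Longrightarrow> triple M (\<lambda>\<sigma>. I k \<sigma> \<and> regs \<sigma> i = k) c (\<lambda>\<sigma>. I (Suc k) \<sigma> \<and> regs \<sigma> i = k)"
    and ins: "\<And>k m \<sigma>. I k \<sigma> \<Longrightarrow> I k (\<sigma>\<lparr>regs := (regs \<sigma>)(i := m)\<rparr>)"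
  shows "triple M (I 0) (For i bd c) (I N)"
proof -
  let ?b = "NLess (NReg i) bd"
  let ?c = "Then c (SetReg i (NAdd (NReg i) (NConst 1)))"
  let ?K = "2 + bcost ?b + weight c * M ^ depth c + 4"
  \<comment> \<open>Induction on the number \<open>m\<close> of remaining iterations. In
    \<open>?K\<close>, the test costs \<open>1 + bcost ?b\<close>, the sequential composition 1 and
    the increment of the counter 4.\<close>
  have loop: "\<exists>t \<sigma>'. exec (Loop ?b ?c) \<sigma> t \<sigma>' \<and> t \<le> m * ?K + (1 + bcost ?b) \<and> I N \<sigma>'"
    if "I (N - m) \<sigma>" "regs \<sigma> i = N - m" "m \<le> N" for m \<sigma>
    using that
  proof (induction m arbitrary: \<sigma>)
    case 0
    then have "\<not> bval ?b \<sigma>" using bound by simp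
    then show ?case using 0 exec_Loop_false[of ?b \<sigma> ?c] by (intro exI conjI) auto
  next
    case (Suc m)
    let ?k = "N - Suc m"
    have k: "?k < N" "Suc ?k = N - m" using Suc.prems by auto
    have b: "bval ?b \<sigma>" using bound[OF Suc.prems(1)] Suc.prems k by simp
    obtain t \<sigma>1 where 1: "exec c \<sigma> t \<sigma>1" "t \<le> weight c * M ^ depth c" "I (Suc ?k) \<sigma>1" "regs \<sigma>1 i = ?k"
      using body[OF k(1)] Suc.prems unfolding triple_def by blast
    define \<sigma>2 where "\<sigma>2 = \<sigma>1\<lparr>regs := (regs \<sigma>1)(i := Suc ?k)\<rparr>"
    have set: "exec (SetReg i (NAdd (NReg i) (NConst 1))) \<sigma>1 4 \<sigma>2"
      using exec_SetReg[of i "NAdd (NReg i) (NConst 1)" \<sigma>1] 1(4) by (simp add: \<sigma>2_def numeral_eq_Suc)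
    have "I (N - m) \<sigma>2" "regs \<sigma>2 i = N - m"
      using ins[OF 1(3)] k(2) by (simp_all add: \<sigma>2_def)
    with Suc.IH[of \<sigma>2] Suc.prems obtain t' \<sigma>' where
      2: "exec (Loop ?b ?c) \<sigma>2 t' \<sigma>'" "t' \<le> m * ?K + (1 + bcost ?b)" "I N \<sigma>'" by auto
    have "exec (Loop ?b ?c) \<sigma> (1 + bcost ?b + (1 + t + 4) + t') \<sigma>'"
      by (rule exec_Loop_true[OF b exec_Then[OF 1(1) set] 2(1)])
    moreover have "1 + bcost ?b + (1 + t + 4) + t' \<le> Suc m * ?K + (1 + bcost ?b)"
      using 1(2) 2(2) by simp
    ultimately show ?case using 2(3) by blast
  qed
  show ?thesis
    unfolding triple_def
  proof (intro allI impI)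
    fix \<sigma> assume "I 0 \<sigma>"
    then have "I (N - N) (\<sigma>\<lparr>regs := (regs \<sigma>)(i := 0)\<rparr>)" using ins by simp
    from loop[OF this] obtain t \<sigma>' where
      1: "exec (Loop ?b ?c) (\<sigma>\<lparr>regs := (regs \<sigma>)(i := 0)\<rparr>) t \<sigma>'"
        "t \<le> N * ?K + (1 + bcost ?b)" "I N \<sigma>'" by auto
    have set: "exec (SetReg i (NConst 0)) \<sigma> 2 (\<sigma>\<lparr>regs := (regs \<sigma>)(i := 0)\<rparr>)"
      using exec_SetReg[of i "NConst 0" \<sigma>] by (simp add: numeral_eq_Suc)
    have M: "1 \<le> M ^ depth c" "1 \<le> M * M ^ depth c" "M \<le> M * M ^ depth c" using assms(2) by auto
    have "N * ?K \<le> M * ?K" using assms(1) by simp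
    also have "M * ?K = M * (6 + bcost ?b) + weight c * (M * M ^ depth c)"
      by (simp add: algebra_simps)
    also have "\<dots> \<le> (6 + bcost ?b) * (M * M ^ depth c) + weight c * (M * M ^ depth c)"
      using mult_le_mono2[OF M(3), of "6 + bcost ?b"] by (simp add: mult.commute)
    finally have "1 + 2 + t \<le> 3 + (6 + bcost ?b) * (M * M ^ depth c) + weight c * (M * M ^ depth c) + (1 + bcost ?b)"
      using 1(2) by simp
    also have "\<dots> \<le> 3 * (M * M ^ depth c) + (6 + bcost ?b) * (M * M ^ depth c)
        + weight c * (M * M ^ depth c) + (1 + bcost ?b) * (M * M ^ depth c)"
      by (intro add_mono order_refl mult_le_mono2[OF M(2), unfolded mult_1_right])
    also have "\<dots> = (10 + 2 * bcost ?b + weight c) * (M * M ^ depth c)"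
      by (simp add: algebra_simps)
    also have "\<dots> = weight (For i bd c) * M ^ depth (For i bd c)"
      by (simp only: weight_For depth_For power_Suc)
    finally show "\<exists>t \<sigma>'. exec (For i bd c) \<sigma> t \<sigma>' \<and> t \<le> weight (For i bd c) * M ^ depth (For i bd c) \<and> I N \<sigma>'"
      using exec_Then[OF set 1(1)] 1(3) unfolding For_def by blast
  qed
qed

section \<open>Variables that a program can change\<close>

fun written_regs :: "program \<Rightarrow> string set" where
  "written_regs (SetReg x a) = {x}"
| "written_regs (Then c1 c2) = written_regs c1 \<union> written_regs c2"
| "written_regs (Cond b c1 c2) = written_regs c1 \<union> written_regs c2"
| "written_regs (Loop b c) = written_regs c"
| "written_regs _ = {}"

fun written_arrays :: "program \<Rightarrow> string set" where
  "written_arrays (Write A i e) = {A}"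
| "written_arrays (Then c1 c2) = written_arrays c1 \<union> written_arrays c2"
| "written_arrays (Cond b c1 c2) = written_arrays c1 \<union> written_arrays c2"
| "written_arrays (Loop b c) = written_arrays c"
| "written_arrays _ = {}"

definition agree :: "program \<Rightarrow> machine_state \<Rightarrow> machine_state \<Rightarrow> bool" where
  "agree c \<sigma> \<sigma>' \<longleftrightarrow> (\<forall>x. x \<notin> written_regs c \<longrightarrow> regs \<sigma>' x = regs \<sigma> x) \<and>
     (\<forall>A. A \<notin> written_arrays c \<longrightarrow> arrays \<sigma>' A = arrays \<sigma> A)"

lemma exec_agree: "exec c \<sigma> t \<sigma>' \<Longrightarrow> agree c \<sigma> \<sigma>'"
  by (induction rule: exec.induct) (auto simp: agree_def)

lemma written_For [simp]:
  "written_regs (For i bd c) = insert i (written_regs c)"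
  "written_arrays (For i bd c) = written_arrays c"
  by (auto simp: For_def)

definition frame :: "program \<Rightarrow> (machine_state \<Rightarrow> bool) \<Rightarrow> bool" where
  "frame c F \<longleftrightarrow> (\<forall>\<sigma> \<sigma>'. agree c \<sigma> \<sigma>' \<longrightarrow> F \<sigma> \<longrightarrow> F \<sigma>')"

text \<open>A frame rule based on the variables written in the program text. It lets each component
  be specified by what it computes alone, while facts about the remaining memory are carried
  along.\<close>

lemma triple_frame:
  assumes "triple M P c Q" "frame c F"
  shows "triple M (\<lambda>\<sigma>. F \<sigma> \<and> P \<sigma>) c (\<lambda>\<sigma>. F \<sigma> \<and> Q \<sigma>)"
  using assms exec_agree unfolding triple_def frame_def by blast

lemma frame_conj: "frame c F \<Longrightarrow> frame c G \<Longrightarrow> frame c (\<lambda>\<sigma>. F \<sigma> \<and> G \<sigma>)"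
  by (auto simp: frame_def)

text \<open>Symbolic execution turns a conditional write into one array update whose value is an
  \<open>if\<close>, so consecutive conditional writes do not multiply the cases.\<close>

definition When :: "bexp \<Rightarrow> string \<Rightarrow> nexp \<Rightarrow> rexp \<Rightarrow> program" where
  "When b A i e = Cond b (Write A i e) Nop"

lemma When_simps [simp]:
  "depth (When b A i e) = 0" "written_regs (When b A i e) = {}" "written_arrays (When b A i e) = {A}"
  by (simp_all add: When_def)

lemma run_When [simp]:
  "run (When b A i e) \<sigma> = \<sigma>\<lparr>arrays := (arrays \<sigma>)(A := (arrays \<sigma> A)
     (nval i \<sigma> := if bval b \<sigma> then rval e \<sigma> else arrays \<sigma> A (nval i \<sigma>)))\<rparr>"
  by (simp_all add: When_def)

fun block :: "program list \<Rightarrow> program" where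
  "block [] = Nop"
| "block (c # cs) = Then c (block cs)"

lemma run_agree: "agree c \<sigma> (run c \<sigma>)"
proof (induction c arbitrary: \<sigma>)
  case (Then c1 c2)
  then show ?case unfolding agree_def by simp
qed (auto simp: agree_def)

lemma triple_Cond:
  assumes "triple M (\<lambda>\<sigma>. P \<sigma> \<and> bval b \<sigma>) c1 Q" "triple M (\<lambda>\<sigma>. P \<sigma> \<and> \<not> bval b \<sigma>) c2 Q" "1 \<le> M"
  shows "triple M P (Cond b c1 c2) Q"
  unfolding triple_def
proof (intro allI impI)
  fix \<sigma> assume P: "P \<sigma>"
  let ?D = "depth (Cond b c1 c2)"
  let ?c = "if bval b \<sigma> then c1 else c2"
  obtain t \<sigma>' where 1: "exec ?c \<sigma> t \<sigma>'" "t \<le> weight ?c * M ^ depth ?c" "Q \<sigma>'"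
    using assms(1,2) P unfolding triple_def by (cases "bval b \<sigma>") auto
  have "M ^ depth ?c \<le> M ^ ?D" "1 \<le> M ^ ?D"
    using assms(3) by (auto intro!: power_increasing)
  then have "t \<le> weight ?c * M ^ ?D" using 1(2) by (meson mult_le_mono2 order_trans)
  moreover have "1 + bcost b \<le> (1 + bcost b) * M ^ ?D"
    using mult_le_mono2[OF \<open>1 \<le> M ^ ?D\<close>, of "1 + bcost b"] by simp
  moreover have "(1 + bcost b) * M ^ ?D + weight ?c * M ^ ?D \<le> weight (Cond b c1 c2) * M ^ ?D"
    unfolding distrib_right[symmetric] by (intro mult_le_mono1) simp
  ultimately have "1 + bcost b + t \<le> weight (Cond b c1 c2) * M ^ ?D" by linarith
  moreover have "exec (Cond b c1 c2) \<sigma> (1 + bcost b + t) \<sigma>'"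
    using 1(1) exec_Cond_true exec_Cond_false by (cases "bval b \<sigma>") auto
  ultimately show "\<exists>t \<sigma>'. exec (Cond b c1 c2) \<sigma> t \<sigma>' \<and> t \<le> weight (Cond b c1 c2) * M ^ ?D \<and> Q \<sigma>'"
    using 1(3) by blast
qed

lemma disjoint_agree:
  assumes "agree c \<sigma> \<sigma>'"
  shows "written_regs c \<inter> R = {} \<Longrightarrow> x \<in> R \<Longrightarrow> regs \<sigma>' x = regs \<sigma> x"
    and "written_arrays c \<inter> S = {} \<Longrightarrow> A \<in> S \<Longrightarrow> arrays \<sigma>' A = arrays \<sigma> A"
  using assms by (auto simp: agree_def)



section \<open>The program\<close>

abbreviation cell :: "string \<Rightarrow> rexp" where
  "cell A \<equiv> RRead A (NConst 0)"

abbreviation next_of :: "string \<Rightarrow> nexp" where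
  "next_of i \<equiv> NAdd (NReg i) (NConst 1)"

fun offset_exp :: "pad \<Rightarrow> nexp" where
  "offset_exp Pad1 = NConst 0"
| "offset_exp Pad2 = NReg ''n1''"

fun num_exp :: "pad \<Rightarrow> nexp" where
  "num_exp Pad1 = NReg ''n1''"
| "num_exp Pad2 = NSub (NReg ''n'') (NReg ''n1'')"

definition set_pads :: "pad \<Rightarrow> program" where
  "set_pads p = block
     [SetReg ''op'' (offset_exp p), SetReg ''np'' (num_exp p),
      SetReg ''oq'' (offset_exp (other_pad p)), SetReg ''nq'' (num_exp (other_pad p)),
      Write ''k'' (NConst 0) (RSub (RConst 1) (RDiv (RConst 1) (cell ''s'')))]"

text \<open>Index 0 and the index after the last stockpile receive the default values of
  \<open>left_at\<close> and \<open>right_at\<close>, so reading at \<open>a + 1\<close> or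
  \<open>b + 1\<close> always finds a meaningful entry.\<close>

definition load_pad :: "string \<Rightarrow> string \<Rightarrow> string \<Rightarrow> string \<Rightarrow> string \<Rightarrow> program" where
  "load_pad l r w off m = block
     [Write l (NConst 0) (cell ''L''), Write r (NConst 0) (RConst 0), Write w (NConst 0) (RConst 0),
      For ''i'' (NReg m) (block
        [Write l (next_of ''i'') (RRead ''l'' (NAdd (NReg off) (next_of ''i''))),
         Write r (next_of ''i'') (RRead ''r'' (NAdd (NReg off) (next_of ''i''))),
         Write w (next_of ''i'') (RAdd (RRead w (NReg ''i''))
           (RSub (RRead r (next_of ''i'')) (RRead l (next_of ''i''))))]),
      Write l (next_of m) (cell ''L''), Write r (next_of m) (RConst 0)]"

text \<open>The machine has neither minimum nor maximum; two conditional writes to the scratch cell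
  \<open>t\<close> compute the clamp. The coefficient \<open>c\<close> is 1, 0 or -1, so the flags
  \<open>u\<close> and \<open>v\<close> act by multiplication.\<close>

definition add_clamp :: "int \<Rightarrow> string \<Rightarrow> nexp \<Rightarrow> rexp \<Rightarrow> rexp \<Rightarrow> rexp \<Rightarrow> program" where
  "add_clamp c dest i z l r = block
     [Write ''t'' (NConst 0) z, When (RLess r (cell ''t'')) ''t'' (NConst 0) r,
      Write ''t'' (NConst 0) (RSub (cell ''t'') l),
      When (RLess (cell ''t'') (RConst 0)) ''t'' (NConst 0) (RConst 0),
      Write dest i (RAdd (RRead dest i) (RMul (RConst c) (cell ''t'')))]"

text \<open>Each of the linearly many values is summed up from scratch in linear time. The quadratic
  bound affords this, and the ends of the two pads need not be merged into one order.\<close>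

definition gain_table :: "bool \<Rightarrow> bool \<Rightarrow> string \<Rightarrow> string \<Rightarrow> string \<Rightarrow> program" where
  "gain_table u v dest x m =
     For ''i'' (NAdd (NReg m) (NConst 2)) (block
       [Write dest (NReg ''i'') (RConst 0),
        For ''j'' (NReg ''nq'') (add_clamp (of_bool v) dest (NReg ''i'') (RRead x (NReg ''i''))
          (RRead ''lq'' (next_of ''j'')) (RRead ''rq'' (next_of ''j''))),
        For ''j'' (NReg ''np'') (add_clamp (- of_bool u) dest (NReg ''i'') (RRead x (NReg ''i''))
          (RRead ''lp'' (next_of ''j'')) (RRead ''rp'' (next_of ''j'')))])"

definition prepare :: "pad \<Rightarrow> bool \<Rightarrow> bool \<Rightarrow> program" where
  "prepare p u v = block
     [set_pads p, load_pad ''lp'' ''rp'' ''wp'' ''op'' ''np'', load_pad ''lq'' ''rq'' ''wq'' ''oq'' ''nq'',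
      gain_table u v ''glp'' ''lp'' ''np'', gain_table u v ''grp'' ''rp'' ''np'',
      gain_table u v ''glq'' ''lq'' ''nq'', gain_table u v ''grq'' ''rq'' ''nq'']"

section \<open>Correctness of the tables\<close>

context yard
begin

text \<open>Common bound on the iterations of all loops. The longest ones fill a table with indices
  from 0 to \<open>pile_num Y p + 1\<close>.\<close>

abbreviation "M \<equiv> num Y + 2"

definition inputs :: "machine_state \<Rightarrow> bool" where
  "inputs \<sigma> \<longleftrightarrow> regs \<sigma> ''n'' = num Y \<and> regs \<sigma> ''n1'' = num1 Y \<and>
     arrays \<sigma> ''L'' 0 = pad_length Y \<and> arrays \<sigma> ''s'' 0 = speed Y \<and>
     (\<forall>j\<in>{1..num Y}. arrays \<sigma> ''l'' j = left_end Y j \<and> arrays \<sigma> ''r'' j = right_end Y j)"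

definition pads_set :: "pad \<Rightarrow> machine_state \<Rightarrow> bool" where
  "pads_set p \<sigma> \<longleftrightarrow> regs \<sigma> ''op'' = offset Y p \<and> regs \<sigma> ''np'' = pile_num Y p \<and>
     regs \<sigma> ''oq'' = offset Y (other_pad p) \<and> regs \<sigma> ''nq'' = pile_num Y (other_pad p) \<and>
     arrays \<sigma> ''k'' 0 = \<kappa>"

definition pad_loaded :: "string \<Rightarrow> string \<Rightarrow> string \<Rightarrow> pad \<Rightarrow> machine_state \<Rightarrow> bool" where
  "pad_loaded l r w p \<sigma> \<longleftrightarrow> (\<forall>i\<le>pile_num Y p + 1. arrays \<sigma> l i = left_at Y p i \<and> arrays \<sigma> r i = right_at Y p i) \<and>
     (\<forall>i\<le>pile_num Y p. arrays \<sigma> w i = prefix_work Y p i)"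

definition loaded :: "pad \<Rightarrow> machine_state \<Rightarrow> bool" where
  "loaded p \<sigma> \<longleftrightarrow> inputs \<sigma> \<and> pads_set p \<sigma> \<and> pad_loaded ''lp'' ''rp'' ''wp'' p \<sigma> \<and>
     pad_loaded ''lq'' ''rq'' ''wq'' (other_pad p) \<sigma>"

definition tabled :: "pad \<Rightarrow> bool \<Rightarrow> bool \<Rightarrow> machine_state \<Rightarrow> bool" where
  "tabled p u v \<sigma> \<longleftrightarrow> loaded p \<sigma> \<and>
     (\<forall>i\<le>pile_num Y p + 1. arrays \<sigma> ''glp'' i = gain Y p u v (left_at Y p i)) \<and>
     (\<forall>i\<le>pile_num Y p + 1. arrays \<sigma> ''grp'' i = gain Y p u v (right_at Y p i)) \<and>
     (\<forall>i\<le>pile_num Y (other_pad p) + 1. arrays \<sigma> ''glq'' i = gain Y p u v (left_at Y (other_pad p) i)) \<and>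
     (\<forall>i\<le>pile_num Y (other_pad p) + 1. arrays \<sigma> ''grq'' i = gain Y p u v (right_at Y (other_pad p) i))"

lemma M_pos: "1 \<le> M"
  by simp

lemma triple_block:
  assumes "triple M P c R" "triple M R (block cs) Q"
  shows "triple M P (block (c # cs)) Q"
  using triple_Then[OF assms M_pos] by simp

lemma triple_block_Nil: "triple M P (block []) P"
  by (rule triple_run) simp_all

lemma pile_num_le: "pile_num Y p + 2 \<le> M"
  using num1_le by (cases p) auto

lemma pile_in: "i < pile_num Y p \<Longrightarrow> offset Y p + Suc i \<in> {1..num Y}"
  using in_stockpiles[of "Suc i" p] stockpiles_sub[of p] by auto

lemma set_pads_triple: "triple M inputs (set_pads p) (pads_set p)"
proof (rule triple_run)
  show "depth (set_pads p) = 0" by (cases p) (simp_all add: set_pads_def)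
  show "pads_set p (run (set_pads p) \<sigma>)" if "inputs \<sigma>" for \<sigma>
    using that by (cases p) (simp_all add: set_pads_def pads_set_def inputs_def)
qed

lemma prefix_work_Suc: "prefix_work Y p (Suc i) = prefix_work Y p i + (right_at Y p (Suc i) - left_at Y p (Suc i))"
  by (simp add: prefix_work_def)

lemma load_pad_triple:
  assumes dist: "distinct [l, r, w, ''l'', ''r'', ''L'', ''s'']" and "off \<noteq> ''i''" "m \<noteq> ''i''"
  shows "triple M (\<lambda>\<sigma>. inputs \<sigma> \<and> regs \<sigma> off = offset Y p \<and> regs \<sigma> m = pile_num Y p)
    (load_pad l r w off m) (pad_loaded l r w p)"
proof -
  have ne:
    "l \<noteq> r" "l \<noteq> w" "l \<noteq> ''l''" "''l'' \<noteq> l" "l \<noteq> ''r''"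
    "''r'' \<noteq> l" "l \<noteq> ''L''" "''L'' \<noteq> l" "l \<noteq> ''s''" "''s'' \<noteq> l"
    "r \<noteq> l" "r \<noteq> w" "r \<noteq> ''l''" "''l'' \<noteq> r" "r \<noteq> ''r''"
    "''r'' \<noteq> r" "r \<noteq> ''L''" "''L'' \<noteq> r" "r \<noteq> ''s''" "''s'' \<noteq> r"
    "w \<noteq> l" "w \<noteq> r" "w \<noteq> ''l''" "''l'' \<noteq> w" "w \<noteq> ''r''"
    "''r'' \<noteq> w" "w \<noteq> ''L''" "''L'' \<noteq> w" "w \<noteq> ''s''" "''s'' \<noteq> w"
    using dist by auto
  define I where "I k \<sigma> \<longleftrightarrow> (\<forall>j\<in>{1..num Y}. arrays \<sigma> ''l'' j = left_end Y j \<and> arrays \<sigma> ''r'' j = right_end Y j) \<and>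
    arrays \<sigma> ''L'' 0 = pad_length Y \<and> regs \<sigma> off = offset Y p \<and> regs \<sigma> m = pile_num Y p \<and>
    (\<forall>i\<le>k. arrays \<sigma> l i = left_at Y p i \<and> arrays \<sigma> r i = right_at Y p i \<and> arrays \<sigma> w i = prefix_work Y p i)"
    for k and \<sigma> :: machine_state
  let ?body = "block [Write l (next_of ''i'') (RRead ''l'' (NAdd (NReg off) (next_of ''i''))),
         Write r (next_of ''i'') (RRead ''r'' (NAdd (NReg off) (next_of ''i''))),
         Write w (next_of ''i'') (RAdd (RRead w (NReg ''i''))
           (RSub (RRead r (next_of ''i'')) (RRead l (next_of ''i''))))]"
  let ?P = "\<lambda>\<sigma>. inputs \<sigma> \<and> regs \<sigma> off = offset Y p \<and> regs \<sigma> m = pile_num Y p"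
  have i1: "triple M ?P (Write l (NConst 0) (cell ''L''))
     (\<lambda>\<sigma>. ?P \<sigma> \<and> arrays \<sigma> l 0 = left_at Y p 0)"
    by (rule triple_run) (simp_all add: ne inputs_def left_at_def)
  have i2: "triple M (\<lambda>\<sigma>. ?P \<sigma> \<and> arrays \<sigma> l 0 = left_at Y p 0) (Write r (NConst 0) (RConst 0))
     (\<lambda>\<sigma>. ?P \<sigma> \<and> arrays \<sigma> l 0 = left_at Y p 0 \<and> arrays \<sigma> r 0 = right_at Y p 0)"
    by (rule triple_run) (simp_all add: ne inputs_def right_at_def)
  have i3: "triple M (\<lambda>\<sigma>. ?P \<sigma> \<and> arrays \<sigma> l 0 = left_at Y p 0 \<and> arrays \<sigma> r 0 = right_at Y p 0)
     (Write w (NConst 0) (RConst 0)) (I 0)"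
    by (rule triple_run) (simp_all add: ne inputs_def I_def prefix_work_def)
  have body: "triple M (\<lambda>\<sigma>. I k \<sigma> \<and> regs \<sigma> ''i'' = k) ?body (\<lambda>\<sigma>. I (Suc k) \<sigma> \<and> regs \<sigma> ''i'' = k)"
    if "k < pile_num Y p" for k
  proof (rule triple_run)
    fix \<sigma> assume I: "I k \<sigma> \<and> regs \<sigma> ''i'' = k"
    have "arrays \<sigma> ''l'' (offset Y p + Suc k) = left_at Y p (Suc k)"
      "arrays \<sigma> ''r'' (offset Y p + Suc k) = right_at Y p (Suc k)"
      using I pile_in[OF that] that by (auto simp: I_def left_at_def right_at_def)
    then show "I (Suc k) (run ?body \<sigma>) \<and> regs (run ?body \<sigma>) ''i'' = k"
      using I assms(2,3) by (auto simp: ne I_def le_Suc_eq prefix_work_Suc)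
  qed simp
  have loop: "triple M (I 0) (For ''i'' (NReg m) ?body) (I (pile_num Y p))"
    by (rule triple_For[OF _ M_pos _ body])
      (use pile_num_le[of p] assms(2,3) in \<open>simp_all add: I_def\<close>)
  have e1: "triple M (I (pile_num Y p)) (Write l (next_of m) (cell ''L''))
     (\<lambda>\<sigma>. I (pile_num Y p) \<sigma> \<and> arrays \<sigma> l (pile_num Y p + 1) = left_at Y p (pile_num Y p + 1))"
    by (rule triple_run) (simp_all add: ne I_def left_at_def)
  have e2: "triple M (\<lambda>\<sigma>. I (pile_num Y p) \<sigma> \<and> arrays \<sigma> l (pile_num Y p + 1) = left_at Y p (pile_num Y p + 1))
    (Write r (next_of m) (RConst 0)) (pad_loaded l r w p)"
    by (rule triple_run) (auto simp: ne I_def pad_loaded_def le_Suc_eq right_at_def)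
  show ?thesis
    unfolding load_pad_def
    by (rule triple_block[OF i1 triple_block[OF i2 triple_block[OF i3 triple_block[OF loop
      triple_block[OF e1 triple_block[OF e2 triple_block_Nil]]]]]])
qed

lemma if_max: "(if x < y then y else x) = max x (y :: real)"
  and if_min: "(if y < x then y else x) = min x (y :: real)"
  and if_diff: "(if x < y then 0 else x - y) = max 0 (x - y :: real)"
  by auto

lemma run_add_clamp:
  assumes "dest \<noteq> ''t''"
    and "\<And>x. rval l (\<sigma>\<lparr>arrays := (arrays \<sigma>)(''t'' := x)\<rparr>) = rval l \<sigma>"
    and "\<And>x. rval r (\<sigma>\<lparr>arrays := (arrays \<sigma>)(''t'' := x)\<rparr>) = rval r \<sigma>"
  shows "depth (add_clamp c dest (NReg i) z l r) = 0"
    and "run (add_clamp c dest (NReg i) z l r) \<sigma> = \<sigma>\<lparr>arrays := (arrays \<sigma>)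
      (''t'' := (arrays \<sigma> ''t'')(0 := clamp (rval l \<sigma>) (rval r \<sigma>) (rval z \<sigma>)),
       dest := (arrays \<sigma> dest)(regs \<sigma> i := arrays \<sigma> dest (regs \<sigma> i) + c * clamp (rval l \<sigma>) (rval r \<sigma>) (rval z \<sigma>)))\<rparr>"
  using assms
  by (simp_all add: add_clamp_def if_max if_min if_diff clamp_def max.commute min.commute fun_upd_twist[of dest "''t''"]
      cong: if_cong)

lemma loaded_upd_array:
  fixes \<sigma> :: machine_state
  assumes "A \<notin> {''lp'', ''rp'', ''wp'', ''lq'', ''rq'', ''wq'', ''l'', ''r'', ''L'', ''s'', ''k''}"
  shows "loaded p (\<sigma>\<lparr>arrays := (arrays \<sigma>)(A := f)\<rparr>) = loaded p \<sigma>"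
proof -
  have "\<forall>B\<in>{''lp'', ''rp'', ''wp'', ''lq'', ''rq'', ''wq'', ''l'', ''r'', ''L'', ''s'', ''k''}. B \<noteq> A" using assms by blast
  then show ?thesis by (simp add: loaded_def inputs_def pads_set_def pad_loaded_def)
qed

lemma loaded_upd_reg:
  fixes \<sigma> :: machine_state
  assumes "x \<notin> {''n'', ''n1'', ''op'', ''np'', ''oq'', ''nq''}"
  shows "loaded p (\<sigma>\<lparr>regs := (regs \<sigma>)(x := k)\<rparr>) = loaded p \<sigma>"
proof -
  have "\<forall>y\<in>{''n'', ''n1'', ''op'', ''np'', ''oq'', ''nq''}. y \<noteq> x" using assms by blast
  then show ?thesis by (simp add: loaded_def inputs_def pads_set_def pad_loaded_def)
qed

lemma gain_table_triple:
  assumes dest: "dest \<notin> {''t'', ''lp'', ''rp'', ''wp'', ''lq'', ''rq'', ''wq'', ''l'', ''r'', ''L'', ''s'', ''k''}"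
    and x: "x \<noteq> dest" "dest \<noteq> x" "x \<noteq> ''t''"
    and tab: "\<And>\<sigma>. loaded p \<sigma> \<Longrightarrow> regs \<sigma> m = pile_num Y o' \<and> (\<forall>i\<le>pile_num Y o' + 1. arrays \<sigma> x i = X i)"
  shows "triple M (loaded p) (gain_table u v dest x m)
    (\<lambda>\<sigma>. loaded p \<sigma> \<and> (\<forall>i\<le>pile_num Y o' + 1. arrays \<sigma> dest i = gain Y p u v (X i)))"
proof -
  \<comment> \<open>Entries below \<open>k\<close> are final, and entry \<open>k\<close> holds the
    partial sum \<open>a\<close>. The two inner loops are instances of one claim that differ in the
    coefficient and the pad.\<close>
  define R where "R k a \<sigma> \<longleftrightarrow> loaded p \<sigma> \<and> regs \<sigma> ''i'' = k \<and>
    (\<forall>i<k. arrays \<sigma> dest i = gain Y p u v (X i)) \<and> arrays \<sigma> dest k = a"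
    for k and a :: real and \<sigma> :: machine_state
  have ne: "dest \<noteq> ''t''" "''t'' \<noteq> dest" using dest by auto
  have inner: "triple M (R k a) (For ''j'' (NReg nr) (add_clamp c dest (NReg ''i'') (RRead x (NReg ''i''))
      (RRead la (next_of ''j'')) (RRead ra (next_of ''j'')))) (R k (a + c * work Y r (X k)))"
    if k: "k < pile_num Y o' + 2" and nr: "nr \<noteq> ''i''" "nr \<noteq> ''j''" and la: "la \<noteq> ''t''" "ra \<noteq> ''t''"
      and r: "\<And>\<sigma>. loaded p \<sigma> \<Longrightarrow> regs \<sigma> nr = pile_num Y r \<and> (\<forall>i\<le>pile_num Y r + 1. arrays \<sigma> la i = left_at Y r i
        \<and> arrays \<sigma> ra i = right_at Y r i)"
    for k c a r nr la ra
  proof -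
    define I where "I j \<sigma> \<longleftrightarrow> R k (a + c * (\<Sum>i=1..j. clamp (left_at Y r i) (right_at Y r i) (X k))) \<sigma>"
      for j and \<sigma> :: machine_state
    have "triple M (I 0) (For ''j'' (NReg nr) (add_clamp c dest (NReg ''i'') (RRead x (NReg ''i''))
      (RRead la (next_of ''j'')) (RRead ra (next_of ''j'')))) (I (pile_num Y r))"
    proof (rule triple_For)
      show "pile_num Y r \<le> M" using pile_num_le[of r] by simp
      show "1 \<le> M" by simp
      show "nval (NReg nr) \<sigma> = pile_num Y r" if "I j \<sigma>" for j \<sigma>
        using that r by (simp add: I_def R_def)
      show "I j (\<sigma>\<lparr>regs := (regs \<sigma>)(''j'' := i)\<rparr>)" if "I j \<sigma>" for j i \<sigma>
        using that by (simp add: I_def R_def loaded_upd_reg)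
      fix j assume j: "j < pile_num Y r"
      show "triple M (\<lambda>\<sigma>. I j \<sigma> \<and> regs \<sigma> ''j'' = j) (add_clamp c dest (NReg ''i'') (RRead x (NReg ''i''))
        (RRead la (next_of ''j'')) (RRead ra (next_of ''j''))) (\<lambda>\<sigma>. I (Suc j) \<sigma> \<and> regs \<sigma> ''j'' = j)"
      proof (rule triple_run)
        show "depth (add_clamp c dest (NReg ''i'') (RRead x (NReg ''i'')) (RRead la (next_of ''j'')) (RRead ra (next_of ''j''))) = 0"
          using run_add_clamp(1) ne la by simp
        fix \<sigma> assume I: "I j \<sigma> \<and> regs \<sigma> ''j'' = j"
        then have ld: "loaded p \<sigma>" and i: "regs \<sigma> ''i'' = k" by (auto simp: I_def R_def)
        have vals: "arrays \<sigma> la (Suc j) = left_at Y r (Suc j)" "arrays \<sigma> ra (Suc j) = right_at Y r (Suc j)"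
          "arrays \<sigma> x k = X k"
          using r[OF ld] tab[OF ld] j k by auto
        show "I (Suc j) (run (add_clamp c dest (NReg ''i'') (RRead x (NReg ''i'')) (RRead la (next_of ''j''))
            (RRead ra (next_of ''j''))) \<sigma>) \<and> regs (run (add_clamp c dest (NReg ''i'') (RRead x (NReg ''i''))
            (RRead la (next_of ''j'')) (RRead ra (next_of ''j''))) \<sigma>) ''j'' = j"
        proof -
          have "loaded p (\<sigma>\<lparr>arrays := (arrays \<sigma>)(''t'' := f, dest := g)\<rparr>)" for f g
            using ld loaded_upd_array[of dest p "\<sigma>\<lparr>arrays := (arrays \<sigma>)(''t'' := f)\<rparr>" g]
              loaded_upd_array[of "''t''" p \<sigma> f] dest by simp
          then show ?thesis
            using I i vals by (subst (1 2) run_add_clamp(2)) (simp_all add: ne la I_def R_def distrib_left)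
        qed
      qed
    qed
    moreover have "I 0 = R k a" "I (pile_num Y r) = R k (a + c * work Y r (X k))"
      by (rule ext, simp add: I_def work_def)+
    ultimately show ?thesis by (simp only:)
  qed
  define K where "K k \<sigma> \<longleftrightarrow> loaded p \<sigma> \<and> (\<forall>i<k. arrays \<sigma> dest i = gain Y p u v (X i))"
    for k and \<sigma> :: machine_state
  have "triple M (K 0) (gain_table u v dest x m) (K (pile_num Y o' + 2))"
    unfolding gain_table_def
  proof (rule triple_For)
    show "pile_num Y o' + 2 \<le> M" "1 \<le> M" using pile_num_le[of o'] by simp_all
    show "nval (NAdd (NReg m) (NConst 2)) \<sigma> = pile_num Y o' + 2" if "K k \<sigma>" for k \<sigma>
      using that tab by (simp add: K_def)
    show "K k (\<sigma>\<lparr>regs := (regs \<sigma>)(''i'' := j)\<rparr>)" if "K k \<sigma>" for k j \<sigma>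
      using that by (simp add: K_def loaded_upd_reg)
    fix k assume k: "k < pile_num Y o' + 2"
    have 1: "triple M (\<lambda>\<sigma>. K k \<sigma> \<and> regs \<sigma> ''i'' = k) (Write dest (NReg ''i'') (RConst 0)) (R k 0)"
      by (rule triple_run) (use dest in \<open>simp_all add: K_def R_def loaded_upd_array\<close>)
    have 2: "triple M (R k 0) (For ''j'' (NReg ''nq'') (add_clamp (of_bool v) dest (NReg ''i'') (RRead x (NReg ''i''))
          (RRead ''lq'' (next_of ''j'')) (RRead ''rq'' (next_of ''j''))))
        (R k (0 + of_int (of_bool v) * work Y (other_pad p) (X k)))"
      by (rule inner[OF k]) (simp_all add: loaded_def pads_set_def pad_loaded_def)
    have 3: "triple M (R k (0 + of_int (of_bool v) * work Y (other_pad p) (X k))) (For ''j'' (NReg ''np'')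
          (add_clamp (- of_bool u) dest (NReg ''i'') (RRead x (NReg ''i''))
          (RRead ''lp'' (next_of ''j'')) (RRead ''rp'' (next_of ''j''))))
        (R k (0 + of_int (of_bool v) * work Y (other_pad p) (X k) + of_int (- of_bool u) * work Y p (X k)))"
      by (rule inner[OF k]) (simp_all add: loaded_def pads_set_def pad_loaded_def)
    have 4: "K (Suc k) \<sigma> \<and> regs \<sigma> ''i'' = k"
      if "R k (0 + of_int (of_bool v) * work Y (other_pad p) (X k) + of_int (- of_bool u) * work Y p (X k)) \<sigma>" for \<sigma>
      using that by (auto simp: K_def R_def gain_def less_Suc_eq)
    show "triple M (\<lambda>\<sigma>. K k \<sigma> \<and> regs \<sigma> ''i'' = k) (block
       [Write dest (NReg ''i'') (RConst 0),
        For ''j'' (NReg ''nq'') (add_clamp (of_bool v) dest (NReg ''i'') (RRead x (NReg ''i''))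
          (RRead ''lq'' (next_of ''j'')) (RRead ''rq'' (next_of ''j''))),
        For ''j'' (NReg ''np'') (add_clamp (- of_bool u) dest (NReg ''i'') (RRead x (NReg ''i''))
          (RRead ''lp'' (next_of ''j'')) (RRead ''rp'' (next_of ''j'')))])
        (\<lambda>\<sigma>. K (Suc k) \<sigma> \<and> regs \<sigma> ''i'' = k)"
      by (rule triple_weaken[OF triple_block[OF 1 triple_block[OF 2 triple_block[OF 3 triple_block_Nil]]] _ 4])
  qed
  then show ?thesis by (rule triple_weaken) (auto simp: K_def)
qed

lemma written_gain_table [simp]:
  "written_regs (gain_table u v dest x m) = {''i'', ''j''}"
  "written_arrays (gain_table u v dest x m) = {dest, ''t''}"
  by (auto simp: gain_table_def add_clamp_def)

lemma written_load_pad [simp]: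
  "written_regs (load_pad l r w off m) = {''i''}"
  "written_arrays (load_pad l r w off m) = {l, r, w}"
  by (auto simp: load_pad_def)

lemma written_set_pads [simp]:
  "written_regs (set_pads p) = {''op'', ''np'', ''oq'', ''nq''}"
  "written_arrays (set_pads p) = {''k''}"
  by (auto simp: set_pads_def)

lemma prepare_triple: "triple M inputs (prepare p u v) (tabled p u v)"
proof -
  let ?q = "other_pad p"
  let ?T = "\<lambda>d r f \<sigma>. \<forall>i\<le>pile_num Y r + 1. arrays \<sigma> d i = gain Y p u v (f Y r i)"
  have 1: "triple M (\<lambda>\<sigma>. inputs \<sigma> \<and> inputs \<sigma>) (set_pads p) (\<lambda>\<sigma>. inputs \<sigma> \<and> pads_set p \<sigma>)"
    by (intro triple_frame set_pads_triple) (auto simp: frame_def agree_def inputs_def)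
  have 2: "triple M (\<lambda>\<sigma>. (inputs \<sigma> \<and> pads_set p \<sigma>) \<and> inputs \<sigma> \<and> regs \<sigma> ''op'' = offset Y p \<and> regs \<sigma> ''np'' = pile_num Y p)
      (load_pad ''lp'' ''rp'' ''wp'' ''op'' ''np'') (\<lambda>\<sigma>. (inputs \<sigma> \<and> pads_set p \<sigma>) \<and> pad_loaded ''lp'' ''rp'' ''wp'' p \<sigma>)"
    by (intro triple_frame load_pad_triple) (auto simp: frame_def agree_def inputs_def pads_set_def)
  have 3: "triple M (\<lambda>\<sigma>. (inputs \<sigma> \<and> pads_set p \<sigma> \<and> pad_loaded ''lp'' ''rp'' ''wp'' p \<sigma>) \<and>
       inputs \<sigma> \<and> regs \<sigma> ''oq'' = offset Y ?q \<and> regs \<sigma> ''nq'' = pile_num Y ?q)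
      (load_pad ''lq'' ''rq'' ''wq'' ''oq'' ''nq'')
      (\<lambda>\<sigma>. (inputs \<sigma> \<and> pads_set p \<sigma> \<and> pad_loaded ''lp'' ''rp'' ''wp'' p \<sigma>) \<and> pad_loaded ''lq'' ''rq'' ''wq'' ?q \<sigma>)"
    by (intro triple_frame load_pad_triple) (auto simp: frame_def agree_def inputs_def pads_set_def pad_loaded_def)
  have g1: "triple M (loaded p) (gain_table u v ''glp'' ''lp'' ''np'') (\<lambda>\<sigma>. loaded p \<sigma> \<and> ?T ''glp'' p left_at \<sigma>)"
    and g2: "triple M (loaded p) (gain_table u v ''grp'' ''rp'' ''np'') (\<lambda>\<sigma>. loaded p \<sigma> \<and> ?T ''grp'' p right_at \<sigma>)"
    and g3: "triple M (loaded p) (gain_table u v ''glq'' ''lq'' ''nq'') (\<lambda>\<sigma>. loaded p \<sigma> \<and> ?T ''glq'' ?q left_at \<sigma>)"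
    and g4: "triple M (loaded p) (gain_table u v ''grq'' ''rq'' ''nq'') (\<lambda>\<sigma>. loaded p \<sigma> \<and> ?T ''grq'' ?q right_at \<sigma>)"
    by (rule gain_table_triple; simp add: loaded_def pads_set_def pad_loaded_def)+
  have 5: "triple M (\<lambda>\<sigma>. ?T ''glp'' p left_at \<sigma> \<and> loaded p \<sigma>) (gain_table u v ''grp'' ''rp'' ''np'')
      (\<lambda>\<sigma>. ?T ''glp'' p left_at \<sigma> \<and> loaded p \<sigma> \<and> ?T ''grp'' p right_at \<sigma>)"
    by (intro triple_frame g2) (simp add: frame_def agree_def)
  have 6: "triple M (\<lambda>\<sigma>. (?T ''glp'' p left_at \<sigma> \<and> ?T ''grp'' p right_at \<sigma>) \<and> loaded p \<sigma>) (gain_table u v ''glq'' ''lq'' ''nq'')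
      (\<lambda>\<sigma>. (?T ''glp'' p left_at \<sigma> \<and> ?T ''grp'' p right_at \<sigma>) \<and> loaded p \<sigma> \<and> ?T ''glq'' ?q left_at \<sigma>)"
    by (intro triple_frame g3) (simp add: frame_def agree_def)
  have 7: "triple M (\<lambda>\<sigma>. (?T ''glp'' p left_at \<sigma> \<and> ?T ''grp'' p right_at \<sigma> \<and> ?T ''glq'' ?q left_at \<sigma>) \<and> loaded p \<sigma>)
      (gain_table u v ''grq'' ''rq'' ''nq'')
      (\<lambda>\<sigma>. (?T ''glp'' p left_at \<sigma> \<and> ?T ''grp'' p right_at \<sigma> \<and> ?T ''glq'' ?q left_at \<sigma>) \<and> loaded p \<sigma> \<and> ?T ''grq'' ?q right_at \<sigma>)"
    by (intro triple_frame g4) (simp add: frame_def agree_def)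
  show ?thesis
    unfolding prepare_def
    by (rule triple_block[OF triple_weaken[OF 1] triple_block[OF triple_weaken[OF 2] triple_block[OF triple_weaken[OF 3]
      triple_block[OF g1 triple_block[OF triple_weaken[OF 5] triple_block[OF triple_weaken[OF 6]
      triple_block[OF triple_weaken[OF 7] triple_block_Nil]]]]]]])
      (auto simp: loaded_def pads_set_def tabled_def)
qed

end

section \<open>Evaluating and comparing candidates\<close>

definition turning_points :: program where
  "turning_points = block
     [Write ''x'' (NConst 0) (RDiv (RConst 1) (RConst 3)),
      When (RLess (cell ''x'') (RRead ''rp'' (NReg ''a''))) ''x'' (NConst 0) (RRead ''rp'' (NReg ''a'')),
      When (RLess (cell ''x'') (RRead ''rq'' (NReg ''b''))) ''x'' (NConst 0) (RRead ''rq'' (NReg ''b'')),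
      Write ''y'' (NConst 0) (RSub (cell ''L'') (RDiv (RConst 1) (RConst 3))),
      When (RLess (RRead ''lp'' (next_of ''a'')) (cell ''y'')) ''y'' (NConst 0) (RRead ''lp'' (next_of ''a'')),
      When (RLess (RRead ''lq'' (next_of ''b'')) (cell ''y'')) ''y'' (NConst 0) (RRead ''lq'' (next_of ''b''))]"

definition undelayed_times :: program where
  "undelayed_times = block
     [Write ''t0'' (NConst 0) (RAdd (RDiv (RMul (RConst 2) (cell ''x'')) (cell ''s''))
        (RMul (cell ''k'') (RAdd (RRead ''wp'' (NReg ''a'')) (RRead ''wq'' (NReg ''b''))))),
      Write ''t1'' (NConst 0) (RAdd (RDiv (RMul (RConst 2) (RSub (cell ''L'') (cell ''y''))) (cell ''s''))
        (RMul (cell ''k'') (RAdd (RSub (RRead ''wp'' (NReg ''np'')) (RRead ''wp'' (NReg ''a'')))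
          (RSub (RRead ''wq'' (NReg ''nq'')) (RRead ''wq'' (NReg ''b''))))))]"

definition crossing_exp :: bexp where
  "crossing_exp = RLess (RRead ''lq'' (next_of ''b'')) (RRead ''rp'' (NReg ''a''))"

text \<open>Later writes override earlier ones, which reproduces the order of cases in
  \<open>delay\<close>; the truncation at 0 is confined to the crossing case.\<close>

definition compute_delay :: "bool \<Rightarrow> bool \<Rightarrow> program" where
  "compute_delay u v = block
     [Write ''g'' (NConst 0) (RRead ''m1'' (NReg ''b'')),
      When (RLess (cell ''g'') (cell ''m2'')) ''g'' (NConst 0) (cell ''m2''),
      Write ''d'' (NConst 0) (RConst 0),
      When (BAnd (BNot (NLess (NReg ''a'') (NReg ''np''))) (BNot (NLess (NReg ''b'') (NReg ''nq''))))
        ''d'' (NConst 0) (RSub (cell ''t0'') (cell ''t1'')),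
      When crossing_exp ''d'' (NConst 0)
        (RAdd (RAdd (RDiv (RSub (RMul (RConst 2) (RRead ''rp'' (NReg ''a''))) (cell ''L'')) (cell ''s''))
          (RMul (cell ''k'') (RSub (RSub (RAdd (RMul (RConst (of_bool u)) (RRead ''wq'' (NReg ''b'')))
              (RRead ''wp'' (NReg ''a'')))
            (RMul (RConst (of_bool v)) (RRead ''wq'' (NReg ''nq''))))
            (RMul (RConst (1 - of_bool v)) (RSub (RRead ''wp'' (NReg ''np'')) (RRead ''wp'' (NReg ''a'')))))))
          (RMul (cell ''k'') (cell ''g''))),
      When (BAnd crossing_exp (RLess (cell ''d'') (RConst 0))) ''d'' (NConst 0) (RConst 0)]"

definition compute_value :: program where
  "compute_value = block
     [Write ''e'' (NConst 0) (cell ''t0''),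
      When (RLess (cell ''e'') (RAdd (cell ''t1'') (cell ''d''))) ''e'' (NConst 0) (RAdd (cell ''t1'') (cell ''d''))]"

text \<open>The pad and the flags exist only in the program text, not in memory. What is stored is
  therefore, for each of the four legs, the index before its first stockpile and the number of its
  stockpiles, together with both turning points and the delay.\<close>

definition record_candidate :: "bool \<Rightarrow> bool \<Rightarrow> program" where
  "record_candidate u v = block
     [SetReg ''found'' (NConst 1), Write ''best'' (NConst 0) (cell ''e''),
      Write ''bx'' (NConst 0) (cell ''x''), Write ''by'' (NConst 0) (cell ''y''), Write ''bd'' (NConst 0) (cell ''d''),
      SetReg ''f1'' (NReg (if u then ''oq'' else ''op'')), SetReg ''k1'' (NReg (if u then ''b'' else ''a'')),
      SetReg ''f2'' (NReg (if u then ''op'' else ''oq'')), SetReg ''k2'' (NReg (if u then ''a'' else ''b'')),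
      SetReg ''f3'' (if v then NAdd (NReg ''oq'') (NReg ''b'') else NAdd (NReg ''op'') (NReg ''a'')),
      SetReg ''k3'' (if v then NSub (NReg ''nq'') (NReg ''b'') else NSub (NReg ''np'') (NReg ''a'')),
      SetReg ''f4'' (if v then NAdd (NReg ''op'') (NReg ''a'') else NAdd (NReg ''oq'') (NReg ''b'')),
      SetReg ''k4'' (if v then NSub (NReg ''np'') (NReg ''a'') else NSub (NReg ''nq'') (NReg ''b''))]"

text \<open>Memory starts at zero and there is no infinite value, so the register
  \<open>found\<close> tells whether \<open>best\<close> is meaningful.\<close>

definition try_candidate :: "bool \<Rightarrow> bool \<Rightarrow> program" where
  "try_candidate u v = block
     [turning_points, undelayed_times, compute_delay u v, compute_value,
      Cond (BAnd (NLess (NConst 0) (NReg ''found'')) (BNot (RLess (cell ''e'') (cell ''best'')))) Nop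
        (record_candidate u v)]"

text \<open>\<open>For\<close> counts upwards while \<open>b\<close> must decrease, hence the
  counter \<open>c\<close>. \<open>m2\<close> is one cell, reset for every \<open>a\<close>;
  \<open>m1\<close> has an entry for every \<open>b\<close> and survives from one \<open>a\<close>
  to the next. The guards on \<open>a\<close> and \<open>b\<close> keep out default values, which
  could pass the comparisons.\<close>

definition update_maxima :: program where
  "update_maxima = block
     [SetReg ''b'' (NSub (NReg ''nq'') (NReg ''c'')),
      When (BAnd (NLess (NReg ''b'') (NReg ''nq''))
          (BAnd (BNot (RLess (RRead ''rp'' (NReg ''a'')) (RRead ''rq'' (next_of ''b''))))
            (RLess (cell ''m2'') (RRead ''grq'' (next_of ''b'')))))
        ''m2'' (NConst 0) (RRead ''grq'' (next_of ''b'')),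
      When (BAnd (NLess (NConst 0) (NReg ''a''))
          (BAnd (BNot (RLess (RRead ''lp'' (NReg ''a'')) (RRead ''lq'' (next_of ''b''))))
            (RLess (RRead ''m1'' (NReg ''b'')) (RRead ''glp'' (NReg ''a'')))))
        ''m1'' (NReg ''b'') (RRead ''glp'' (NReg ''a''))]"

definition search_step :: "bool \<Rightarrow> bool \<Rightarrow> program" where
  "search_step u v = block
     [update_maxima,
      Cond (RLess (RRead ''lp'' (next_of ''a'')) (RRead ''rq'' (NReg ''b''))) Nop (try_candidate u v)]"

definition search :: "bool \<Rightarrow> bool \<Rightarrow> program" where
  "search u v = block
     [For ''b'' (next_of ''nq'') (Write ''m1'' (NReg ''b'') (RRead ''glq'' (next_of ''b''))),
      For ''a'' (next_of ''np'') (block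
        [Write ''m2'' (NConst 0) (RRead ''grp'' (NReg ''a'')),
         For ''c'' (next_of ''nq'') (search_step u v)])]"

type_synonym candidate = "pad \<times> bool \<times> bool \<times> nat \<times> nat"

lemma written_consider [simp]:
  "written_regs turning_points = {}" "written_arrays turning_points = {''x'', ''y''}"
  "written_regs undelayed_times = {}" "written_arrays undelayed_times = {''t0'', ''t1''}"
  "written_regs (compute_delay u v) = {}" "written_arrays (compute_delay u v) = {''g'', ''d''}"
  "written_regs compute_value = {}" "written_arrays compute_value = {''e''}"
  "written_regs (record_candidate u v) = {''found'', ''f1'', ''k1'', ''f2'', ''k2'', ''f3'', ''k3'', ''f4'', ''k4''}"
  "written_arrays (record_candidate u v) = {''best'', ''bx'', ''by'', ''bd''}"
  by (auto simp: turning_points_def undelayed_times_def compute_delay_def compute_value_def record_candidate_def)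

lemma depth_consider [simp]:
  "depth turning_points = 0" "depth undelayed_times = 0" "depth (compute_delay u v) = 0"
  "depth compute_value = 0" "depth (record_candidate u v) = 0"
  by (simp_all add: turning_points_def undelayed_times_def compute_delay_def compute_value_def record_candidate_def)

section \<open>Correctness of the search\<close>

context yard
begin

lemma frame_tabled:
  assumes "written_regs c \<inter> {''n'', ''n1'', ''op'', ''np'', ''oq'', ''nq''} = {}"
    and "written_arrays c \<inter> {''lp'', ''rp'', ''wp'', ''lq'', ''rq'', ''wq'', ''l'', ''r'', ''L'', ''s'', ''k'',
      ''glp'', ''grp'', ''glq'', ''grq''} = {}"
  shows "frame c (tabled p u v)"
  unfolding frame_def
proof (intro allI impI)
  fix \<sigma> \<sigma>' assume a: "agree c \<sigma> \<sigma>'" and t: "tabled p u v \<sigma>"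
  from t show "tabled p u v \<sigma>'"
    by (simp add: tabled_def loaded_def inputs_def pads_set_def pad_loaded_def
        disjoint_agree(1)[OF a assms(1)] disjoint_agree(2)[OF a assms(2)])
qed

lemmas tabled_simps = tabled_def loaded_def inputs_def pads_set_def pad_loaded_def

definition at_candidate :: "pad \<Rightarrow> bool \<Rightarrow> bool \<Rightarrow> nat \<Rightarrow> nat \<Rightarrow> machine_state \<Rightarrow> bool" where
  "at_candidate p u v a b \<sigma> \<longleftrightarrow> tabled p u v \<sigma> \<and> a \<le> pile_num Y p \<and> b \<le> pile_num Y (other_pad p) \<and>
     regs \<sigma> ''a'' = a \<and> regs \<sigma> ''b'' = b \<and>
     arrays \<sigma> ''m1'' b = Max (gain Y p u v ` left_points Y p a b) \<and>
     arrays \<sigma> ''m2'' 0 = Max (gain Y p u v ` right_points Y p a b)"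

lemma frame_at_candidate:
  assumes "written_regs c \<inter> {''n'', ''n1'', ''op'', ''np'', ''oq'', ''nq'', ''a'', ''b''} = {}"
    and "written_arrays c \<inter> {''lp'', ''rp'', ''wp'', ''lq'', ''rq'', ''wq'', ''l'', ''r'', ''L'', ''s'', ''k'',
      ''glp'', ''grp'', ''glq'', ''grq'', ''m1'', ''m2''} = {}"
  shows "frame c (at_candidate p u v a b)"
proof -
  have "frame c (tabled p u v)" by (rule frame_tabled) (use assms in auto)
  then show ?thesis
    unfolding frame_def at_candidate_def using disjoint_agree(1)[OF _ assms(1)] disjoint_agree(2)[OF _ assms(2)] by simp
qed

lemma triple_extend:
  assumes "frame c F" "depth c = 0" "\<And>\<sigma>. F \<sigma> \<Longrightarrow> P \<sigma> \<Longrightarrow> Q (run c \<sigma>)"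
  shows "triple M (\<lambda>\<sigma>. F \<sigma> \<and> P \<sigma>) c (\<lambda>\<sigma>. F \<sigma> \<and> Q \<sigma>)"
  using assms run_agree unfolding frame_def by (intro triple_run) blast+

definition turning :: "(pad \<Rightarrow> nat) \<Rightarrow> machine_state \<Rightarrow> bool" where
  "turning c \<sigma> \<longleftrightarrow> arrays \<sigma> ''x'' 0 = peak Y c \<and> arrays \<sigma> ''y'' 0 = valley Y c"

definition timed :: "(pad \<Rightarrow> nat) \<Rightarrow> machine_state \<Rightarrow> bool" where
  "timed c \<sigma> \<longleftrightarrow> arrays \<sigma> ''t0'' 0 = time0 Y c \<and> arrays \<sigma> ''t1'' 0 = time1 Y c"

lemma turning_points_triple:
  "triple M (\<lambda>\<sigma>. at_candidate p u v a b \<sigma> \<and> True) turning_points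
    (\<lambda>\<sigma>. at_candidate p u v a b \<sigma> \<and> turning (split_at p a b) \<sigma>)"
proof (rule triple_extend)
  show "frame turning_points (at_candidate p u v a b)" by (rule frame_at_candidate) simp_all
  fix \<sigma> assume "at_candidate p u v a b \<sigma>"
  then show "turning (split_at p a b) (run turning_points \<sigma>)"
    by (simp add: at_candidate_def tabled_simps turning_def turning_points_def if_max if_min peak_eq valley_eq
        max.assoc min.assoc)
qed simp

lemma undelayed_times_triple:
  "triple M (\<lambda>\<sigma>. (at_candidate p u v a b \<sigma> \<and> turning (split_at p a b) \<sigma>) \<and> True) undelayed_times
    (\<lambda>\<sigma>. (at_candidate p u v a b \<sigma> \<and> turning (split_at p a b) \<sigma>) \<and> timed (split_at p a b) \<sigma>)"
proof (rule triple_extend)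
  show "frame undelayed_times (\<lambda>\<sigma>. at_candidate p u v a b \<sigma> \<and> turning (split_at p a b) \<sigma>)"
    by (intro frame_conj frame_at_candidate) (simp_all add: frame_def agree_def turning_def)
  fix \<sigma> assume at: "at_candidate p u v a b \<sigma> \<and> turning (split_at p a b) \<sigma>"
  then have c: "is_split (split_at p a b)" by (simp add: is_split_split_at at_candidate_def)
  show "timed (split_at p a b) (run undelayed_times \<sigma>)"
    using at by (simp add: at_candidate_def tabled_simps turning_def undelayed_times_def timed_def
        time0_eq[OF c, of p] time1_eq[OF c, of p])
qed simp

lemma compute_delay_triple:
  "triple M (\<lambda>\<sigma>. (at_candidate p u v a b \<sigma> \<and> turning (split_at p a b) \<sigma> \<and> timed (split_at p a b) \<sigma>) \<and> True)
    (compute_delay u v)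
    (\<lambda>\<sigma>. (at_candidate p u v a b \<sigma> \<and> turning (split_at p a b) \<sigma> \<and> timed (split_at p a b) \<sigma>) \<and>
      arrays \<sigma> ''d'' 0 = delay Y p u v a b)"
proof (rule triple_extend)
  show "frame (compute_delay u v) (\<lambda>\<sigma>. at_candidate p u v a b \<sigma> \<and> turning (split_at p a b) \<sigma> \<and> timed (split_at p a b) \<sigma>)"
    by (intro frame_conj frame_at_candidate) (simp_all add: frame_def agree_def turning_def timed_def)
  fix \<sigma> assume at: "at_candidate p u v a b \<sigma> \<and> turning (split_at p a b) \<sigma> \<and> timed (split_at p a b) \<sigma>"
  have cr: "crossing Y p a b \<longleftrightarrow> arrays \<sigma> ''lq'' (Suc b) < arrays \<sigma> ''rp'' a"
    using at by (simp add: crossing_def at_candidate_def tabled_simps)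
  have base: "base_delay Y p u v a b =
      (2 * arrays \<sigma> ''rp'' a - arrays \<sigma> ''L'' 0) / arrays \<sigma> ''s'' 0 + arrays \<sigma> ''k'' 0 *
       (of_bool u * arrays \<sigma> ''wq'' b + arrays \<sigma> ''wp'' a - of_bool v * arrays \<sigma> ''wq'' (regs \<sigma> ''nq'')
        - (1 - of_bool v) * (arrays \<sigma> ''wp'' (regs \<sigma> ''np'') - arrays \<sigma> ''wp'' a))"
    using at by (simp add: base_delay_def at_candidate_def tabled_simps)
  have k: "arrays \<sigma> ''k'' 0 = \<kappa>" using at by (simp add: at_candidate_def tabled_simps)
  have ab: "regs \<sigma> ''a'' = a" "regs \<sigma> ''b'' = b" "regs \<sigma> ''np'' = pile_num Y p" "regs \<sigma> ''nq'' = pile_num Y (other_pad p)"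
    "a \<le> pile_num Y p" "b \<le> pile_num Y (other_pad p)"
    using at by (simp_all add: at_candidate_def tabled_simps)
  have g: "arrays \<sigma> ''m1'' b = Max (gain Y p u v ` left_points Y p a b)"
    "arrays \<sigma> ''m2'' 0 = Max (gain Y p u v ` right_points Y p a b)"
    using at by (simp_all add: at_candidate_def)
  have t: "arrays \<sigma> ''t0'' 0 = time0 Y (split_at p a b)" "arrays \<sigma> ''t1'' 0 = time1 Y (split_at p a b)"
    using at by (simp_all add: timed_def)
  have full: "(\<not> a < pile_num Y p \<and> \<not> b < pile_num Y (other_pad p)) \<longleftrightarrow>
      a = pile_num Y p \<and> b = pile_num Y (other_pad p)"
    using ab by auto
  show "arrays (run (compute_delay u v) \<sigma>) ''d'' 0 = delay Y p u v a b"
    unfolding delay_def cr base k[symmetric] g[symmetric] t[symmetric] full[symmetric]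
    by (simp add: compute_delay_def crossing_exp_def if_max ab(1,2)) (simp add: ab max_def)
qed simp

lemma compute_value_triple:
  "triple M (\<lambda>\<sigma>. (at_candidate p u v a b \<sigma> \<and> turning (split_at p a b) \<sigma> \<and> timed (split_at p a b) \<sigma> \<and>
      arrays \<sigma> ''d'' 0 = delay Y p u v a b) \<and> True) compute_value
    (\<lambda>\<sigma>. (at_candidate p u v a b \<sigma> \<and> turning (split_at p a b) \<sigma> \<and> timed (split_at p a b) \<sigma> \<and>
      arrays \<sigma> ''d'' 0 = delay Y p u v a b) \<and> arrays \<sigma> ''e'' 0 = candidate_value Y p u v a b)"
proof (rule triple_extend)
  show "frame compute_value (\<lambda>\<sigma>. at_candidate p u v a b \<sigma> \<and> turning (split_at p a b) \<sigma> \<and> timed (split_at p a b) \<sigma> \<and>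
      arrays \<sigma> ''d'' 0 = delay Y p u v a b)"
    by (intro frame_conj frame_at_candidate) (simp_all add: frame_def agree_def turning_def timed_def)
qed (simp_all add: compute_value_def timed_def candidate_value_def if_max)

fun recorded :: "candidate \<Rightarrow> machine_state \<Rightarrow> bool" where
  "recorded (p, u, v, a, b) \<sigma> \<longleftrightarrow>
     (let c = split_at p a b; o0 = pick u p; o1 = pick v p in
      arrays \<sigma> ''bx'' 0 = peak Y c \<and> arrays \<sigma> ''by'' 0 = valley Y c \<and> arrays \<sigma> ''bd'' 0 = delay Y p u v a b \<and>
      regs \<sigma> ''f1'' = offset Y o0 \<and> regs \<sigma> ''k1'' = c o0 \<and>
      regs \<sigma> ''f2'' = offset Y (other_pad o0) \<and> regs \<sigma> ''k2'' = c (other_pad o0) \<and>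
      regs \<sigma> ''f3'' = offset Y o1 + c o1 \<and> regs \<sigma> ''k3'' = pile_num Y o1 - c o1 \<and>
      regs \<sigma> ''f4'' = offset Y (other_pad o1) + c (other_pad o1) \<and>
      regs \<sigma> ''k4'' = pile_num Y (other_pad o1) - c (other_pad o1))"

declare recorded.simps [simp del]

fun value_of :: "candidate \<Rightarrow> real" where
  "value_of (p, u, v, a, b) = candidate_value Y p u v a b"

definition best_of :: "candidate set \<Rightarrow> machine_state \<Rightarrow> bool" where
  "best_of C \<sigma> \<longleftrightarrow>
     (if regs \<sigma> ''found'' = 0 then C = {} else
      (\<exists>x\<in>C. recorded x \<sigma> \<and> arrays \<sigma> ''best'' 0 = value_of x \<and> (\<forall>y\<in>C. value_of x \<le> value_of y)))"

lemma frame_best_of: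
  assumes "written_regs c \<inter> {''found'', ''f1'', ''k1'', ''f2'', ''k2'', ''f3'', ''k3'', ''f4'', ''k4''} = {}"
    and "written_arrays c \<inter> {''best'', ''bx'', ''by'', ''bd''} = {}"
  shows "frame c (best_of C)"
  unfolding frame_def
proof (intro allI impI)
  fix \<sigma> \<sigma>' assume a: "agree c \<sigma> \<sigma>'" and b: "best_of C \<sigma>"
  have "recorded x \<sigma>' = recorded x \<sigma>" for x
    by (cases x) (simp add: recorded.simps disjoint_agree(1)[OF a assms(1)] disjoint_agree(2)[OF a assms(2)])
  with b show "best_of C \<sigma>'"
    by (simp add: best_of_def disjoint_agree(1)[OF a assms(1)] disjoint_agree(2)[OF a assms(2)])
qed

lemma record_triple:
  "triple M (\<lambda>\<sigma>. at_candidate p u v a b \<sigma> \<and> turning (split_at p a b) \<sigma> \<and>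
      arrays \<sigma> ''d'' 0 = delay Y p u v a b \<and> arrays \<sigma> ''e'' 0 = candidate_value Y p u v a b \<and> best_of C \<sigma>)
    (Cond (BAnd (NLess (NConst 0) (NReg ''found'')) (BNot (RLess (cell ''e'') (cell ''best'')))) Nop
        (record_candidate u v))
    (best_of (insert (p, u, v, a, b) C))"
proof (rule triple_run)
  let ?x = "(p, u, v, a, b)"
  fix \<sigma> assume \<sigma>: "at_candidate p u v a b \<sigma> \<and> turning (split_at p a b) \<sigma> \<and>
      arrays \<sigma> ''d'' 0 = delay Y p u v a b \<and> arrays \<sigma> ''e'' 0 = candidate_value Y p u v a b \<and> best_of C \<sigma>"
  let ?b = "BAnd (NLess (NConst 0) (NReg ''found'')) (BNot (RLess (cell ''e'') (cell ''best'')))"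
  show "best_of (insert ?x C) (run (Cond ?b Nop (record_candidate u v)) \<sigma>)"
  proof (cases "bval ?b \<sigma>")
    case True
    then show ?thesis using \<sigma> by (auto simp: best_of_def)
  next
    case False
    have min: "value_of ?x \<le> value_of y" if "y \<in> C" for y
      using \<sigma> False that by (auto simp: best_of_def split: if_splits)
    have rec: "recorded ?x (run (record_candidate u v) \<sigma>)"
      using \<sigma> by (cases u; cases v) (simp_all add: recorded.simps record_candidate_def at_candidate_def tabled_simps turning_def pick_def)
    have "regs (run (record_candidate u v) \<sigma>) ''found'' = 1"
      "arrays (run (record_candidate u v) \<sigma>) ''best'' 0 = value_of ?x"
      using \<sigma> by (simp_all add: record_candidate_def)
    then have "best_of (insert ?x C) (run (record_candidate u v) \<sigma>)"
      using rec min unfolding best_of_def by auto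
    then show ?thesis by (simp only: run.simps False if_False)
  qed
qed simp

lemma try_candidate_triple:
  "triple M (\<lambda>\<sigma>. at_candidate p u v a b \<sigma> \<and> best_of C \<sigma>) (try_candidate u v) (best_of (insert (p, u, v, a, b) C))"
proof -
  have fb: "triple M (\<lambda>\<sigma>. best_of C \<sigma> \<and> P \<sigma>) c (\<lambda>\<sigma>. best_of C \<sigma> \<and> Q \<sigma>)"
    if "triple M P c Q" "written_regs c = {}" "written_arrays c \<inter> {''best'', ''bx'', ''by'', ''bd''} = {}" for P c Q
    by (rule triple_frame[OF that(1)]) (rule frame_best_of, use that in auto)
  note f1 = fb[OF turning_points_triple] and f2 = fb[OF undelayed_times_triple]
    and f3 = fb[OF compute_delay_triple] and f4 = fb[OF compute_value_triple]
  show ?thesis unfolding try_candidate_def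
    by (rule triple_block[OF triple_weaken[OF f1] triple_block[OF triple_weaken[OF f2]
        triple_block[OF triple_weaken[OF f3] triple_block[OF triple_weaken[OF f4]
        triple_block[OF record_triple triple_block_Nil]]]]]) auto
qed

lemma left_points_Suc:
  "left_points Y p (Suc a) b = (if left_at Y (other_pad p) (b + 1) \<le> left_at Y p (Suc a)
     then insert (left_at Y p (Suc a)) (left_points Y p a b) else left_points Y p a b)"
proof -
  have "{i \<in> {1..Suc a}. left_at Y (other_pad p) (b + 1) \<le> left_at Y p i} =
    (if left_at Y (other_pad p) (b + 1) \<le> left_at Y p (Suc a) then {Suc a} else {}) \<union>
    {i \<in> {1..a}. left_at Y (other_pad p) (b + 1) \<le> left_at Y p i}"
    by (auto simp: le_Suc_eq)
  then show ?thesis unfolding left_points_def by auto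
qed

lemma right_points_step:
  assumes "b < pile_num Y (other_pad p)"
  shows "right_points Y p a b = (if right_at Y (other_pad p) (b + 1) \<le> right_at Y p a
     then insert (right_at Y (other_pad p) (b + 1)) (right_points Y p a (b + 1)) else right_points Y p a (b + 1))"
proof -
  have "{b + 1..pile_num Y (other_pad p)} = insert (b + 1) {b + 1 + 1..pile_num Y (other_pad p)}"
    using assms by auto
  then have "{j \<in> {b + 1..pile_num Y (other_pad p)}. right_at Y (other_pad p) j \<le> right_at Y p a} =
    (if right_at Y (other_pad p) (b + 1) \<le> right_at Y p a then {b + 1} else {}) \<union>
    {j \<in> {b + 1 + 1..pile_num Y (other_pad p)}. right_at Y (other_pad p) j \<le> right_at Y p a}"
    by auto
  then show ?thesis unfolding right_points_def by auto
qed

lemma points_ends: "left_points Y p 0 b = {left_at Y (other_pad p) (b + 1)}"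
  "right_points Y p a (pile_num Y (other_pad p)) = {right_at Y p a}"
  by (auto simp: left_points_def right_points_def)

text \<open>The condition on \<open>b'\<close> is written additively: with truncated subtraction,
  \<open>k = pile_num Y (other_pad p) + 1\<close> would miss \<open>b' = 0\<close> at the end of a
  row.\<close>

definition tried :: "pad \<Rightarrow> bool \<Rightarrow> bool \<Rightarrow> nat \<Rightarrow> nat \<Rightarrow> candidate set" where
  "tried p u v a k = {(p, u, v, a', b') |a' b'. admissible Y p a' b' \<and>
     (a' < a \<or> a' = a \<and> pile_num Y (other_pad p) < b' + k)}"

text \<open>
  The state before the \<open>k\<close>-th inner iteration, where \<open>b\<close> is about to become \<open>pile_num Y (other_pad p) - k\<close>.
\<close>

definition maxima :: "pad \<Rightarrow> bool \<Rightarrow> bool \<Rightarrow> nat \<Rightarrow> nat \<Rightarrow> machine_state \<Rightarrow> bool" where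
  "maxima p u v a k \<sigma> \<longleftrightarrow>
     (\<forall>b\<le>pile_num Y (other_pad p). arrays \<sigma> ''m1'' b = Max (gain Y p u v `
        left_points Y p (if pile_num Y (other_pad p) < b + k then a else a - 1) b)) \<and>
     arrays \<sigma> ''m2'' 0 = Max (gain Y p u v ` right_points Y p a (pile_num Y (other_pad p) - (k - 1)))"

lemma written_update_maxima [simp]:
  "written_regs update_maxima = {''b''}" "written_arrays update_maxima = {''m1'', ''m2''}"
  by (auto simp: update_maxima_def)

lemma update_maxima_triple:
  assumes a: "a \<le> pile_num Y p" and k: "k \<le> pile_num Y (other_pad p)"
  shows "triple M (\<lambda>\<sigma>. (tabled p u v \<sigma> \<and> regs \<sigma> ''a'' = a \<and> regs \<sigma> ''c'' = k) \<and> maxima p u v a k \<sigma>) update_maxima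
    (\<lambda>\<sigma>. (tabled p u v \<sigma> \<and> regs \<sigma> ''a'' = a \<and> regs \<sigma> ''c'' = k) \<and>
       maxima p u v a (Suc k) \<sigma> \<and> regs \<sigma> ''b'' = pile_num Y (other_pad p) - k)"
proof (rule triple_extend)
  show "frame update_maxima (\<lambda>\<sigma>. tabled p u v \<sigma> \<and> regs \<sigma> ''a'' = a \<and> regs \<sigma> ''c'' = k)"
    by (intro frame_conj frame_tabled) (simp_all add: frame_def agree_def)
  show "depth update_maxima = 0" by (simp add: update_maxima_def)
  fix \<sigma> assume t: "tabled p u v \<sigma> \<and> regs \<sigma> ''a'' = a \<and> regs \<sigma> ''c'' = k" and m: "maxima p u v a k \<sigma>"
  let ?q = "other_pad p" and ?N = "pile_num Y (other_pad p)" and ?G = "gain Y p u v"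
  let ?b = "?N - k" and ?s = "run update_maxima \<sigma>"
  have m2: "arrays ?s ''m2'' 0 = Max (?G ` right_points Y p a ?b)"
  proof -
    have old: "arrays \<sigma> ''m2'' 0 = Max (?G ` right_points Y p a (?N - (k - 1)))"
      using m by (simp add: maxima_def)
    have val: "arrays \<sigma> ''rp'' a = right_at Y p a" "arrays \<sigma> ''rq'' (Suc ?b) = right_at Y ?q (Suc ?b)"
      "arrays \<sigma> ''grq'' (Suc ?b) = ?G (right_at Y ?q (Suc ?b))" "regs \<sigma> ''nq'' = ?N"
      using t a by (simp_all add: tabled_simps)
    have new: "arrays ?s ''m2'' 0 = (if k > 0 \<and> right_at Y ?q (Suc ?b) \<le> right_at Y p a
        then max (arrays \<sigma> ''m2'' 0) (?G (right_at Y ?q (Suc ?b))) else arrays \<sigma> ''m2'' 0)"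
      using t k by (auto simp: update_maxima_def val max_def)
    show ?thesis
    \<comment> \<open>In the first iteration no stockpile of the other pad has been released to
      \<open>R1\<close> yet, and \<open>k - 1\<close> truncates to 0, so the set of points stays the
      same.\<close>
    proof (cases "k = 0")
      case True
      then show ?thesis using new old by simp
    next
      case False
      then have "?b < ?N" "?N - (k - 1) = Suc ?b" using k by auto
      then show ?thesis
        unfolding new old using False right_points_step[of ?b p a] by (simp add: max.commute)
    qed
  qed
  have m1: "arrays ?s ''m1'' b = Max (?G ` left_points Y p (if ?N < b + Suc k then a else a - 1) b)"
    if b: "b \<le> ?N" for b
  proof -
    have old: "arrays \<sigma> ''m1'' b = Max (?G ` left_points Y p (if ?N < b + k then a else a - 1) b)"
      using m b by (simp add: maxima_def)
    have val: "arrays \<sigma> ''lp'' a = left_at Y p a" "arrays \<sigma> ''lq'' (Suc ?b) = left_at Y ?q (Suc ?b)"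
      "arrays \<sigma> ''glp'' a = ?G (left_at Y p a)" "regs \<sigma> ''nq'' = ?N"
      using t a by (simp_all add: tabled_simps)
    have new: "arrays ?s ''m1'' b = (if b = ?b \<and> a > 0 \<and> left_at Y ?q (Suc ?b) \<le> left_at Y p a
        then max (arrays \<sigma> ''m1'' b) (?G (left_at Y p a)) else arrays \<sigma> ''m1'' b)"
      using t by (auto simp: update_maxima_def val max_def)
    show ?thesis
    proof (cases "b = ?b")
      case False
      then have "?N < b + Suc k \<longleftrightarrow> ?N < b + k" using b k by auto
      then show ?thesis using False new old by simp
    next
      case True
      \<comment> \<open>Only the entry for the current \<open>b\<close> advances from
        \<open>a - 1\<close> to \<open>a\<close>. For \<open>a = 0\<close> the truncated predecessor
        is 0 itself, and nothing is added.\<close>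
      then have "?N < b + Suc k" "\<not> ?N < b + k" using k by auto
      then show ?thesis
        unfolding new old using True left_points_Suc[of p "a - 1" b] by (cases a) (simp_all add: max.commute)
    qed
  qed
  show "maxima p u v a (Suc k) ?s \<and> regs ?s ''b'' = ?b"
    using m1 m2 t by (simp add: maxima_def) (simp add: update_maxima_def tabled_simps)
qed

lemma tried_Suc:
  assumes "a \<le> pile_num Y p" "k \<le> pile_num Y (other_pad p)"
  shows "tried p u v a (Suc k) = (if admissible Y p a (pile_num Y (other_pad p) - k)
    then insert (p, u, v, a, pile_num Y (other_pad p) - k) (tried p u v a k) else tried p u v a k)"
proof -
  have "pile_num Y (other_pad p) < b + Suc k \<longleftrightarrow> b = pile_num Y (other_pad p) - k \<or> pile_num Y (other_pad p) < b + k"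
    if "b \<le> pile_num Y (other_pad p)" for b
    using that assms by auto
  then show ?thesis by (auto simp: tried_def admissible_def)
qed

lemma search_step_triple:
  assumes a: "a \<le> pile_num Y p" and k: "k \<le> pile_num Y (other_pad p)"
  shows "triple M (\<lambda>\<sigma>. tabled p u v \<sigma> \<and> regs \<sigma> ''a'' = a \<and> regs \<sigma> ''c'' = k \<and> maxima p u v a k \<sigma> \<and>
      best_of (C \<union> tried p u v a k) \<sigma>) (search_step u v)
    (\<lambda>\<sigma>. tabled p u v \<sigma> \<and> regs \<sigma> ''a'' = a \<and> regs \<sigma> ''c'' = k \<and> maxima p u v a (Suc k) \<sigma> \<and>
      best_of (C \<union> tried p u v a (Suc k)) \<sigma>)"
proof -
  let ?N = "pile_num Y (other_pad p)"
  let ?b = "?N - k" and ?C = "C \<union> tried p u v a k"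
  let ?R = "\<lambda>\<sigma>. tabled p u v \<sigma> \<and> regs \<sigma> ''a'' = a \<and> regs \<sigma> ''c'' = k \<and> maxima p u v a (Suc k) \<sigma> \<and> regs \<sigma> ''b'' = ?b"
  have 1: "triple M (\<lambda>\<sigma>. best_of ?C \<sigma> \<and> (tabled p u v \<sigma> \<and> regs \<sigma> ''a'' = a \<and> regs \<sigma> ''c'' = k) \<and> maxima p u v a k \<sigma>)
     update_maxima (\<lambda>\<sigma>. best_of ?C \<sigma> \<and> (tabled p u v \<sigma> \<and> regs \<sigma> ''a'' = a \<and> regs \<sigma> ''c'' = k) \<and>
       maxima p u v a (Suc k) \<sigma> \<and> regs \<sigma> ''b'' = ?b)"
    by (intro triple_frame update_maxima_triple[OF a k] frame_best_of) simp_all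
  have "frame (try_candidate u v) ?R"
    by (intro frame_conj frame_tabled)
      (simp_all add: try_candidate_def frame_def agree_def maxima_def)
  note 2 = triple_frame[OF try_candidate_triple[of p u v a ?b ?C] this]
  have at: "at_candidate p u v a ?b \<sigma>" if "?R \<sigma>" for \<sigma>
    using that a k by (simp add: at_candidate_def maxima_def)
  have adm: "admissible Y p a ?b \<longleftrightarrow> \<not> arrays \<sigma> ''lp'' (Suc a) < arrays \<sigma> ''rq'' ?b" if "?R \<sigma>" for \<sigma>
    using that a by (simp add: admissible_def crossing_def tabled_simps)
  let ?Q = "\<lambda>\<sigma>. tabled p u v \<sigma> \<and> regs \<sigma> ''a'' = a \<and> regs \<sigma> ''c'' = k \<and> maxima p u v a (Suc k) \<sigma> \<and>
      best_of (C \<union> tried p u v a (Suc k)) \<sigma>"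
  let ?cond = "RLess (RRead ''lp'' (next_of ''a'')) (RRead ''rq'' (NReg ''b''))"
  have 3: "triple M (\<lambda>\<sigma>. best_of ?C \<sigma> \<and> ?R \<sigma>) (Cond ?cond Nop (try_candidate u v)) ?Q"
  proof (rule triple_Cond)
    show "1 \<le> M" by simp
    show "triple M (\<lambda>\<sigma>. (best_of ?C \<sigma> \<and> ?R \<sigma>) \<and> bval ?cond \<sigma>) Nop ?Q"
    proof (rule triple_run)
      fix \<sigma> assume s: "(best_of ?C \<sigma> \<and> ?R \<sigma>) \<and> bval ?cond \<sigma>"
      then have "regs \<sigma> ''a'' = a" "regs \<sigma> ''b'' = ?b" "bval ?cond \<sigma>" and R: "?R \<sigma>" by blast+
      then have "\<not> admissible Y p a ?b" unfolding adm[OF R] by simp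
      then show "?Q (run Nop \<sigma>)" using s by (simp add: tried_Suc[OF a k])
    qed simp
    show "triple M (\<lambda>\<sigma>. (best_of ?C \<sigma> \<and> ?R \<sigma>) \<and> \<not> bval ?cond \<sigma>) (try_candidate u v) ?Q"
    proof (cases "admissible Y p a ?b")
      case True
      then have "C \<union> tried p u v a (Suc k) = insert (p, u, v, a, ?b) ?C" by (simp add: tried_Suc[OF a k])
      then show ?thesis using at by (intro triple_weaken[OF 2]) auto
    next
      case False
      \<comment> \<open>The test in the program is exactly the negation of admissibility here, so
        this branch cannot be reached.\<close>
      have "\<not> ((best_of ?C \<sigma> \<and> ?R \<sigma>) \<and> \<not> bval ?cond \<sigma>)" for \<sigma>
      proof
        assume "(best_of ?C \<sigma> \<and> ?R \<sigma>) \<and> \<not> bval ?cond \<sigma>"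
        then have "regs \<sigma> ''a'' = a" "regs \<sigma> ''b'' = ?b" "\<not> bval ?cond \<sigma>" and R: "?R \<sigma>" by blast+
        then show False using False unfolding adm[OF R] by simp
      qed
      then show ?thesis unfolding triple_def by blast
    qed
  qed
  show ?thesis unfolding search_step_def
    by (rule triple_block[OF triple_weaken[OF 1] triple_block[OF triple_weaken[OF 3] triple_block_Nil]]) auto
qed

lemma tried_row: "tried p u v a (Suc (pile_num Y (other_pad p))) = tried p u v (Suc a) 0"
  by (auto simp: tried_def admissible_def less_Suc_eq)

lemma tried_none: "tried p u v 0 0 = {}"
  by (auto simp: tried_def admissible_def)

lemma tried_all: "tried p u v (Suc (pile_num Y p)) 0 = {(p, u, v, a, b) |a b. admissible Y p a b}"
  by (auto simp: tried_def admissible_def)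

lemma search_triple:
  "triple M (\<lambda>\<sigma>. tabled p u v \<sigma> \<and> best_of C \<sigma>) (search u v)
    (\<lambda>\<sigma>. tabled p u v \<sigma> \<and> best_of (C \<union> {(p, u, v, a, b) |a b. admissible Y p a b}) \<sigma>)"
proof -
  let ?N = "pile_num Y (other_pad p)"
  let ?G = "gain Y p u v"
  define I where "I k \<sigma> \<longleftrightarrow> tabled p u v \<sigma> \<and> best_of C \<sigma> \<and>
    (\<forall>b<k. arrays \<sigma> ''m1'' b = Max (?G ` left_points Y p 0 b))" for k and \<sigma> :: machine_state
  have T: "tabled p u v (\<sigma>\<lparr>regs := (regs \<sigma>)(x := m)\<rparr>)" if "tabled p u v \<sigma>" "x \<in> {''a'', ''b'', ''c''}" for \<sigma> x m
    using that by (auto simp: tabled_simps)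
  have B: "best_of D (\<sigma>\<lparr>regs := (regs \<sigma>)(x := m)\<rparr>)" if "best_of D \<sigma>" "x \<in> {''a'', ''b'', ''c''}" for D \<sigma> x m
  proof -
    have "frame (SetReg x (NConst m)) (best_of D)" by (rule frame_best_of) (use that in auto)
    then show ?thesis using that(1) run_agree[of "SetReg x (NConst m)" \<sigma>] by (simp add: frame_def)
  qed
  have 1: "triple M (I 0) (For ''b'' (next_of ''nq'') (Write ''m1'' (NReg ''b'') (RRead ''glq'' (next_of ''b'')))) (I (?N + 1))"
  proof (rule triple_For)
    show "?N + 1 \<le> M" "1 \<le> M" using pile_num_le[of "other_pad p"] by simp_all
    show "nval (next_of ''nq'') \<sigma> = ?N + 1" if "I k \<sigma>" for k \<sigma>
      using that by (simp add: I_def tabled_simps)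
    show "I k (\<sigma>\<lparr>regs := (regs \<sigma>)(''b'' := m)\<rparr>)" if "I k \<sigma>" for k m \<sigma>
      using that T B by (simp add: I_def)
    fix k assume k: "k < ?N + 1"
    let ?w = "Write ''m1'' (NReg ''b'') (RRead ''glq'' (next_of ''b''))"
    have "frame ?w (tabled p u v)" "frame ?w (best_of C)"
      by (rule frame_tabled; simp) (rule frame_best_of; simp)
    then have fr: "tabled p u v (run ?w \<sigma>)" "best_of C (run ?w \<sigma>)" if "tabled p u v \<sigma>" "best_of C \<sigma>" for \<sigma>
      using run_agree that unfolding frame_def by blast+
    show "triple M (\<lambda>\<sigma>. I k \<sigma> \<and> regs \<sigma> ''b'' = k) ?w (\<lambda>\<sigma>. I (Suc k) \<sigma> \<and> regs \<sigma> ''b'' = k)"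
    proof (rule triple_run)
      fix \<sigma> assume s: "I k \<sigma> \<and> regs \<sigma> ''b'' = k"
      then have "arrays \<sigma> ''glq'' (Suc k) = Max (?G ` left_points Y p 0 k)"
        using k by (simp add: I_def tabled_def points_ends)
      then have "arrays (run ?w \<sigma>) ''m1'' b = Max (?G ` left_points Y p 0 b)" if "b < Suc k" for b
        using s that by (simp add: I_def)
      moreover have "regs (run ?w \<sigma>) ''b'' = k" using s by simp
      moreover have "tabled p u v (run ?w \<sigma>)" "best_of C (run ?w \<sigma>)" using s fr unfolding I_def by blast+
      ultimately show "I (Suc k) (run ?w \<sigma>) \<and> regs (run ?w \<sigma>) ''b'' = k" unfolding I_def by blast
    qed simp
  qed
  \<comment> \<open>At the start of row \<open>k\<close> the entries of \<open>m1\<close> still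
    belong to row \<open>k - 1\<close>; for the first row the truncated predecessor matches the
    initialisation with the left boundary alone.\<close>
  define J where "J k \<sigma> \<longleftrightarrow> tabled p u v \<sigma> \<and> best_of (C \<union> tried p u v k 0) \<sigma> \<and>
    (\<forall>b\<le>?N. arrays \<sigma> ''m1'' b = Max (?G ` left_points Y p (k - 1) b))" for k and \<sigma> :: machine_state
  let ?init = "Write ''m2'' (NConst 0) (RRead ''grp'' (NReg ''a''))"
  have 2: "triple M (J 0) (For ''a'' (next_of ''np'') (block [?init, For ''c'' (next_of ''nq'') (search_step u v)]))
     (J (pile_num Y p + 1))"
  proof (rule triple_For)
    show "pile_num Y p + 1 \<le> M" "1 \<le> M" using pile_num_le[of p] by simp_all
    show "nval (next_of ''np'') \<sigma> = pile_num Y p + 1" if "J k \<sigma>" for k \<sigma>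
      using that by (simp add: J_def tabled_simps)
    show "J k (\<sigma>\<lparr>regs := (regs \<sigma>)(''a'' := m)\<rparr>)" if "J k \<sigma>" for k m \<sigma>
      using that T B by (simp add: J_def)
    fix a assume "a < pile_num Y p + 1"
    then have a: "a \<le> pile_num Y p" by simp
    define K where "K k \<sigma> \<longleftrightarrow> tabled p u v \<sigma> \<and> regs \<sigma> ''a'' = a \<and> maxima p u v a k \<sigma> \<and>
      best_of (C \<union> tried p u v a k) \<sigma>" for k and \<sigma> :: machine_state
    have i: "triple M (\<lambda>\<sigma>. J a \<sigma> \<and> regs \<sigma> ''a'' = a) ?init (K 0)"
    proof (rule triple_run)
      have "frame ?init (tabled p u v)" "frame ?init (best_of (C \<union> tried p u v a 0))"
        by (rule frame_tabled; simp) (rule frame_best_of; simp)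
      then have fr: "tabled p u v (run ?init \<sigma>)" "best_of (C \<union> tried p u v a 0) (run ?init \<sigma>)"
        if "tabled p u v \<sigma>" "best_of (C \<union> tried p u v a 0) \<sigma>" for \<sigma>
        using run_agree that unfolding frame_def by blast+
      fix \<sigma> assume s: "J a \<sigma> \<and> regs \<sigma> ''a'' = a"
      have "arrays \<sigma> ''grp'' a = ?G (right_at Y p a)" using s a by (simp add: J_def tabled_def)
      then have "maxima p u v a 0 (run ?init \<sigma>)"
        using s by (simp add: maxima_def J_def points_ends)
      moreover have "regs (run ?init \<sigma>) ''a'' = a" using s by simp
      moreover have "tabled p u v (run ?init \<sigma>)" "best_of (C \<union> tried p u v a 0) (run ?init \<sigma>)"
        using s fr unfolding J_def by blast+
      ultimately show "K 0 (run ?init \<sigma>)" unfolding K_def by blast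
    qed simp
    have l: "triple M (K 0) (For ''c'' (next_of ''nq'') (search_step u v)) (K (?N + 1))"
    proof (rule triple_For)
      show "?N + 1 \<le> M" "1 \<le> M" using pile_num_le[of "other_pad p"] by simp_all
      show "nval (next_of ''nq'') \<sigma> = ?N + 1" if "K k \<sigma>" for k \<sigma>
        using that by (simp add: K_def tabled_simps)
      show "K k (\<sigma>\<lparr>regs := (regs \<sigma>)(''c'' := m)\<rparr>)" if "K k \<sigma>" for k m \<sigma>
        using that T B by (simp add: K_def maxima_def)
      fix k assume "k < ?N + 1"
      then have "k \<le> ?N" by simp
      from search_step_triple[OF a this, of u v C]
      show "triple M (\<lambda>\<sigma>. K k \<sigma> \<and> regs \<sigma> ''c'' = k) (search_step u v) (\<lambda>\<sigma>. K (Suc k) \<sigma> \<and> regs \<sigma> ''c'' = k)"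
        by (rule triple_weaken) (auto simp: K_def)
    qed
    have e: "J (Suc a) \<sigma> \<and> regs \<sigma> ''a'' = a" if "K (?N + 1) \<sigma>" for \<sigma>
      using that by (simp add: K_def J_def tried_row maxima_def)
    show "triple M (\<lambda>\<sigma>. J a \<sigma> \<and> regs \<sigma> ''a'' = a) (block [?init, For ''c'' (next_of ''nq'') (search_step u v)])
      (\<lambda>\<sigma>. J (Suc a) \<sigma> \<and> regs \<sigma> ''a'' = a)"
      by (rule triple_weaken[OF triple_block[OF i triple_block[OF l triple_block_Nil]] _ e])
  qed
  show ?thesis unfolding search_def
    by (rule triple_weaken[OF triple_block[OF 1 triple_block[OF triple_weaken[OF 2] triple_block_Nil]]])
      (auto simp: I_def J_def tried_none tried_all less_Suc_eq_le)
qed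

end

section \<open>Writing the schedule\<close>

fun len_of :: "reclaimer \<Rightarrow> string" where "len_of R0 = ''len0''" | "len_of R1 = ''len1''"
fun dir_of :: "reclaimer \<Rightarrow> string" where "dir_of R0 = ''dir0''" | "dir_of R1 = ''dir1''"
fun pile_of :: "reclaimer \<Rightarrow> string" where "pile_of R0 = ''pile0''" | "pile_of R1 = ''pile1''"
fun dur_of :: "reclaimer \<Rightarrow> string" where "dur_of R0 = ''dur0''" | "dur_of R1 = ''dur1''"

text \<open>The test for a positive duration is the counterpart of \<open>moving\<close>: empty
  pieces are never written.\<close>

definition emit :: "reclaimer \<Rightarrow> int \<Rightarrow> rexp \<Rightarrow> rexp \<Rightarrow> program" where
  "emit k c pile d = block
     [Write ''t'' (NConst 0) d,
      Cond (RLess (RConst 0) (cell ''t''))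
        (block [Write (dir_of k) (NReg (len_of k)) (RConst c), Write (pile_of k) (NReg (len_of k)) pile,
          Write (dur_of k) (NReg (len_of k)) (cell ''t''), SetReg (len_of k) (next_of (len_of k))])
        Nop]"

fun sign :: "direction \<Rightarrow> int" where "sign Leftward = - 1" | "sign Rightward = 1"

fun entry_exp :: "direction \<Rightarrow> rexp" where
  "entry_exp Rightward = RRead ''l'' (NReg ''g'')"
| "entry_exp Leftward = RRead ''r'' (NReg ''g'')"

fun exit_exp :: "direction \<Rightarrow> rexp" where
  "exit_exp Rightward = RRead ''r'' (NReg ''g'')"
| "exit_exp Leftward = RRead ''l'' (NReg ''g'')"

definition travel :: "reclaimer \<Rightarrow> direction \<Rightarrow> rexp \<Rightarrow> program" where
  "travel k D e = emit k (sign D) (RConst 0) (RDiv (RMul (RConst (sign D)) (RSub e (cell ''pos''))) (cell ''s''))"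

definition visit :: "reclaimer \<Rightarrow> direction \<Rightarrow> program" where
  "visit k D = block
     [travel k D (entry_exp D),
      emit k (sign D) (ROfNat (NReg ''g'')) (RSub (RRead ''r'' (NReg ''g'')) (RRead ''l'' (NReg ''g''))),
      Write ''pos'' (NConst 0) (exit_exp D)]"

fun pile_exp :: "direction \<Rightarrow> string \<Rightarrow> string \<Rightarrow> nexp" where
  "pile_exp Rightward f m = NAdd (NReg f) (next_of ''i'')"
| "pile_exp Leftward f m = NAdd (NReg f) (NSub (NReg m) (NReg ''i''))"

definition leg_program :: "reclaimer \<Rightarrow> direction \<Rightarrow> string \<Rightarrow> string \<Rightarrow> rexp \<Rightarrow> program" where
  "leg_program k D f m e = block
     [For ''i'' (NReg m) (block [SetReg ''g'' (pile_exp D f m), visit k D]),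
      travel k D e, Write ''pos'' (NConst 0) e]"

definition write_schedule :: program where
  "write_schedule = block
     [SetReg ''len0'' (NConst 0), Write ''pos'' (NConst 0) (RConst 0),
      leg_program R0 Rightward ''f1'' ''k1'' (cell ''bx''), leg_program R0 Leftward ''f2'' ''k2'' (RConst 0),
      SetReg ''len1'' (NConst 0), emit R1 0 (RConst 0) (cell ''bd''), Write ''pos'' (NConst 0) (cell ''L''),
      leg_program R1 Leftward ''f3'' ''k3'' (cell ''by''), leg_program R1 Rightward ''f4'' ''k4'' (cell ''L'')]"

text \<open>The choice of \<open>p\<close>, \<open>u\<close> and \<open>v\<close> is unrolled into
  eight copies of the search, so it adds a constant factor and no further nesting of loops.\<close>

definition configurations :: "(pad \<times> bool \<times> bool) list" where
  "configurations = List.product [Pad1, Pad2] (List.product [False, True] [False, True])"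

definition configuration_program :: "pad \<times> bool \<times> bool \<Rightarrow> program" where
  "configuration_program = (\<lambda>(p, u, v). block [prepare p u v, search u v])"

definition scheduler :: program where
  "scheduler = block [block (map configuration_program configurations), write_schedule]"

definition emitted :: "reclaimer \<Rightarrow> trajectory \<Rightarrow> machine_state \<Rightarrow> bool" where
  "emitted k ps \<sigma> \<longleftrightarrow> trajectory_output \<sigma> (len_of k) (dir_of k) (pile_of k) (dur_of k) ps"

lemma sign_signum [simp]: "real_of_int (sign D) = signum D"
  by (cases D) auto

lemma depth_emit [simp]: "depth (emit k c pile d) = 0"
  by (simp add: emit_def)

lemma written_emit [simp]:
  "written_regs (emit k c pile d) = {len_of k}"
  "written_arrays (emit k c pile d) = {''t'', dir_of k, pile_of k, dur_of k}"
  by (auto simp: emit_def)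

text \<open>The stockpile number may depend on registers only, because \<open>emit\<close> changes
  arrays before it evaluates \<open>pile\<close>.\<close>

lemma emitted_emit:
  assumes "emitted k ps \<sigma>" and "move_code m = (c, z)"
    and "\<And>\<sigma>'. regs \<sigma>' = regs \<sigma> \<Longrightarrow> rval pile \<sigma>' = z"
  shows "emitted k (ps @ moving [(m, rval d \<sigma>)]) (run (emit k c pile d) \<sigma>)"
proof (cases "0 < rval d \<sigma>")
  case False
  then show ?thesis using assms(1) by (cases k) (simp_all add: emitted_def trajectory_output_def emit_def)
next
  case True
  show ?thesis
    using assms True by (cases k) (auto simp: emitted_def trajectory_output_def emit_def nth_append less_Suc_eq)
qed

lemma emitted_cong:
  assumes "regs \<sigma>' (len_of k) = regs \<sigma> (len_of k)" "arrays \<sigma>' (dir_of k) = arrays \<sigma> (dir_of k)"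
    "arrays \<sigma>' (pile_of k) = arrays \<sigma> (pile_of k)" "arrays \<sigma>' (dur_of k) = arrays \<sigma> (dur_of k)"
  shows "emitted k ps \<sigma>' = emitted k ps \<sigma>"
  using assms by (simp add: emitted_def trajectory_output_def)

lemma names_neq [simp]:
  "len_of k \<noteq> ''g''" "''g'' \<noteq> len_of k" "len_of k \<noteq> ''i''" "''i'' \<noteq> len_of k"
  "dir_of k \<noteq> ''pos''" "pile_of k \<noteq> ''pos''" "dur_of k \<noteq> ''pos''"
  "''pos'' \<noteq> dir_of k" "''pos'' \<noteq> pile_of k" "''pos'' \<noteq> dur_of k"
  by (cases k; simp)+

lemma written_leg [simp]:
  "written_regs (travel k D e) = {len_of k}" "written_arrays (travel k D e) = {''t'', dir_of k, pile_of k, dur_of k}"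
  "written_regs (leg_program k D f m e) = {''i'', ''g'', len_of k}"
  "written_arrays (leg_program k D f m e) = {''t'', dir_of k, pile_of k, dur_of k, ''pos''}"
  "written_regs (visit k D) = {len_of k}" "written_arrays (visit k D) = {''t'', dir_of k, pile_of k, dur_of k, ''pos''}"
  by (auto simp: travel_def leg_program_def visit_def)

lemma depth_leg [simp]: "depth (travel k D e) = 0" "depth (visit k D) = 0"
  by (simp_all add: travel_def visit_def)

section \<open>Correctness of the written schedule\<close>

context yard
begin

lemma frame_inputs:
  assumes "written_regs c \<inter> {''n'', ''n1''} = {}" "written_arrays c \<inter> {''L'', ''s'', ''l'', ''r''} = {}"
  shows "frame c inputs"
  unfolding frame_def
proof (intro allI impI)
  fix \<sigma> \<sigma>' assume a: "agree c \<sigma> \<sigma>'" and "inputs \<sigma>"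
  then show "inputs \<sigma>'"
    by (simp add: inputs_def disjoint_agree(1)[OF a assms(1)] disjoint_agree(2)[OF a assms(2)])
qed

definition at_pos :: "reclaimer \<Rightarrow> trajectory \<Rightarrow> real \<Rightarrow> machine_state \<Rightarrow> bool" where
  "at_pos k ps x \<sigma> \<longleftrightarrow> emitted k ps \<sigma> \<and> arrays \<sigma> ''pos'' 0 = x"

lemma travel_run:
  fixes x :: real
  assumes "at_pos k ps x \<sigma>" "inputs \<sigma>"
  shows "emitted k (ps @ moving [(Travel D, signum D * (rval e \<sigma> - x) / speed Y)]) (run (travel k D e) \<sigma>)"
proof -
  let ?d = "RDiv (RMul (RConst (sign D)) (RSub e (cell ''pos''))) (cell ''s'')"
  have d: "rval ?d \<sigma> = signum D * (rval e \<sigma> - x) / speed Y"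
    using assms by (simp add: at_pos_def inputs_def)
  have "emitted k (ps @ moving [(Travel D, rval ?d \<sigma>)]) (run (emit k (sign D) (RConst 0) ?d) \<sigma>)"
    by (rule emitted_emit) (use assms in \<open>simp_all add: at_pos_def\<close>)
  then show ?thesis unfolding travel_def d .
qed

lemma visit_run:
  fixes x :: real
  assumes at: "at_pos k ps x \<sigma>" and inp: "inputs \<sigma>" and j: "regs \<sigma> ''g'' = j" "j \<in> {1..num Y}"
  shows "at_pos k (ps @ moving [(Travel D, signum D * (real_of_int (entry Y j D) - x) / speed Y),
    (Reclaim j D, real_of_int (right_end Y j - left_end Y j))]) (exit Y j D) (run (visit k D) \<sigma>)"
proof -
  let ?c1 = "travel k D (entry_exp D)"
  let ?c2 = "emit k (sign D) (ROfNat (NReg ''g'')) (RSub (RRead ''r'' (NReg ''g'')) (RRead ''l'' (NReg ''g'')))"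
  define \<sigma>1 where "\<sigma>1 = run ?c1 \<sigma>"
  define \<sigma>2 where "\<sigma>2 = run ?c2 \<sigma>1"
  have lr: "arrays \<sigma> ''l'' j = left_end Y j" "arrays \<sigma> ''r'' j = right_end Y j"
    using inp j by (simp_all add: inputs_def)
  have e: "rval (entry_exp D) \<sigma> = entry Y j D" using lr j by (cases D) simp_all
  have 1: "emitted k (ps @ moving [(Travel D, signum D * (real_of_int (entry Y j D) - x) / speed Y)]) \<sigma>1"
    using travel_run[OF at inp, of D "entry_exp D"] unfolding e \<sigma>1_def by simp
  have a1: "agree ?c1 \<sigma> \<sigma>1" and a2: "agree ?c2 \<sigma>1 \<sigma>2" unfolding \<sigma>1_def \<sigma>2_def by (rule run_agree)+
  have s1: "regs \<sigma>1 ''g'' = j" "arrays \<sigma>1 ''l'' = arrays \<sigma> ''l''" "arrays \<sigma>1 ''r'' = arrays \<sigma> ''r''"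
    using a1 j by (cases k; simp add: agree_def travel_def)+
  have s2: "regs \<sigma>2 ''g'' = j" "arrays \<sigma>2 ''l'' = arrays \<sigma> ''l''" "arrays \<sigma>2 ''r'' = arrays \<sigma> ''r''"
    using a2 s1 by (cases k; simp add: agree_def)+
  have d: "rval (RSub (RRead ''r'' (NReg ''g'')) (RRead ''l'' (NReg ''g''))) \<sigma>1 = right_end Y j - left_end Y j"
    using s1 lr by simp
  have 2: "emitted k ((ps @ moving [(Travel D, signum D * (real_of_int (entry Y j D) - x) / speed Y)]) @
      moving [(Reclaim j D, real_of_int (right_end Y j - left_end Y j))]) \<sigma>2"
    unfolding \<sigma>2_def d[symmetric] by (rule emitted_emit[OF 1]) (use s1 in simp_all)
  have x: "rval (exit_exp D) \<sigma>2 = exit Y j D" using s2 lr by (cases D) simp_all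
  have "run (visit k D) \<sigma> = run (Write ''pos'' (NConst 0) (exit_exp D)) \<sigma>2"
    by (simp add: visit_def \<sigma>1_def \<sigma>2_def del: filter.simps)
  then show ?thesis using 2 x
    by (simp add: at_pos_def emitted_cong[of "\<sigma>2\<lparr>arrays := (arrays \<sigma>2)(''pos'' := f)\<rparr>" k \<sigma>2 for f]
        split: if_splits)
qed

definition pile_list :: "direction \<Rightarrow> nat \<Rightarrow> nat \<Rightarrow> nat list" where
  "pile_list D f m = (if D = Rightward then [f + 1..<f + m + 1] else rev [f + 1..<f + m + 1])"

lemma length_pile_list [simp]: "length (pile_list D f m) = m"
  by (simp add: pile_list_def)

lemma pile_list_nth:
  "i < m \<Longrightarrow> pile_list D f m ! i = (if D = Rightward then f + Suc i else f + (m - i))"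
  by (auto simp: pile_list_def rev_nth simp del: upt_Suc)

lemma set_pile_list: "set (pile_list D f m) = {f + 1..f + m}"
  by (auto simp: pile_list_def)

text \<open>The end point \<open>e\<close> is evaluated again after the loop. It is therefore
  restricted to expressions whose cells a leg does not write.\<close>

lemma leg_triple:
  assumes sub: "{F + 1..F + m} \<subseteq> {1..num Y}" and m: "m \<le> num Y"
    and fm: "f \<notin> {''i'', ''g'', len_of k}" "mr \<notin> {''i'', ''g'', len_of k}"
    and e: "e \<in> {cell ''bx'', cell ''by'', cell ''L'', RConst 0}"
  shows "triple M (\<lambda>\<sigma>. (inputs \<sigma> \<and> regs \<sigma> f = F \<and> regs \<sigma> mr = m \<and> rval e \<sigma> = y) \<and> at_pos k ps x \<sigma>)
    (leg_program k D f mr e)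
    (\<lambda>\<sigma>. (inputs \<sigma> \<and> regs \<sigma> f = F \<and> regs \<sigma> mr = m \<and> rval e \<sigma> = y) \<and>
      at_pos k (ps @ moving (leg Y D x (pile_list D F m) y)) y \<sigma>)"
proof -
  let ?js = "pile_list D F m"
  let ?E = "\<lambda>\<sigma>. inputs \<sigma> \<and> regs \<sigma> f = F \<and> regs \<sigma> mr = m \<and> rval e \<sigma> = y"
  have frameE: "frame c ?E" if "written_regs c \<subseteq> {''i'', ''g'', len_of k}"
    "written_arrays c \<subseteq> {''t'', dir_of k, pile_of k, dur_of k, ''pos''}" for c
  proof -
    have "written_regs c \<inter> {''n'', ''n1''} = {}" "written_arrays c \<inter> {''L'', ''s'', ''l'', ''r''} = {}"
      and ar: "written_arrays c \<inter> {''bx'', ''by'', ''L''} = {}"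
      using that by (cases k; fastforce)+
    then have "frame c inputs" by (intro frame_inputs)
    moreover have "f \<notin> written_regs c" "mr \<notin> written_regs c" using that fm by blast+
    moreover have "rval e \<sigma>' = rval e \<sigma>" if "agree c \<sigma> \<sigma>'" for \<sigma> \<sigma>'
      using e by (auto simp: disjoint_agree(2)[OF that ar])
    ultimately show ?thesis unfolding frame_def agree_def by metis
  qed
  \<comment> \<open>After \<open>i\<close> stockpiles the output is the sweep over the first
    \<open>i\<close> entries, and the cell \<open>pos\<close> holds the point where that sweep ends,
    from which the next travelling piece is computed.\<close>
  define I where "I i \<sigma> \<longleftrightarrow> ?E \<sigma> \<and> at_pos k (ps @ moving (sweep Y D x (take i ?js))) (sweep_end Y D x (take i ?js)) \<sigma>"
    for i and \<sigma> :: machine_state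
  have atU: "at_pos k qs z (\<sigma>\<lparr>regs := (regs \<sigma>)(r := j)\<rparr>) = at_pos k qs z \<sigma>" if "r \<in> {''i'', ''g''}" for qs z \<sigma> r j
    using that emitted_cong[of "\<sigma>\<lparr>regs := (regs \<sigma>)(r := j)\<rparr>" k \<sigma> qs] by (cases k) (auto simp: at_pos_def)
  have EU: "?E (\<sigma>\<lparr>regs := (regs \<sigma>)(r := j)\<rparr>)" if "?E \<sigma>" "r \<in> {''i'', ''g''}" for \<sigma> r j
  proof -
    have "frame (SetReg r (NConst j)) ?E" using that(2) by (intro frameE) auto
    then show ?thesis using that(1) run_agree[of "SetReg r (NConst j)" \<sigma>] unfolding frame_def by (metis nval.simps(1) run.simps(2))
  qed
  have 1: "triple M (I 0) (For ''i'' (NReg mr) (block [SetReg ''g'' (pile_exp D f mr), visit k D])) (I m)"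
  proof (rule triple_For)
    show "m \<le> M" "1 \<le> M" using m by simp_all
    show "nval (NReg mr) \<sigma> = m" if "I i \<sigma>" for i \<sigma> using that by (simp add: I_def)
    show "I i (\<sigma>\<lparr>regs := (regs \<sigma>)(''i'' := j)\<rparr>)" if "I i \<sigma>" for i j \<sigma>
      using that atU[of "''i''"] EU[of \<sigma> "''i''"] unfolding I_def by blast
    fix i assume i: "i < m"
    show "triple M (\<lambda>\<sigma>. I i \<sigma> \<and> regs \<sigma> ''i'' = i) (block [SetReg ''g'' (pile_exp D f mr), visit k D])
      (\<lambda>\<sigma>. I (Suc i) \<sigma> \<and> regs \<sigma> ''i'' = i)"
    proof (rule triple_run)
      fix \<sigma> assume s: "I i \<sigma> \<and> regs \<sigma> ''i'' = i"
      let ?j = "?js ! i"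
      define \<sigma>1 where "\<sigma>1 = \<sigma>\<lparr>regs := (regs \<sigma>)(''g'' := ?j)\<rparr>"
      have E: "?E \<sigma>" using s by (simp add: I_def)
      have j: "nval (pile_exp D f mr) \<sigma> = ?j" using E s i by (cases D) (simp_all add: pile_list_nth)
      have E1: "?E \<sigma>1" unfolding \<sigma>1_def by (rule EU[OF E]) simp
      have at1: "at_pos k (ps @ moving (sweep Y D x (take i ?js))) (sweep_end Y D x (take i ?js)) \<sigma>1"
        using s unfolding \<sigma>1_def I_def by (simp add: atU)
      have "?j \<in> {1..num Y}" using sub set_pile_list nth_mem[of i ?js] i by (metis length_pile_list subsetD)
      then have at2: "at_pos k ((ps @ moving (sweep Y D x (take i ?js))) @
          moving [(Travel D, signum D * (real_of_int (entry Y ?j D) - sweep_end Y D x (take i ?js)) / speed Y),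
          (Reclaim ?j D, real_of_int (right_end Y ?j - left_end Y ?j))]) (exit Y ?j D) (run (visit k D) \<sigma>1)"
        using E1 by (intro visit_run[OF at1]) (simp_all add: \<sigma>1_def)
      have take: "take (Suc i) ?js = take i ?js @ [?j]" using i by (simp add: take_Suc_conv_app_nth)
      have "at_pos k (ps @ moving (sweep Y D x (take (Suc i) ?js))) (sweep_end Y D x (take (Suc i) ?js)) (run (visit k D) \<sigma>1)"
        using at2 unfolding take sweep_snoc sweep_end_snoc by (simp del: filter.simps)
      moreover have "frame (visit k D) ?E" by (rule frameE) auto
      then have "?E (run (visit k D) \<sigma>1)" using E1 run_agree unfolding frame_def by blast
      moreover have "regs (run (visit k D) \<sigma>1) ''i'' = i"
        using run_agree[of "visit k D" \<sigma>1] s by (simp add: agree_def \<sigma>1_def)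
      moreover have "run (block [SetReg ''g'' (pile_exp D f mr), visit k D]) \<sigma> = run (visit k D) \<sigma>1"
        by (simp add: j \<sigma>1_def)
      ultimately show "I (Suc i) (run (block [SetReg ''g'' (pile_exp D f mr), visit k D]) \<sigma>) \<and>
          regs (run (block [SetReg ''g'' (pile_exp D f mr), visit k D]) \<sigma>) ''i'' = i"
        unfolding I_def by simp
    qed simp
  qed
  let ?last = "block [travel k D e, Write ''pos'' (NConst 0) e]"
  have 2: "triple M (I m) ?last (\<lambda>\<sigma>. ?E \<sigma> \<and> at_pos k (ps @ moving (leg Y D x ?js y)) y \<sigma>)"
  proof (rule triple_run)
    fix \<sigma> assume s: "I m \<sigma>"
    define \<sigma>1 where "\<sigma>1 = run (travel k D e) \<sigma>"
    have E: "?E \<sigma>" using s by (simp add: I_def)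
    have "frame (travel k D e) ?E" "frame ?last ?E" by (rule frameE; auto)+
    then have E1: "?E \<sigma>1" and E2: "?E (run ?last \<sigma>)" using E run_agree unfolding frame_def \<sigma>1_def by blast+
    have "at_pos k (ps @ moving (sweep Y D x ?js)) (sweep_end Y D x ?js) \<sigma>"
      using s by (simp add: I_def)
    from travel_run[OF this, of D e] E
    have "emitted k (ps @ moving (leg Y D x ?js y)) \<sigma>1"
      unfolding \<sigma>1_def leg_def by (simp del: filter.simps)
    then have "at_pos k (ps @ moving (leg Y D x ?js y)) y (run ?last \<sigma>)"
      using E1 by (simp add: at_pos_def emitted_cong[of "\<sigma>1\<lparr>arrays := (arrays \<sigma>1)(''pos'' := f)\<rparr>" k \<sigma>1 for f] flip: \<sigma>1_def)
    then show "?E (run ?last \<sigma>) \<and> at_pos k (ps @ moving (leg Y D x ?js y)) y (run ?last \<sigma>)"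
      using E2 by blast
  qed simp
  have "leg_program k D f mr e = Then (For ''i'' (NReg mr) (block [SetReg ''g'' (pile_exp D f mr), visit k D])) ?last"
    by (simp add: leg_program_def)
  then have "triple M (I 0) (leg_program k D f mr e) (\<lambda>\<sigma>. ?E \<sigma> \<and> at_pos k (ps @ moving (leg Y D x ?js y)) y \<sigma>)"
    using triple_Then[OF 1 2] by simp
  then show ?thesis by (rule triple_weaken) (auto simp: I_def)
qed

lemma frame_recorded:
  assumes "written_regs c \<inter> {''f1'', ''k1'', ''f2'', ''k2'', ''f3'', ''k3'', ''f4'', ''k4''} = {}"
    and "written_arrays c \<inter> {''bx'', ''by'', ''bd''} = {}"
  shows "frame c (recorded z)"
  unfolding frame_def
proof (intro allI impI)
  fix \<sigma> \<sigma>' assume a: "agree c \<sigma> \<sigma>'" and "recorded z \<sigma>"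
  then show "recorded z \<sigma>'"
    by (cases z) (simp add: recorded.simps disjoint_agree(1)[OF a assms(1)] disjoint_agree(2)[OF a assms(2)])
qed

lemma frame_emitted:
  assumes "len_of k \<notin> written_regs c" "{dir_of k, pile_of k, dur_of k} \<inter> written_arrays c = {}"
  shows "frame c (emitted k ps)"
  unfolding frame_def agree_def using assms by (auto simp: emitted_def trajectory_output_def)

lemma triple_start:
  "triple M (\<lambda>\<sigma>. True) (SetReg (len_of k) (NConst 0)) (emitted k [])"
  by (rule triple_run) (simp_all add: emitted_def trajectory_output_def)

lemma triple_place:
  assumes "e \<in> {RConst 0, cell ''L''}"
  shows "triple M (\<lambda>\<sigma>. emitted k ps \<sigma> \<and> rval e \<sigma> = x) (Write ''pos'' (NConst 0) e) (at_pos k ps x)"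
  by (rule triple_run) (use assms in \<open>auto simp: at_pos_def emitted_def trajectory_output_def\<close>)

lemma near_pile_list:
  "pile_list Rightward (offset Y p) i = near_list Y p i" "pile_list Leftward (offset Y p) i = rev (near_list Y p i)"
  by (simp_all add: pile_list_def near_list_def)

lemma far_pile_list:
  assumes "i \<le> pile_num Y p"
  shows "pile_list Rightward (offset Y p + i) (pile_num Y p - i) = far_list Y p i"
    and "pile_list Leftward (offset Y p + i) (pile_num Y p - i) = rev (far_list Y p i)"
  using assms by (simp_all add: pile_list_def far_list_def)

lemma write_schedule_triple:
  assumes adm: "admissible Y p a b"
  shows "triple M (\<lambda>\<sigma>. inputs \<sigma> \<and> recorded (p, u, v, a, b) \<sigma>) write_schedule
    (\<lambda>\<sigma>. schedule_output \<sigma> (candidate_plan Y p u v a b))"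
proof -
  define c where "c = split_at p a b"
  define o0 where "o0 = pick u p"
  define o1 where "o1 = pick v p"
  define w where "w = delay Y p u v a b"
  let ?q0 = "other_pad o0" and ?q1 = "other_pad o1" and ?p = "peak Y c" and ?v = "valley Y c"
  let ?L = "real_of_int (pad_length Y)"
  let ?r = "recorded (p, u, v, a, b)"
  have cp: "c r \<le> pile_num Y r" for r
    using adm is_split_split_at[of p a b] by (simp add: admissible_def c_def is_split_def)
  have num: "pile_num Y r \<le> num Y" for r using pile_num_le[of r] by simp
  have nsub: "{offset Y r + 1..offset Y r + c r} \<subseteq> {1..num Y}" for r
    using near_sub[OF cp[of r]] stockpiles_sub[of r] unfolding near_def by blast
  have fsub: "{offset Y r + c r + 1..offset Y r + c r + (pile_num Y r - c r)} \<subseteq> {1..num Y}" for r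
  proof -
    have "offset Y r + c r + (pile_num Y r - c r) = offset Y r + pile_num Y r" using cp[of r] by simp
    then show ?thesis using far_sub[of r "c r"] stockpiles_sub[of r] unfolding far_def by (metis subset_trans)
  qed
  have rec: "arrays \<sigma> ''bx'' 0 = ?p \<and> arrays \<sigma> ''by'' 0 = ?v \<and> arrays \<sigma> ''bd'' 0 = w \<and>
      regs \<sigma> ''f1'' = offset Y o0 \<and> regs \<sigma> ''k1'' = c o0 \<and>
      regs \<sigma> ''f2'' = offset Y ?q0 \<and> regs \<sigma> ''k2'' = c ?q0 \<and>
      regs \<sigma> ''f3'' = offset Y o1 + c o1 \<and> regs \<sigma> ''k3'' = pile_num Y o1 - c o1 \<and>
      regs \<sigma> ''f4'' = offset Y ?q1 + c ?q1 \<and> regs \<sigma> ''k4'' = pile_num Y ?q1 - c ?q1" if "?r \<sigma>" for \<sigma>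
    using that by (simp add: recorded.simps Let_def c_def o0_def o1_def w_def)
  let ?B = "\<lambda>\<sigma>. inputs \<sigma> \<and> ?r \<sigma>"
  have frB: "frame cc ?B" if "written_regs cc \<subseteq> {''i'', ''g'', ''len0'', ''len1''}"
    "written_arrays cc \<subseteq> {''t'', ''dir0'', ''pile0'', ''dur0'', ''dir1'', ''pile1'', ''dur1'', ''pos''}" for cc
    using that by (intro frame_conj frame_inputs frame_recorded) fastforce+
  define T1 where "T1 = moving (leg Y Rightward 0 (near_list Y o0 (c o0)) ?p)"
  define T2 where "T2 = moving (leg Y Leftward ?p (rev (near_list Y ?q0 (c ?q0))) 0)"
  define T3 where "T3 = moving (leg Y Leftward ?L (rev (far_list Y o1 (c o1))) ?v)"
  define T4 where "T4 = moving (leg Y Rightward ?v (far_list Y ?q1 (c ?q1)) ?L)"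
  let ?W = "moving [(Wait, w)]"
  have 1: "triple M (\<lambda>\<sigma>. ?B \<sigma> \<and> True) (SetReg ''len0'' (NConst 0)) (\<lambda>\<sigma>. ?B \<sigma> \<and> emitted R0 [] \<sigma>)"
    using triple_start[of R0] by (intro triple_frame frB) simp_all
  have 2: "triple M (\<lambda>\<sigma>. ?B \<sigma> \<and> emitted R0 [] \<sigma> \<and> rval (RConst 0) \<sigma> = 0) (Write ''pos'' (NConst 0) (RConst 0))
      (\<lambda>\<sigma>. ?B \<sigma> \<and> at_pos R0 [] 0 \<sigma>)"
    by (intro triple_frame triple_place frB) simp_all
  note l3 = leg_triple[OF nsub[of o0] order_trans[OF cp num], of "''f1''" R0 "''k1''" "cell ''bx''" ?p "[]" 0 Rightward,
      unfolded near_pile_list, folded T1_def, simplified append_Nil]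
  have 3: "triple M (\<lambda>\<sigma>. ?B \<sigma> \<and> (inputs \<sigma> \<and> regs \<sigma> ''f1'' = offset Y o0 \<and> regs \<sigma> ''k1'' = c o0 \<and> rval (cell ''bx'') \<sigma> = ?p)
        \<and> at_pos R0 [] 0 \<sigma>) (leg_program R0 Rightward ''f1'' ''k1'' (cell ''bx''))
      (\<lambda>\<sigma>. ?B \<sigma> \<and> (inputs \<sigma> \<and> regs \<sigma> ''f1'' = offset Y o0 \<and> regs \<sigma> ''k1'' = c o0 \<and> rval (cell ''bx'') \<sigma> = ?p)
        \<and> at_pos R0 T1 ?p \<sigma>)"
    by (intro triple_frame frB l3) simp_all
  note l4 = leg_triple[OF nsub[of ?q0] order_trans[OF cp num], of "''f2''" R0 "''k2''" "RConst 0" 0 T1 ?p Leftward,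
      unfolded near_pile_list, folded T2_def]
  have 4: "triple M (\<lambda>\<sigma>. ?B \<sigma> \<and> (inputs \<sigma> \<and> regs \<sigma> ''f2'' = offset Y ?q0 \<and> regs \<sigma> ''k2'' = c ?q0 \<and> rval (RConst 0) \<sigma> = 0)
        \<and> at_pos R0 T1 ?p \<sigma>) (leg_program R0 Leftward ''f2'' ''k2'' (RConst 0))
      (\<lambda>\<sigma>. ?B \<sigma> \<and> (inputs \<sigma> \<and> regs \<sigma> ''f2'' = offset Y ?q0 \<and> regs \<sigma> ''k2'' = c ?q0 \<and> rval (RConst 0) \<sigma> = 0)
        \<and> at_pos R0 (T1 @ T2) 0 \<sigma>)"
    by (intro triple_frame frB l4) simp_all
  \<comment> \<open>The finished output of \<open>R0\<close> joins the framed facts: from here on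
    only the output arrays of \<open>R1\<close> and scratch memory are written.\<close>
  let ?C = "\<lambda>\<sigma>. ?B \<sigma> \<and> emitted R0 (T1 @ T2) \<sigma>"
  have frC: "frame cc ?C" if "written_regs cc \<subseteq> {''i'', ''g'', ''len1''}"
    "written_arrays cc \<subseteq> {''t'', ''dir1'', ''pile1'', ''dur1'', ''pos''}" for cc
  proof (rule frame_conj)
    show "frame cc ?B" by (rule frB; rule order_trans[OF that(1)] order_trans[OF that(2)]; blast)
    show "frame cc (emitted R0 (T1 @ T2))"
    proof (rule frame_emitted)
      show "len_of R0 \<notin> written_regs cc" using that(1) by auto
      show "{dir_of R0, pile_of R0, dur_of R0} \<inter> written_arrays cc = {}" using that(2) by auto
    qed
  qed
  have 5: "triple M (\<lambda>\<sigma>. ?C \<sigma> \<and> True) (SetReg ''len1'' (NConst 0)) (\<lambda>\<sigma>. ?C \<sigma> \<and> emitted R1 [] \<sigma>)"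
    using triple_start[of R1] by (intro triple_frame frC) simp_all
  have e: "triple M (\<lambda>\<sigma>. emitted R1 [] \<sigma> \<and> rval (cell ''bd'') \<sigma> = w) (emit R1 0 (RConst 0) (cell ''bd'')) (emitted R1 ?W)"
  proof (rule triple_run)
    fix \<sigma> assume s: "emitted R1 [] \<sigma> \<and> rval (cell ''bd'') \<sigma> = w"
    have "emitted R1 ([] @ moving [(Wait, rval (cell ''bd'') \<sigma>)]) (run (emit R1 0 (RConst 0) (cell ''bd'')) \<sigma>)"
      by (rule emitted_emit) (use s in simp_all)
    then show "emitted R1 ?W (run (emit R1 0 (RConst 0) (cell ''bd'')) \<sigma>)"
      using s by (simp only: append_Nil)
  qed simp
  have 6: "triple M (\<lambda>\<sigma>. ?C \<sigma> \<and> emitted R1 [] \<sigma> \<and> rval (cell ''bd'') \<sigma> = w) (emit R1 0 (RConst 0) (cell ''bd''))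
      (\<lambda>\<sigma>. ?C \<sigma> \<and> emitted R1 ?W \<sigma>)"
    by (intro triple_frame frC e) simp_all
  have 7: "triple M (\<lambda>\<sigma>. ?C \<sigma> \<and> emitted R1 ?W \<sigma> \<and> rval (cell ''L'') \<sigma> = ?L) (Write ''pos'' (NConst 0) (cell ''L''))
      (\<lambda>\<sigma>. ?C \<sigma> \<and> at_pos R1 ?W ?L \<sigma>)"
    by (intro triple_frame triple_place frC) simp_all
  have m1: "pile_num Y r - c r \<le> num Y" for r using num[of r] by simp
  note l8 = leg_triple[OF fsub[of o1] m1, of "''f3''" R1 "''k3''" "cell ''by''" ?v ?W ?L Leftward,
      unfolded far_pile_list[OF cp], folded T3_def]
  have 8: "triple M (\<lambda>\<sigma>. ?C \<sigma> \<and> (inputs \<sigma> \<and> regs \<sigma> ''f3'' = offset Y o1 + c o1 \<and> regs \<sigma> ''k3'' = pile_num Y o1 - c o1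
        \<and> rval (cell ''by'') \<sigma> = ?v) \<and> at_pos R1 ?W ?L \<sigma>) (leg_program R1 Leftward ''f3'' ''k3'' (cell ''by''))
      (\<lambda>\<sigma>. ?C \<sigma> \<and> (inputs \<sigma> \<and> regs \<sigma> ''f3'' = offset Y o1 + c o1 \<and> regs \<sigma> ''k3'' = pile_num Y o1 - c o1
        \<and> rval (cell ''by'') \<sigma> = ?v) \<and> at_pos R1 (?W @ T3) ?v \<sigma>)"
    by (intro triple_frame frC l8) simp_all
  note l9 = leg_triple[OF fsub[of ?q1] m1, of "''f4''" R1 "''k4''" "cell ''L''" ?L "?W @ T3" ?v Rightward,
      unfolded far_pile_list[OF cp], folded T4_def]
  have 9: "triple M (\<lambda>\<sigma>. ?C \<sigma> \<and> (inputs \<sigma> \<and> regs \<sigma> ''f4'' = offset Y ?q1 + c ?q1 \<and> regs \<sigma> ''k4'' = pile_num Y ?q1 - c ?q1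
        \<and> rval (cell ''L'') \<sigma> = ?L) \<and> at_pos R1 (?W @ T3) ?v \<sigma>) (leg_program R1 Rightward ''f4'' ''k4'' (cell ''L''))
      (\<lambda>\<sigma>. ?C \<sigma> \<and> (inputs \<sigma> \<and> regs \<sigma> ''f4'' = offset Y ?q1 + c ?q1 \<and> regs \<sigma> ''k4'' = pile_num Y ?q1 - c ?q1
        \<and> rval (cell ''L'') \<sigma> = ?L) \<and> at_pos R1 ((?W @ T3) @ T4) ?L \<sigma>)"
    by (intro triple_frame frC l9) simp_all
  have out: "schedule_output \<sigma> (candidate_plan Y p u v a b)"
    if "emitted R0 (T1 @ T2) \<sigma>" "emitted R1 ((?W @ T3) @ T4) \<sigma>" for \<sigma>
  proof -
    have "candidate_plan Y p u v a b R0 = T1 @ T2" "candidate_plan Y p u v a b R1 = (?W @ T3) @ T4"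
      by (simp_all add: candidate_plan_def plan.simps trajectory_of_def T1_def T2_def T3_def T4_def
          flip: c_def o0_def o1_def w_def)
    then show ?thesis using that by (simp add: schedule_output_def emitted_def)
  qed
  have inL: "arrays \<sigma> ''L'' 0 = ?L" if "inputs \<sigma>" for \<sigma> using that by (simp add: inputs_def)
  have fin: "schedule_output \<sigma> (candidate_plan Y p u v a b)"
    if "?C \<sigma> \<and> at_pos R1 ((?W @ T3) @ T4) ?L \<sigma>" for \<sigma>
    using that out by (simp add: at_pos_def)
  show ?thesis
    unfolding write_schedule_def
    by (rule triple_block[OF triple_pre[OF 1] triple_block[OF triple_pre[OF 2] triple_block[OF triple_pre[OF 3]
      triple_block[OF triple_pre[OF 4] triple_block[OF triple_pre[OF 5] triple_block[OF triple_pre[OF 6]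
      triple_block[OF triple_pre[OF 7] triple_block[OF triple_pre[OF 8] triple_block[OF triple_pre[OF 9]
      triple_weaken[OF triple_block_Nil _ fin]]]]]]]]]])
      (simp_all add: rec inL at_pos_def)
qed

section \<open>Assembling the program\<close>

fun candidates_of :: "pad \<times> bool \<times> bool \<Rightarrow> candidate set" where
  "candidates_of (p, u, v) = {(p, u, v, a, b) |a b. admissible Y p a b}"

lemma written_search [simp]:
  "written_regs (prepare p u v) = {''op'', ''np'', ''oq'', ''nq'', ''i'', ''j''}"
  "written_arrays (prepare p u v) = {''k'', ''lp'', ''rp'', ''wp'', ''lq'', ''rq'', ''wq'',
     ''glp'', ''grp'', ''glq'', ''grq'', ''t''}"
  by (auto simp: prepare_def)

lemma configuration_triple:
  "triple M (\<lambda>\<sigma>. best_of C \<sigma> \<and> inputs \<sigma>) (configuration_program x) (\<lambda>\<sigma>. best_of (C \<union> candidates_of x) \<sigma> \<and> inputs \<sigma>)"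
proof -
  obtain p u v where x: "x = (p, u, v)" by (cases x)
  have 1: "triple M (\<lambda>\<sigma>. best_of C \<sigma> \<and> inputs \<sigma>) (prepare p u v) (\<lambda>\<sigma>. best_of C \<sigma> \<and> tabled p u v \<sigma>)"
    by (intro triple_frame prepare_triple frame_best_of) simp_all
  show ?thesis
    unfolding configuration_program_def x prod.case
    by (rule triple_weaken[OF triple_block[OF 1 triple_block[OF triple_weaken[OF search_triple] triple_block_Nil]]])
      (auto simp: tabled_simps)
qed

lemma configurations_triple:
  "triple M (\<lambda>\<sigma>. best_of C \<sigma> \<and> inputs \<sigma>) (block (map configuration_program xs))
    (\<lambda>\<sigma>. best_of (C \<union> (\<Union>x\<in>set xs. candidates_of x)) \<sigma> \<and> inputs \<sigma>)"
proof (induction xs arbitrary: C)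
  case Nil
  show ?case using triple_block_Nil by simp
next
  case (Cons x xs)
  have eq: "C \<union> (\<Union>y\<in>set (x # xs). candidates_of y) = (C \<union> candidates_of x) \<union> (\<Union>y\<in>set xs. candidates_of y)"
    by auto
  show ?case unfolding eq list.map
    by (rule triple_block[OF configuration_triple Cons.IH])
qed

lemma all_candidates:
  "(p, u, v, a, b) \<in> (\<Union>x\<in>set configurations. candidates_of x) \<longleftrightarrow> admissible Y p a b"
proof -
  have "(p, u, v) \<in> set configurations" by (cases p; cases u; cases v) (simp_all add: configurations_def)
  then show ?thesis by force
qed

lemma scheduler_correct:
  "\<exists>t \<sigma> S. exec scheduler (input_state Y) t \<sigma> \<and> t \<le> weight scheduler * M ^ depth scheduler \<and>
    schedule_output \<sigma> S \<and> optimal_contiguous_unimodal Y S"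
proof -
  define All where "All = (\<Union>x\<in>set configurations. candidates_of x)"
  note all = all_candidates[folded All_def]
  have "best_of {} (input_state Y)" "inputs (input_state Y)"
    by (simp_all add: best_of_def inputs_def input_state_def)
  \<comment> \<open>Giving everything to \<open>R0\<close> is always admissible, because the left
    end beyond the last stockpile defaults to \<open>pad_length Y\<close>. So some candidate is
    recorded in the end.\<close>
  have nonempty: "All \<noteq> {}"
  proof -
    have "admissible Y Pad1 (pile_num Y Pad1) (pile_num Y Pad2)"
      using right_at_bounds(2)[of Pad2 "pile_num Y Pad2"]
      by (simp add: admissible_def crossing_def left_at_def)
    then show ?thesis using all[of Pad1 False False] by blast
  qed
  have "triple M (\<lambda>\<sigma>. best_of All \<sigma> \<and> inputs \<sigma>) write_schedule
    (\<lambda>\<sigma>. \<exists>S. schedule_output \<sigma> S \<and> optimal_contiguous_unimodal Y S)"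
    unfolding triple_def
  proof (intro allI impI)
    fix \<sigma> assume s: "best_of All \<sigma> \<and> inputs \<sigma>"
    then obtain z where z: "z \<in> All" "recorded z \<sigma>" "\<forall>y\<in>All. value_of z \<le> value_of y"
      using nonempty unfolding best_of_def by (auto split: if_splits)
    obtain p u v a b where zeq: "z = (p, u, v, a, b)" by (cases z)
    note x = z(1,2)[unfolded zeq]
    have min: "value_of (p, u, v, a, b) \<le> value_of y" if "y \<in> All" for y
      using z(3) that unfolding zeq by blast
    have adm: "admissible Y p a b" using x(1) all by blast
    have "optimal_contiguous_unimodal Y (candidate_plan Y p u v a b)"
    proof (rule best_candidate_optimal[OF adm])
      fix p' u' v' a' b' assume "admissible Y p' a' b'"
      then show "candidate_value Y p u v a b \<le> candidate_value Y p' u' v' a' b'"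
        using min[of "(p', u', v', a', b')"] all by simp
    qed
    then show "\<exists>t \<sigma>'. exec write_schedule \<sigma> t \<sigma>' \<and> t \<le> weight write_schedule * M ^ depth write_schedule \<and>
        (\<exists>S. schedule_output \<sigma>' S \<and> optimal_contiguous_unimodal Y S)"
      using write_schedule_triple[OF adm, of u v] s x(2) unfolding triple_def by blast
  qed
  then have "triple M (\<lambda>\<sigma>. best_of {} \<sigma> \<and> inputs \<sigma>) scheduler
    (\<lambda>\<sigma>. \<exists>S. schedule_output \<sigma> S \<and> optimal_contiguous_unimodal Y S)"
    unfolding scheduler_def
    using configurations_triple[of "{}" configurations, folded All_def]
    by (intro triple_block[OF _ triple_block[OF _ triple_block_Nil]]) simp_all
  then show ?thesis
    using \<open>best_of {} (input_state Y)\<close> \<open>inputs (input_state Y)\<close> unfolding triple_def by blast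
qed

end

section \<open>Running time\<close>

lemma depth_parts:
  "depth (set_pads p) = 0" "depth (load_pad l r w off m) = 1" "depth (add_clamp c dest i z z' y) = 0"
  "depth (gain_table u v dest x m) = 2" "depth update_maxima = 0" "depth (leg_program k D f m e) = 1"
  by (simp_all add: set_pads_def load_pad_def add_clamp_def gain_table_def update_maxima_def leg_program_def)

text \<open>Two nested loops occur in the gain tables (points and stockpiles) and in the search
  (\<open>a\<close> and \<open>c\<close>); a single step of the search is loop-free. This depth is
  the exponent of the time bound.\<close>

lemma depth_configuration: "depth (configuration_program x) = 2"
proof -
  have "depth (search_step u v) = 0" for u v
    by (simp add: search_step_def try_candidate_def depth_parts)
  then have "depth (search u v) = 2" "depth (prepare p u v) = 2" for p u v
    by (simp_all add: search_def prepare_def depth_parts)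
  then show ?thesis by (cases x) (simp add: configuration_program_def)
qed

lemma depth_scheduler: "depth scheduler = 2"
  by (simp add: scheduler_def configurations_def write_schedule_def depth_parts depth_configuration)

theorem theorem4:
  shows "\<exists>(prog :: program) (c :: nat). \<forall>Y :: stockyard. valid_stockyard Y \<longrightarrow>
           (\<exists>t \<sigma> S. exec prog (input_state Y) t \<sigma> \<and> t \<le> c * (num Y)\<^sup>2 \<and>
                    schedule_output \<sigma> S \<and> optimal_contiguous_unimodal Y S)"
\<comment> \<open>The factor 9 absorbs the shift in the number of iterations:
  \<open>num Y + 2\<close> is at most \<open>3 * num Y\<close>, since there is at least one
  stockpile.\<close>
proof (rule exI[of _ scheduler], rule exI[of _ "9 * weight scheduler"], intro allI impI)
  fix Y :: stockyard
  assume "valid_stockyard Y"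
  then interpret yard Y by unfold_locales
  obtain t \<sigma> S where t: "exec scheduler (input_state Y) t \<sigma>" "t \<le> weight scheduler * (num Y + 2)\<^sup>2"
    and S: "schedule_output \<sigma> S" "optimal_contiguous_unimodal Y S"
    using scheduler_correct unfolding depth_scheduler by blast
  have "(num Y + 2)\<^sup>2 \<le> (3 * num Y)\<^sup>2" using num_pos by (intro power_mono) auto
  then have "weight scheduler * (num Y + 2)\<^sup>2 \<le> weight scheduler * (3 * num Y)\<^sup>2"
    by (rule mult_le_mono2)
  also have "\<dots> = 9 * weight scheduler * (num Y)\<^sup>2" by (simp add: power_mult_distrib)
  finally have "t \<le> 9 * weight scheduler * (num Y)\<^sup>2" by (rule order_trans[OF t(2)])
  then show "\<exists>t \<sigma> S. exec scheduler (input_state Y) t \<sigma> \<and> t \<le> 9 * weight scheduler * (num Y)\<^sup>2 \<and>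
      schedule_output \<sigma> S \<and> optimal_contiguous_unimodal Y S"
    using t(1) S by blast
qed

end
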